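(* Let $G=(\mathcal V,\mathcal E)$ be a locally finite, connected, simple graph with a Markov kernel $K$, and let $\Gamma_K$ be a subgroup of $\mathrm{Aut}_K(G)$. Suppose $(G,K,\Gamma_K)$ is transitive, unimodular, and infinitely accessible. Consider the parking process on $(G,K)$ with car density $p\in[0,1]$. Then: (i) If $p\ge 1/2$, then $V=\infty$ almost surely. Moreover, $\mathbf{E}V_t=(2p-1)t+o(t)$ as $t\to\infty$. (ii) If $p<1/2$, then $V<\infty$ almost surely. Moreover, if $p$ is sufficiently small (i.e. there is $p_0>0$, depending on $(G,K,\Gamma_K)$, such that the following holds for all $p<p_0$), then $\mathbf{E}V<\infty$.
   Context: A (Markov) kernel on $G$ is a function $K:\mathcal V\times\mathcal V\to[0,1]$ with $K(u,v)=0$ if $(u,v)\notin\mathcal E$ and $\sum_{v\in N(u)}K(u,v)=1$, where $N(u)$ is the set of neighbors of $u$. A vertex $u$ is accessible from $v$ if there are adjacent vertices $v=x_0,x_1,\dots,x_n=u$ with $\prod_{i=0}^{n-1}K(x_i,x_{i+1})>0$. $\mathrm{Aut}_K(G)$ is the group of graph automorphisms $\varphi$ of $G$ with $K(\varphi(u),\varphi(v))=K(u,v)$ for all $u,v\in\mathcal V$. For a subgroup $\Gamma_K\le\mathrm{Aut}_K(G)$ put $\Gamma_K(u,v)=\{\varphi\in\Gamma_K:\varphi(u)=v\}$. The triple $(G,K,\Gamma_K)$ is: transitive if $\Gamma_K(u,v)\ne\emptyset$ for all $u,v\in\mathcal V$; unimodular if $|\Gamma_K(u,u)v|=|\Gamma_K(v,v)u|<\infty$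 for all $u,v\in\mathcal V$ (where $\Gamma_K(u,u)v$ is the orbit of $v$ under the stabilizer of $u$); infinitely accessible if there exist $\varphi\in\Gamma_K$ and $u\in\mathcal V$ such that $\{\varphi^n(u):n\ge0\}$ is infinite and $u$ is accessible from $\varphi(u)$. Parking process on $(G,K)$ with density $p$: initially each vertex independently contains one car with probability $p$, and otherwise is a parking spot that fits one car. In discrete time, all unparked cars simultaneously perform independent random walks with transition kernel $K$. When one or more unparked cars move at the same time to a still unoccupied parking spot, exactly one of them parks there forever (each car has i.i.d. uniform $[0,1]$ tie-breaking variables, independent of everything else, one per time step, and the car with the smallest value parks); the others remain unparked and keep walking. Cars arriving at an occupied spot or at a vertex that initially contained a car pass through unaffected. A car visits $v$ at time $t\ge1$ if it is unparked at a neighbor of $v$ at time $t-1$ and moves to $v$ at time $t$ (whether or not it parks there). $V_t^{(v)}$ is the total number of visits to $v$ by cars at times $1,\dots,t$ (with multiplicity), so $V_0^{(v)}=0$, and $V^{(v)}=\lim_{t\to\infty}V_t^{(v)}\in[0,\infty]$. By transitivity the laws of $V_t^{(v)}$ and $V^{(v)}$ do not depend on $v$; $V_t$ and $V$ denote random variables with these laws. *)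

theory Defs
  imports "HOL-Probability.Probability" "HOL-Library.Landau_Symbols" "HOL-Algebra.Group"
begin


text \<open>A graph is given by its adjacency relation; the vertex set is the whole type \<open>'v\<close>.\<close>

definition simple_graph :: "('v \<Rightarrow> 'v \<Rightarrow> bool) \<Rightarrow> bool" where
  "simple_graph E \<longleftrightarrow> symp E \<and> irreflp E"

definition neighbors :: "('v \<Rightarrow> 'v \<Rightarrow> bool) \<Rightarrow> 'v \<Rightarrow> 'v set" where
  "neighbors E u = {v. E u v}"

definition locally_finite_graph :: "('v \<Rightarrow> 'v \<Rightarrow> bool) \<Rightarrow> bool" where
  "locally_finite_graph E \<longleftrightarrow> (\<forall>u. finite (neighbors E u))"

definition connected_graph :: "('v \<Rightarrow> 'v \<Rightarrow> bool) \<Rightarrow> bool" where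
  "connected_graph E \<longleftrightarrow> (\<forall>u v. E\<^sup>*\<^sup>* u v)"

definition markov_kernel :: "('v \<Rightarrow> 'v \<Rightarrow> bool) \<Rightarrow> ('v \<Rightarrow> 'v \<Rightarrow> real) \<Rightarrow> bool" where
  "markov_kernel E K \<longleftrightarrow>
     (\<forall>u v. 0 \<le> K u v \<and> K u v \<le> 1) \<and>
     (\<forall>u v. \<not> E u v \<longrightarrow> K u v = 0) \<and>
     (\<forall>u. (\<Sum>v\<in>neighbors E u. K u v) = 1)"

definition accessible_from ::
    "('v \<Rightarrow> 'v \<Rightarrow> bool) \<Rightarrow> ('v \<Rightarrow> 'v \<Rightarrow> real) \<Rightarrow> 'v \<Rightarrow> 'v \<Rightarrow> bool" where
  "accessible_from E K u v \<longleftrightarrow>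
     (\<exists>(n::nat) x. x 0 = v \<and> x n = u \<and> (\<forall>i<n. E (x i) (x (Suc i))) \<and>
        (\<Prod>i<n. K (x i) (x (Suc i))) > 0)"

definition kernel_aut_group ::
    "('v \<Rightarrow> 'v \<Rightarrow> bool) \<Rightarrow> ('v \<Rightarrow> 'v \<Rightarrow> real) \<Rightarrow> ('v \<Rightarrow> 'v) monoid" where
  "kernel_aut_group E K =
     \<lparr>carrier = {\<phi>. bij \<phi> \<and> (\<forall>u v. E (\<phi> u) (\<phi> v) \<longleftrightarrow> E u v) \<and>
                    (\<forall>u v. K (\<phi> u) (\<phi> v) = K u v)},
      monoid.mult = (\<circ>), one = id\<rparr>"

lemma group_kernel_aut_group: "group (kernel_aut_group E K)"
proof (rule groupI)
  fix \<phi> assume "\<phi> \<in> carrier (kernel_aut_group E K)"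
  then have b: "bij \<phi>" and e: "\<And>u v. E (\<phi> u) (\<phi> v) \<longleftrightarrow> E u v"
    and k: "\<And>u v. K (\<phi> u) (\<phi> v) = K u v"
    by (auto simp: kernel_aut_group_def)
  have r: "\<phi> (inv_into UNIV \<phi> x) = x" for x
    using b by (simp add: bij_is_surj surj_f_inv_f)
  have "inv_into UNIV \<phi> \<in> carrier (kernel_aut_group E K)"
    using b e[of "inv_into UNIV \<phi> _" "inv_into UNIV \<phi> _"] k[of "inv_into UNIV \<phi> _" "inv_into UNIV \<phi> _"]
    by (simp add: kernel_aut_group_def bij_imp_bij_inv r)
  moreover have "inv_into UNIV \<phi> \<circ> \<phi> = id"
    using b by (simp add: bij_is_inj)
  ultimately show "\<exists>\<psi>\<in>carrier (kernel_aut_group E K).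
      \<psi> \<otimes>\<^bsub>kernel_aut_group E K\<^esub> \<phi> = \<one>\<^bsub>kernel_aut_group E K\<^esub>"
    by (intro bexI[of _ "inv_into UNIV \<phi>"]) (simp_all add: kernel_aut_group_def)
qed (auto simp: kernel_aut_group_def bij_comp o_assoc)

definition transporter :: "('v \<Rightarrow> 'v) set \<Rightarrow> 'v \<Rightarrow> 'v \<Rightarrow> ('v \<Rightarrow> 'v) set" where
  "transporter \<Gamma> u v = {\<phi> \<in> \<Gamma>. \<phi> u = v}"

definition stab_orbit :: "('v \<Rightarrow> 'v) set \<Rightarrow> 'v \<Rightarrow> 'v \<Rightarrow> 'v set" where
  "stab_orbit \<Gamma> u v = (\<lambda>\<phi>. \<phi> v) ` transporter \<Gamma> u u"

definition transitive_triple :: "('v \<Rightarrow> 'v) set \<Rightarrow> bool" where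
  "transitive_triple \<Gamma> \<longleftrightarrow> (\<forall>u v. transporter \<Gamma> u v \<noteq> {})"

definition unimodular_triple :: "('v \<Rightarrow> 'v) set \<Rightarrow> bool" where
  "unimodular_triple \<Gamma> \<longleftrightarrow>
     (\<forall>u v. finite (stab_orbit \<Gamma> u v) \<and> finite (stab_orbit \<Gamma> v u) \<and>
        card (stab_orbit \<Gamma> u v) = card (stab_orbit \<Gamma> v u))"

definition infinitely_accessible ::
    "('v \<Rightarrow> 'v \<Rightarrow> bool) \<Rightarrow> ('v \<Rightarrow> 'v \<Rightarrow> real) \<Rightarrow> ('v \<Rightarrow> 'v) set \<Rightarrow> bool" where
  "infinitely_accessible E K \<Gamma> \<longleftrightarrow>
     (\<exists>\<phi>\<in>\<Gamma>. \<exists>u. infinite (range (\<lambda>n::nat. (\<phi> ^^ n) u)) \<and> accessible_from E K u (\<phi> u))"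



text \<open>Cars are named by their starting vertex. An outcome \<open>\<omega>\<close> consists of

  \<^item> for each vertex \<open>x\<close>, whether \<open>x\<close> initially contains a car;
  \<^item> for each car \<open>c\<close>, time \<open>t\<close> and vertex \<open>x\<close>, the vertex to which \<open>c\<close> moves at time \<open>t + 1\<close> if it is
    at \<open>x\<close> at time \<open>t\<close>; these are independent with law \<open>K x\<close>, so that the resulting
    trajectories of different cars are independent Markov chains with kernel \<open>K\<close>;
  \<^item> for each car \<open>c\<close> and time \<open>t\<close>, the tie-breaking variable of \<open>c\<close> at time \<open>t\<close>.

  Trajectories are defined for all vertices and all times; only those of existing, unparked cars
  enter the process.\<close>

type_synonym 'v outcome =
  "('v \<Rightarrow> bool) \<times> ('v \<times> nat \<times> 'v \<Rightarrow> 'v) \<times> ('v \<times> nat \<Rightarrow> real)"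

abbreviation init_car :: "'v outcome \<Rightarrow> 'v \<Rightarrow> bool" where
  "init_car \<omega> \<equiv> fst \<omega>"

abbreviation next_vertex :: "'v outcome \<Rightarrow> 'v \<times> nat \<times> 'v \<Rightarrow> 'v" where
  "next_vertex \<omega> \<equiv> fst (snd \<omega>)"

abbreviation tie_break :: "'v outcome \<Rightarrow> 'v \<times> nat \<Rightarrow> real" where
  "tie_break \<omega> \<equiv> snd (snd \<omega>)"

definition step_pmf :: "('v \<Rightarrow> 'v \<Rightarrow> real) \<Rightarrow> 'v \<Rightarrow> 'v pmf" where
  "step_pmf K x = embed_pmf (K x)"

lemma pmf_step_pmf:
  assumes "locally_finite_graph E" "markov_kernel E K"
  shows "pmf (step_pmf K x) y = K x y"
  unfolding step_pmf_def
proof (rule pmf_embed_pmf)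
  show "0 \<le> K x z" for z using assms by (simp add: markov_kernel_def)
  have fin: "finite (neighbors E x)" using assms by (simp add: locally_finite_graph_def)
  have "(\<integral>\<^sup>+ z. ennreal (K x z) \<partial>count_space UNIV) = (\<Sum>z\<in>neighbors E x. ennreal (K x z))"
    using assms by (intro nn_integral_count_space'[OF fin])
      (auto simp: markov_kernel_def neighbors_def)
  also have "\<dots> = ennreal (\<Sum>z\<in>neighbors E x. K x z)"
    using assms by (intro sum_ennreal) (auto simp: markov_kernel_def)
  finally show "(\<integral>\<^sup>+ z. ennreal (K x z) \<partial>count_space UNIV) = 1"
    using assms by (simp add: markov_kernel_def)
qed

definition parking_measure :: "('v \<Rightarrow> 'v \<Rightarrow> real) \<Rightarrow> real \<Rightarrow> 'v outcome measure" where
  "parking_measure K p =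
     (\<Pi>\<^sub>M x\<in>UNIV. measure_pmf (bernoulli_pmf p)) \<Otimes>\<^sub>M
     ((\<Pi>\<^sub>M i\<in>UNIV. case i of (c, t, x) \<Rightarrow> measure_pmf (step_pmf K x)) \<Otimes>\<^sub>M
      (\<Pi>\<^sub>M i\<in>UNIV. uniform_measure lborel {0..1::real}))"

primrec car_pos :: "'v outcome \<Rightarrow> 'v \<Rightarrow> nat \<Rightarrow> 'v" where
  "car_pos \<omega> c 0 = c"
| "car_pos \<omega> c (Suc t) = next_vertex \<omega> (c, t, car_pos \<omega> c t)"

text \<open>The cars that park at time \<open>t\<close>, given the set \<open>A\<close> of cars unparked at time \<open>t - 1\<close> and the
  set \<open>F\<close> of spots unoccupied at time \<open>t - 1\<close>. Almost surely finitely many cars reach a given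
  vertex at a given time and their tie-breaking variables are distinct, so exactly one of the
  cars reaching a spot in \<open>F\<close> parks.\<close>

definition parking_cars :: "'v outcome \<Rightarrow> nat \<Rightarrow> 'v set \<Rightarrow> 'v set \<Rightarrow> 'v set" where
  "parking_cars \<omega> t A F =
     {c \<in> A. car_pos \<omega> c t \<in> F \<and>
        (\<forall>d\<in>A. d \<noteq> c \<and> car_pos \<omega> d t = car_pos \<omega> c t \<longrightarrow> tie_break \<omega> (c, t) < tie_break \<omega> (d, t))}"

text \<open>The set of unparked cars and the set of unoccupied spots at time \<open>t\<close>.\<close>

primrec parking_state :: "'v outcome \<Rightarrow> nat \<Rightarrow> 'v set \<times> 'v set" where
  "parking_state \<omega> 0 = ({c. init_car \<omega> c}, {x. \<not> init_car \<omega> x})"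
| "parking_state \<omega> (Suc t) =
     (let (A, F) = parking_state \<omega> t; P = parking_cars \<omega> (Suc t) A F
      in (A - P, F - (\<lambda>c. car_pos \<omega> c (Suc t)) ` P))"

definition unparked :: "'v outcome \<Rightarrow> nat \<Rightarrow> 'v set" where
  "unparked \<omega> t = fst (parking_state \<omega> t)"

definition visitors :: "('v \<Rightarrow> 'v \<Rightarrow> bool) \<Rightarrow> 'v outcome \<Rightarrow> 'v \<Rightarrow> nat \<Rightarrow> 'v set" where
  "visitors E \<omega> v t =
     {c \<in> unparked \<omega> (t - 1). car_pos \<omega> c (t - 1) \<in> neighbors E v \<and> car_pos \<omega> c t = v}"

definition visits :: "('v \<Rightarrow> 'v \<Rightarrow> bool) \<Rightarrow> 'v \<Rightarrow> nat \<Rightarrow> 'v outcome \<Rightarrow> ennreal" where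
  "visits E v t \<omega> = (\<Sum>s=1..t. emeasure (count_space UNIV) (visitors E \<omega> v s))"

definition total_visits :: "('v \<Rightarrow> 'v \<Rightarrow> bool) \<Rightarrow> 'v \<Rightarrow> 'v outcome \<Rightarrow> ennreal" where
  "total_visits E v \<omega> = lim (\<lambda>t. visits E v t \<omega>)"

end

theory Submission
  imports Defs
begin

text \<open>
  Write \<open>a\<^sub>t\<close> for the probability that a given vertex starts with a car that is still unparked at time \<open>t\<close>
  and \<open>b\<^sub>t\<close> for the probability that it is a spot still free at time \<open>t\<close>. Mass transport sends each car
  to the spot where it parks, so \<open>a\<^sub>t - b\<^sub>t = 2p - 1\<close>, and it sends each car to the vertices it visits,
  so the expected number of visits up to time \<open>t\<close> is the sum of \<open>a\<^sub>s\<close> over \<open>s < t\<close>. Let \<open>q\<close> be the limit of \<open>b\<^sub>t\<close>.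

  If \<open>q > 0\<close>, then every car parks: its trajectory is independent of the other cars and has infinite
  range, and by mixing an infinite set of vertices contains a spot that is never filled. Hence
  \<open>2p - 1 + q = 0\<close>, which is impossible for \<open>p \<ge> 1/2\<close>, so \<open>q = 0\<close> there. If a vertex had finitely many
  visits with positive probability, then deleting the cars of a large ball would leave it unvisited,
  contradicting \<open>q = 0\<close>.

  If \<open>p < 1/2\<close>, then \<open>q > 0\<close>, so the vertex is unvisited with positive probability. Infinitely many
  visits at \<open>x\<close> force infinitely many at every vertex accessible from \<open>x\<close>; along the orbit of the
  automorphism \<open>\<phi>\<close> of infinite accessibility this makes the event of infinitely many visits almost
  invariant under the powers of \<open>\<phi>\<close>, and mixing turns it into a zero-one event.

  If \<open>p\<close> is small, a car unparked after visiting \<open>r\<close> vertices lies in a connected set of at least \<open>r\<close>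
  vertices of which at least half start with a car. This has probability \<open>O(\<epsilon>\<^sup>r)\<close> for \<open>\<epsilon>\<close> as small
  as we like, which beats the at most exponential time a walk needs to visit more than \<open>r\<close> vertices.
\<close>

section \<open>Product measures\<close>

text \<open>Three obstacles shape the proof. Conditioned never to park, a car no longer has a
  trajectory independent of the rest of the outcome. Independence is therefore expressed by
  resampling: the moves of the car are replaced by a fresh copy, and a deterministic comparison of
  the old and the new process does the rest. Next, mixing is needed along sequences of automorphisms
  whose targets are prescribed inside a given infinite set of vertices, so it is proved for every
  sequence that moves a vertex out of each finite set, not only for the powers of one map. Finally,
  emptying a ball of n vertices costs a factor \<open>(1 - p) ^ n\<close>, so the argument for p
  \<ge> 1/2 breaks down at p = 1; that case follows from p = 1/2 by monotonicity in the initial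
  cars.

  At small density the crowding around a car concerns only the initial configuration and the
  slowness of its walk only the moves, so the two are independent. With \<delta> a lower bound for
  the positive values of K, the rate of the first has to beat a time of order r / \<delta>^r, and
  this fixes the threshold for p.\<close>

lemma PiM_resample:
  assumes M: "\<And>i. prob_space (M i)"
  shows "distr (PiM UNIV M \<Otimes>\<^sub>M PiM UNIV M) (PiM UNIV M) (\<lambda>(x, y) i. if i \<in> S then y i else x i) = PiM UNIV M"
    (is "?L = _")
proof (rule measure_eqI_PiM_infinite[symmetric, OF refl])
  interpret P: prob_space "PiM UNIV M" using M by (intro prob_space_PiM)
  show "finite_measure (PiM UNIV M)" by unfold_locales
  have meas: "(\<lambda>(x, y) i. if i \<in> S then y i else x i) \<in> measurable (PiM UNIV M \<Otimes>\<^sub>M PiM UNIV M) (PiM UNIV M)"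
  proof (rule measurable_PiM_single')
    show "(\<lambda>x. (case x of (x, y) \<Rightarrow> \<lambda>i. if i \<in> S then y i else x i) i) \<in> measurable (PiM UNIV M \<Otimes>\<^sub>M PiM UNIV M) (M i)" for i
      by (cases "i \<in> S") (auto simp: case_prod_beta)
  qed (auto simp: space_pair_measure space_PiM PiE_iff)
  fix A J assume J: "finite J" "J \<subseteq> UNIV" and A: "\<And>i. i \<in> J \<Longrightarrow> A i \<in> sets (M i)"
  let ?e = "\<lambda>J. prod_emb UNIV M J (Pi\<^sub>E J A)"
  have "emeasure (PiM UNIV M) (?e J) = (\<Prod>j\<in>J. emeasure (M j) (A j))"
    using M J A by (intro emeasure_PiM_emb) auto
  also have "\<dots> = (\<Prod>j\<in>J-S. emeasure (M j) (A j)) * (\<Prod>j\<in>J\<inter>S. emeasure (M j) (A j))"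
    using J by (subst prod.union_disjoint[symmetric]) (auto intro!: prod.cong)
  also have "\<dots> = emeasure (PiM UNIV M) (?e (J - S)) * emeasure (PiM UNIV M) (?e (J \<inter> S))"
    using M J A by (intro arg_cong2[where f="(*)"] emeasure_PiM_emb[symmetric]) auto
  also have "\<dots> = emeasure (PiM UNIV M \<Otimes>\<^sub>M PiM UNIV M) (?e (J - S) \<times> ?e (J \<inter> S))"
    using J A by (intro P.emeasure_pair_measure_Times[symmetric] sets_PiM_I) auto
  also have "?e (J - S) \<times> ?e (J \<inter> S) = (\<lambda>(x, y) i. if i \<in> S then y i else x i) -` ?e J \<inter> space (PiM UNIV M \<Otimes>\<^sub>M PiM UNIV M)"
    by (auto simp: prod_emb_def space_pair_measure space_PiM PiE_iff split: if_splits)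
  finally show "emeasure (PiM UNIV M) (?e J) = emeasure ?L (?e J)"
    using J A meas by (simp add: emeasure_distr)
qed simp

lemma measurable_PiM_transform:
  assumes "\<And>i. h i \<in> measurable (M (\<sigma> i)) (M i)"
  shows "(\<lambda>x i. h i (x (\<sigma> i))) \<in> measurable (PiM UNIV M) (PiM UNIV M)"
proof (rule measurable_PiM_single')
  show "(\<lambda>x. h i (x (\<sigma> i))) \<in> measurable (PiM UNIV M) (M i)" for i
    using assms[of i] by measurable
qed (use assms[THEN measurable_space] in \<open>auto simp: space_PiM PiE_iff\<close>)

text \<open>A cylinder over J pulls back to a cylinder over the image of J, with each side pulled
  back through \<open>h\<close>. Invariance and mixing of relabellings both reduce to this.\<close>

lemma vimage_transform_prod_emb:
  assumes \<sigma>: "inj \<sigma>" and h: "\<And>i. h i \<in> measurable (M (\<sigma> i)) (M i)"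
  shows "(\<lambda>x i. h i (x (\<sigma> i))) -` prod_emb UNIV M J (Pi\<^sub>E J A) \<inter> space (PiM UNIV M) =
    prod_emb UNIV M (\<sigma> ` J) (\<Pi>\<^sub>E k\<in>\<sigma> ` J. h (inv_into UNIV \<sigma> k) -` A (inv_into UNIV \<sigma> k) \<inter> space (M k))"
  using \<sigma> h[THEN measurable_space] by (auto simp: prod_emb_def space_PiM PiE_iff)

lemma distr_PiM_transform:
  assumes M: "\<And>i. prob_space (M i)" and \<sigma>: "inj \<sigma>"
    and h: "\<And>i. h i \<in> measurable (M (\<sigma> i)) (M i)" "\<And>i. distr (M (\<sigma> i)) (M i) (h i) = M i"
  shows "distr (PiM UNIV M) (PiM UNIV M) (\<lambda>x i. h i (x (\<sigma> i))) = PiM UNIV M" (is "?L = _")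
proof (rule measure_eqI_PiM_infinite[symmetric, OF refl])
  interpret P: prob_space "PiM UNIV M" using M by (intro prob_space_PiM)
  show "finite_measure (PiM UNIV M)" by unfold_locales
  fix A J assume J: "finite J" "J \<subseteq> UNIV" and A: "\<And>i. i \<in> J \<Longrightarrow> A i \<in> sets (M i)"
  let ?B = "\<lambda>k. h (inv_into UNIV \<sigma> k) -` A (inv_into UNIV \<sigma> k) \<inter> space (M k)"
  have B: "?B k \<in> sets (M k)" if "k \<in> \<sigma> ` J" for k
    using that \<sigma> A by (auto intro!: measurable_sets[OF h(1)])
  have "emeasure ?L (prod_emb UNIV M J (Pi\<^sub>E J A)) = emeasure (PiM UNIV M) (prod_emb UNIV M (\<sigma> ` J) (Pi\<^sub>E (\<sigma> ` J) ?B))"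
    using J A by (subst emeasure_distr) (auto intro!: sets_PiM_I measurable_PiM_transform h(1) simp: vimage_transform_prod_emb[where h=h, OF \<sigma> h(1)])
  also have "\<dots> = (\<Prod>k\<in>\<sigma>`J. emeasure (M k) (?B k))"
    using J B M by (intro emeasure_PiM_emb) auto
  also have "\<dots> = (\<Prod>j\<in>J. emeasure (M (\<sigma> j)) (h j -` A j \<inter> space (M (\<sigma> j))))"
    using \<sigma> by (subst prod.reindex) (auto simp: inj_on_def)
  also have "\<dots> = (\<Prod>j\<in>J. emeasure (M j) (A j))"
    by (intro prod.cong refl, subst (3) h(2)[symmetric]) (auto simp: emeasure_distr A h(1))
  also have "\<dots> = emeasure (PiM UNIV M) (prod_emb UNIV M J (Pi\<^sub>E J A))"
    using M J A by (intro emeasure_PiM_emb[symmetric]) auto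
  finally show "emeasure (PiM UNIV M) (prod_emb UNIV M J (Pi\<^sub>E J A)) = emeasure ?L (prod_emb UNIV M J (Pi\<^sub>E J A))" by simp
qed simp

text \<open>Limits on a generator do not in general pass to countable unions. Here the domination of
  \<nu> n by M supplies a summable bound for the pieces, so Tannery's theorem exchanges the limit
  with the sum.\<close>

lemma generator_tendsto_measure:
  assumes "prob_space M" and sets: "sets M = sigma_sets (space M) G" and "Int_stable G" "G \<subseteq> Pow (space M)"
    and fin: "\<And>n. finite_measure (\<nu> n)" and sets': "\<And>n. sets (\<nu> n) = sets M"
    and le: "\<And>n X. X \<in> sets M \<Longrightarrow> measure (\<nu> n) X \<le> measure M X"
    and G: "\<And>X. X \<in> G \<Longrightarrow> (\<lambda>n. measure (\<nu> n) X) \<longlonglongrightarrow> c * measure M X"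
    and total: "(\<lambda>n. measure (\<nu> n) (space M)) \<longlonglongrightarrow> c"
    and X: "X \<in> sets M"
  shows "(\<lambda>n. measure (\<nu> n) X) \<longlonglongrightarrow> c * measure M X"
  using assms(3,4) X[unfolded sets]
proof (induction rule: sigma_sets_induct_disjoint)
  interpret prob_space M by fact
  interpret \<nu>: finite_measure "\<nu> n" for n by (rule fin)
  have sp: "space (\<nu> n) = space M" for n using sets' by (rule sets_eq_imp_space_eq)
  {
    case (compl A)
    then have A: "A \<in> sets M" by (simp add: sets)
    have eq: "measure (\<nu> n) (space M - A) = measure (\<nu> n) (space M) - measure (\<nu> n) A" for n
      using \<nu>.finite_measure_compl[of A n] A by (simp add: sets' sp)
    have "c * measure M (space M - A) = c - c * measure M A"
      using finite_measure_compl[OF A] by (simp add: prob_space right_diff_distrib)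
    with compl.IH total show ?case by (auto simp: eq intro: tendsto_diff)
  next
    case (union A)
    then have A: "range A \<subseteq> sets M" "disjoint_family A" by (auto simp: sets)
    have "summable (\<lambda>k. measure M (A k))"
      using finite_measure_UNION[OF A] by (simp add: sums_iff)
    then have "(\<lambda>n. suminf (\<lambda>k. measure (\<nu> n) (A k))) \<longlonglongrightarrow> suminf (\<lambda>k. c * measure M (A k))"
      using A by (intro tannerys_theorem[THEN conjunct2, THEN conjunct2] union.IH)
         (auto simp: eventually_prod_filter intro!: le exI[of _ "\<lambda>_. True"])
    moreover have "suminf (\<lambda>k. measure (\<nu> n) (A k)) = measure (\<nu> n) (\<Union>i. A i)" for n
      using \<nu>.finite_measure_UNION[of A n] A by (simp add: sets' sums_iff)
    moreover have "suminf (\<lambda>k. c * measure M (A k)) = c * measure M (\<Union>i. A i)"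
      using finite_measure_UNION[OF A] by (simp add: sums_iff suminf_mult)
    ultimately show ?case by simp
  }
qed (use G in auto)

text \<open>T is any sequence of maps, not the powers of one map: in \<open>prob_avoid_free\<close>
  the automorphisms are chosen to send a vertex to the points of a prescribed infinite set.\<close>

definition mixing_along :: "'a measure \<Rightarrow> (nat \<Rightarrow> 'a \<Rightarrow> 'a) \<Rightarrow> bool" where
  "mixing_along M T \<longleftrightarrow> (\<forall>A\<in>sets M. \<forall>B\<in>sets M.
     (\<lambda>n. measure M (A \<inter> T n -` B)) \<longlonglongrightarrow> measure M A * measure M B)"

text \<open>The two sets are freed one after the other. For B in the generator, A varies and the
  measures are M restricted to the preimages of B. For a fixed measurable A, B varies and the
  measures are the images of M restricted to A, dominated by M because T n preserves M.\<close>

lemma mixing_along_generator: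
  assumes "prob_space M" and sets: "sets M = sigma_sets (space M) G" and G: "Int_stable G" "G \<subseteq> Pow (space M)"
    and T: "\<And>n. T n \<in> measurable M M" "\<And>n. distr M M (T n) = M"
    and mix: "\<And>A B. A \<in> G \<Longrightarrow> B \<in> G \<Longrightarrow> (\<lambda>n. measure M (A \<inter> T n -` B)) \<longlonglongrightarrow> measure M A * measure M B"
  shows "mixing_along M T"
  unfolding mixing_along_def
proof (intro ballI)
  interpret prob_space M by fact
  have pre: "T n -` B \<inter> space M \<in> sets M" if "B \<in> sets M" for n B
    using T(1) that by (rule measurable_sets)
  have pre_m: "measure M (T n -` B \<inter> space M) = measure M B" if "B \<in> sets M" for n B
    using measure_distr[OF T(1) that, of n] T(2)[of n] by simp
  have eq: "A \<inter> T n -` B = A \<inter> (T n -` B \<inter> space M)" if "A \<in> sets M" for A B n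
    using sets.sets_into_space[OF that] by auto
  have GM: "A \<in> sets M" if "A \<in> G" for A using that by (simp add: sets sigma_sets.Basic)
  have 1: "(\<lambda>n. measure M (A \<inter> T n -` B)) \<longlonglongrightarrow> measure M A * measure M B" if A: "A \<in> sets M" and B: "B \<in> G" for A B
  proof -
    let ?\<nu> = "\<lambda>n. density M (indicator (T n -` B \<inter> space M))"
    have m: "measure (?\<nu> n) X = measure M (X \<inter> T n -` B)" if "X \<in> sets M" for n X
      using that pre[OF GM[OF B], of n]
      by (auto simp: measure_def emeasure_density eq[OF that] simp flip: indicator_inter_arith intro!: arg_cong[where f=enn2real])
         (metis (no_types, lifting) Int_commute indicator_inter_arith nn_integral_cong nn_integral_indicator sets.Int)
    have "(\<lambda>n. measure (?\<nu> n) A) \<longlonglongrightarrow> measure M B * measure M A"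
    proof (rule generator_tendsto_measure[OF assms(1) sets G _ _ _ _ _ A])
      show "finite_measure (?\<nu> n)" for n
        by (rule finite_measureI) (use pre[OF GM[OF B], of n] in \<open>simp add: emeasure_density\<close>)
      show "measure (?\<nu> n) X \<le> measure M X" if "X \<in> sets M" for n X
        using that by (auto simp: m intro!: finite_measure_mono)
      show "(\<lambda>n. measure (?\<nu> n) X) \<longlonglongrightarrow> measure M B * measure M X" if "X \<in> G" for X
        using mix[OF that B] GM[OF that] by (simp add: m mult.commute)
      show "(\<lambda>n. measure (?\<nu> n) (space M)) \<longlonglongrightarrow> measure M B"
        unfolding m[OF sets.top] using pre_m[OF GM[OF B]] by (simp add: Int_commute)
    qed simp
    then show ?thesis using A by (simp add: m mult.commute)
  qed
  fix A B assume A: "A \<in> sets M" and B: "B \<in> sets M"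
  let ?\<nu> = "\<lambda>n. distr (density M (indicator A)) M (T n)"
  have m: "measure (?\<nu> n) X = measure M (A \<inter> T n -` X)" if "X \<in> sets M" for n X
  proof -
    have "measure (?\<nu> n) X = measure (density M (indicator A)) (T n -` X \<inter> space M)"
      using T that by (subst measure_distr) auto
    also have "\<dots> = measure M (A \<inter> T n -` X)"
      using A pre[OF that, of n] by (auto simp: measure_def emeasure_density eq[OF A] simp flip: indicator_inter_arith)
    finally show ?thesis .
  qed
  have "(\<lambda>n. measure (?\<nu> n) B) \<longlonglongrightarrow> measure M A * measure M B"
  proof (rule generator_tendsto_measure[OF assms(1) sets G _ _ _ _ _ B])
    show "finite_measure (?\<nu> n)" for n
    proof -
      interpret \<nu>: finite_measure "density M (indicator A)"
        by (rule finite_measureI) (use A in \<open>simp add: emeasure_density nn_integral_indicator_finite mult.commute\<close>)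
      show ?thesis using T(1) by (intro \<nu>.finite_measure_distr) simp
    qed
    show "measure (?\<nu> n) X \<le> measure M X" if "X \<in> sets M" for n X
      using finite_measure_mono[of "A \<inter> T n -` X" "T n -` X \<inter> space M"] pre[OF that, of n] sets.sets_into_space[OF A]
      by (auto simp: m[OF that] pre_m[OF that])
    show "(\<lambda>n. measure (?\<nu> n) X) \<longlonglongrightarrow> measure M A * measure M X" if "X \<in> G" for X
      using 1[OF A that] GM[OF that] by (simp add: m)
    have "A \<inter> T n -` space M = A" for n
      using sets.sets_into_space[OF A] measurable_space[OF T(1)] by auto
    then show "(\<lambda>n. measure (?\<nu> n) (space M)) \<longlonglongrightarrow> measure M A"
      by (simp add: m)
  qed simp
  then show "(\<lambda>n. measure M (A \<inter> T n -` B)) \<longlonglongrightarrow> measure M A * measure M B" using B by (simp add: m)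
qed

lemma mixing_along_pair:
  assumes M: "prob_space M" "prob_space N"
    and T: "\<And>n. T n \<in> measurable M M" "\<And>n. distr M M (T n) = M" "mixing_along M T"
    and U: "\<And>n. U n \<in> measurable N N" "\<And>n. distr N N (U n) = N" "mixing_along N U"
  shows "mixing_along (M \<Otimes>\<^sub>M N) (\<lambda>n (x, y). (T n x, U n y))"
proof (rule mixing_along_generator)
  interpret M: prob_space M by fact
  interpret N: prob_space N by fact
  interpret P: pair_prob_space M N ..
  show "prob_space (M \<Otimes>\<^sub>M N)" by unfold_locales
  show "sets (M \<Otimes>\<^sub>M N) = sigma_sets (space (M \<Otimes>\<^sub>M N)) {a \<times> b |a b. a \<in> sets M \<and> b \<in> sets N}"
    by (simp add: sets_pair_measure space_pair_measure)
  show "Int_stable {a \<times> b |a b. a \<in> sets M \<and> b \<in> sets N}" by (rule Int_stable_pair_measure_generator)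
  show "{a \<times> b |a b. a \<in> sets M \<and> b \<in> sets N} \<subseteq> Pow (space (M \<Otimes>\<^sub>M N))"
    by (auto simp: space_pair_measure dest: sets.sets_into_space)
  show "(\<lambda>(x, y). (T n x, U n y)) \<in> measurable (M \<Otimes>\<^sub>M N) (M \<Otimes>\<^sub>M N)" for n
    using T(1)[of n] U(1)[of n] by measurable
  show "distr (M \<Otimes>\<^sub>M N) (M \<Otimes>\<^sub>M N) (\<lambda>(x, y). (T n x, U n y)) = M \<Otimes>\<^sub>M N" for n
    using pair_measure_distr[OF T(1)[of n] U(1)[of n]] by (simp add: T U N.sigma_finite_measure_axioms)
  fix A B assume "A \<in> {a \<times> b |a b. a \<in> sets M \<and> b \<in> sets N}" "B \<in> {a \<times> b |a b. a \<in> sets M \<and> b \<in> sets N}"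
  then obtain a b c d where A: "A = a \<times> b" "B = c \<times> d" and m: "a \<in> sets M" "b \<in> sets N" "c \<in> sets M" "d \<in> sets N"
    by auto
  have times: "measure (M \<Otimes>\<^sub>M N) (X \<times> Y) = measure M X * measure N Y" if "X \<in> sets M" "Y \<in> sets N" for X Y
    using that by (simp add: measure_def N.emeasure_pair_measure_Times enn2real_mult)
  have pre: "a \<inter> T n -` c \<in> sets M" "b \<inter> U n -` d \<in> sets N" for n
  proof -
    have "a \<inter> T n -` c = a \<inter> (T n -` c \<inter> space M)" "b \<inter> U n -` d = b \<inter> (U n -` d \<inter> space N)"
      using m by (auto dest: sets.sets_into_space)
    then show "a \<inter> T n -` c \<in> sets M" "b \<inter> U n -` d \<in> sets N"
      using m measurable_sets[OF T(1)] measurable_sets[OF U(1)] by auto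
  qed
  have "A \<inter> (\<lambda>(x, y). (T n x, U n y)) -` B = (a \<inter> T n -` c) \<times> (b \<inter> U n -` d)" for n
    by (auto simp: A)
  then have "measure (M \<Otimes>\<^sub>M N) (A \<inter> (\<lambda>(x, y). (T n x, U n y)) -` B) = measure M (a \<inter> T n -` c) * measure N (b \<inter> U n -` d)" for n
    by (simp add: times pre)
  moreover have "(\<lambda>n. measure M (a \<inter> T n -` c) * measure N (b \<inter> U n -` d)) \<longlonglongrightarrow> (measure M a * measure M c) * (measure N b * measure N d)"
    using T(3) U(3) m by (intro tendsto_mult) (auto simp: mixing_along_def)
  ultimately show "(\<lambda>n. measure (M \<Otimes>\<^sub>M N) (A \<inter> (\<lambda>(x, y). (T n x, U n y)) -` B)) \<longlonglongrightarrow>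
      measure (M \<Otimes>\<^sub>M N) A * measure (M \<Otimes>\<^sub>M N) B"
    by (simp add: A times m ac_simps)
qed

text \<open>For cylinders the product formula holds exactly as soon as the image of J' under
  \<sigma> n misses J, so the sequence is eventually constant.\<close>

lemma mixing_along_PiM:
  assumes M: "\<And>i. prob_space (M i)" and \<sigma>: "\<And>n. inj (\<sigma> n)"
    and h: "\<And>n i. h n i \<in> measurable (M (\<sigma> n i)) (M i)" "\<And>n i. distr (M (\<sigma> n i)) (M i) (h n i) = M i"
    and disj: "\<And>J J'. finite J \<Longrightarrow> finite J' \<Longrightarrow> eventually (\<lambda>n. J \<inter> \<sigma> n ` J' = {}) sequentially"
  shows "mixing_along (PiM UNIV M) (\<lambda>n x i. h n i (x (\<sigma> n i)))"
proof (rule mixing_along_generator[where G="prod_algebra UNIV M"])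
  interpret P: prob_space "PiM UNIV M" using M by (intro prob_space_PiM)
  show "prob_space (PiM UNIV M)" by unfold_locales
  show "sets (PiM UNIV M) = sigma_sets (space (PiM UNIV M)) (prod_algebra UNIV M)"
    by (simp add: sets_PiM space_PiM)
  show "Int_stable (prod_algebra UNIV M)" by (rule Int_stable_prod_algebra)
  show "prod_algebra UNIV M \<subseteq> Pow (space (PiM UNIV M))"
    using prod_algebra_sets_into_space[of UNIV M] by (simp add: space_PiM)
  show "(\<lambda>x i. h n i (x (\<sigma> n i))) \<in> measurable (PiM UNIV M) (PiM UNIV M)" for n
    by (rule measurable_PiM_transform) (rule h)
  show "distr (PiM UNIV M) (PiM UNIV M) (\<lambda>x i. h n i (x (\<sigma> n i))) = PiM UNIV M" for n
    by (intro distr_PiM_transform M \<sigma> h)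
  fix A B assume "A \<in> prod_algebra UNIV M" "B \<in> prod_algebra UNIV M"
  from this(1) obtain J X where A: "A = prod_emb UNIV M J (Pi\<^sub>E J X)" "finite J" "\<And>i. i \<in> J \<Longrightarrow> X i \<in> sets (M i)"
    by (rule prod_algebraE) blast
  from \<open>B \<in> _\<close> obtain J' Y where B: "B = prod_emb UNIV M J' (Pi\<^sub>E J' Y)" "finite J'" "\<And>i. i \<in> J' \<Longrightarrow> Y i \<in> sets (M i)"
    by (rule prod_algebraE) blast
  have m: "measure (PiM UNIV M) (prod_emb UNIV M J (Pi\<^sub>E J X)) = (\<Prod>i\<in>J. measure (M i) (X i))"
    if "finite J" "\<And>i. i \<in> J \<Longrightarrow> X i \<in> sets (M i)" for J X
    proof -
    interpret product_prob_space M UNIV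
      using M by (simp add: product_prob_space_def product_prob_space_axioms_def product_sigma_finite_def prob_space_imp_sigma_finite)
    show ?thesis using that by (intro measure_PiM_emb) auto
  qed
  have "eventually (\<lambda>n. measure (PiM UNIV M) (A \<inter> (\<lambda>x i. h n i (x (\<sigma> n i))) -` B) = measure (PiM UNIV M) A * measure (PiM UNIV M) B) sequentially"
    using disj[OF A(2) B(2)]
  proof eventually_elim
    case (elim n)
    \<comment> \<open>\<open>?Y\<close> are the sides of the cylinder that B pulls back to;
      \<open>?Z\<close> glues them to the sides of A, which is consistent because the index sets are
      disjoint.\<close>
    let ?Y = "\<lambda>k. h n (inv_into UNIV (\<sigma> n) k) -` Y (inv_into UNIV (\<sigma> n) k) \<inter> space (M k)"
    let ?Z = "\<lambda>k. if k \<in> J then X k else ?Y k"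
    have Y: "?Y k \<in> sets (M k)" if "k \<in> \<sigma> n ` J'" for k
      using that \<sigma>[of n] B(3) by (auto intro!: measurable_sets[OF h(1)])
    have pre: "A \<inter> (\<lambda>x i. h n i (x (\<sigma> n i))) -` B = A \<inter> prod_emb UNIV M (\<sigma> n ` J') (Pi\<^sub>E (\<sigma> n ` J') ?Y)"
      unfolding B(1) vimage_transform_prod_emb[where h="h n", OF \<sigma> h(1), symmetric]
      by (auto simp: A(1) prod_emb_def space_PiM)
    also have "\<dots> = prod_emb UNIV M (J \<union> \<sigma> n ` J') (Pi\<^sub>E (J \<union> \<sigma> n ` J') ?Z)"
    proof -
      have Z: "(\<forall>k\<in>\<sigma> n ` J'. x k \<in> ?Z k) = (\<forall>k\<in>\<sigma> n ` J'. x k \<in> ?Y k)" for x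
        using elim by (intro ball_cong) auto
      show ?thesis
        unfolding A(1) prod_emb_def set_eq_iff
        by (simp add: PiE_iff ball_Un restrict_def Z del: image_iff ball_simps cong: conj_cong ball_cong) (use elim in \<open>auto simp: extensional_def disjoint_iff\<close>)
    qed
    finally have eq: "A \<inter> (\<lambda>x i. h n i (x (\<sigma> n i))) -` B = \<dots>" .
    have "measure (PiM UNIV M) (A \<inter> (\<lambda>x i. h n i (x (\<sigma> n i))) -` B) = (\<Prod>k\<in>J \<union> \<sigma> n ` J'. measure (M k) (?Z k))"
      unfolding eq using A B Y by (intro m) auto
    also have "\<dots> = (\<Prod>k\<in>J. measure (M k) (X k)) * (\<Prod>k\<in>\<sigma> n ` J'. measure (M k) (?Y k))"
      using elim A(2) B(2) by (subst prod.union_disjoint) (auto simp: disjoint_iff intro!: arg_cong2[where f="(*)"] prod.cong)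
    also have "(\<Prod>k\<in>\<sigma> n ` J'. measure (M k) (?Y k)) = measure (PiM UNIV M) (prod_emb UNIV M (\<sigma> n ` J') (Pi\<^sub>E (\<sigma> n ` J') ?Y))"
      using B Y by (simp add: m)
    also have "\<dots> = measure (PiM UNIV M) B"
      unfolding B(1) vimage_transform_prod_emb[where h="h n", OF \<sigma> h(1), symmetric]
      by (subst (2) distr_PiM_transform[where h="h n" and \<sigma>="\<sigma> n" and M=M, OF M \<sigma> h, symmetric], subst measure_distr)
        (use B in \<open>auto intro!: sets_PiM_I measurable_PiM_transform h(1)\<close>)
    also have "(\<Prod>k\<in>J. measure (M k) (X k)) = measure (PiM UNIV M) A"
      using A by (simp add: m)
    finally show ?case .
  qed
  then show "(\<lambda>n. measure (PiM UNIV M) (A \<inter> (\<lambda>x i. h n i (x (\<sigma> n i))) -` B)) \<longlonglongrightarrow> measure (PiM UNIV M) A * measure (PiM UNIV M) B"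
    by (rule tendsto_eventually)
qed

section \<open>The parking process for a fixed outcome\<close>

lemma symp_relpowp:
  assumes "symp E"
  shows "(E ^^ n) x y \<Longrightarrow> (E ^^ n) y x"
proof (induction n arbitrary: y)
  case (Suc n)
  then obtain z where "(E ^^ n) x z" "E z y" by auto
  then have "E y z" "(E ^^ n) z x" using Suc.IH assms by (auto dest: sympD)
  then show ?case by (rule relpowp_Suc_I2)
qed auto

lemma finite_relpowp:
  assumes "locally_finite_graph E"
  shows "finite {y. (E ^^ n) x y}"
proof (induction n)
  case (Suc n)
  have "{y. (E ^^ Suc n) x y} = (\<Union>z\<in>{z. (E ^^ n) x z}. neighbors E z)"
    by (auto simp: neighbors_def)
  then show ?case using Suc assms by (auto simp: locally_finite_graph_def)
qed auto

text \<open>Measurability of the process rests on this: quantifiers over cars and vertices become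
  countable set operations.\<close>

lemma countable_vertices:
  fixes E :: "'v \<Rightarrow> 'v \<Rightarrow> bool"
  assumes "locally_finite_graph E" "connected_graph E"
  shows "countable (UNIV :: 'v set)"
proof -
  fix o' :: 'v
  have "UNIV = (\<Union>n. {y. (E ^^ n) o' y})"
    using assms(2) by (auto simp: connected_graph_def rtranclp_power)
  moreover have "countable (\<Union>n. {y. (E ^^ n) o' y})"
    using finite_relpowp[OF assms(1)] by (auto intro!: countable_UN intro: countable_finite)
  ultimately show ?thesis by simp
qed

section \<open>Free spots, parking cars and regular outcomes\<close>

definition free :: "'v outcome \<Rightarrow> nat \<Rightarrow> 'v set" where
  "free \<omega> t = snd (parking_state \<omega> t)"

text \<open>The index is the time before the move: these cars are still in
  \<open>unparked \<omega> t\<close> and park at time \<open>Suc t\<close>.\<close>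

definition parks :: "'v outcome \<Rightarrow> nat \<Rightarrow> 'v set" where
  "parks \<omega> t = parking_cars \<omega> (Suc t) (unparked \<omega> t) (free \<omega> t)"

lemma unparked_0: "unparked \<omega> 0 = {c. init_car \<omega> c}"
  and free_0: "free \<omega> 0 = {x. \<not> init_car \<omega> x}"
  and unparked_Suc: "unparked \<omega> (Suc t) = unparked \<omega> t - parks \<omega> t"
  and free_Suc: "free \<omega> (Suc t) = free \<omega> t - (\<lambda>c. car_pos \<omega> c (Suc t)) ` parks \<omega> t"
  by (simp_all add: unparked_def free_def parks_def Let_def case_prod_beta)

lemma in_parks_iff:
  "c \<in> parks \<omega> t \<longleftrightarrow> c \<in> unparked \<omega> t \<and> car_pos \<omega> c (Suc t) \<in> free \<omega> t \<and>
    (\<forall>d. d \<in> unparked \<omega> t \<and> d \<noteq> c \<and> car_pos \<omega> d (Suc t) = car_pos \<omega> c (Suc t) \<longrightarrow>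
       tie_break \<omega> (c, Suc t) < tie_break \<omega> (d, Suc t))"
  unfolding parks_def parking_cars_def by blast

lemma parks_imp: "c \<in> parks \<omega> t \<Longrightarrow> c \<in> unparked \<omega> t" "c \<in> parks \<omega> t \<Longrightarrow> car_pos \<omega> c (Suc t) \<in> free \<omega> t"
  by (simp_all only: in_parks_iff)

lemma in_free_Suc_iff:
  "x \<in> free \<omega> (Suc t) \<longleftrightarrow> x \<in> free \<omega> t \<and> \<not> (\<exists>c. c \<in> parks \<omega> t \<and> car_pos \<omega> c (Suc t) = x)"
  unfolding free_Suc by blast

lemma unparked_antimono: "s \<le> t \<Longrightarrow> unparked \<omega> t \<subseteq> unparked \<omega> s"
  by (induction t rule: dec_induct) (auto simp: unparked_Suc)

lemma free_antimono: "s \<le> t \<Longrightarrow> free \<omega> t \<subseteq> free \<omega> s"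
  by (induction t rule: dec_induct) (auto simp: free_Suc)

lemma parks_unique:
  assumes "c \<in> parks \<omega> t" "d \<in> parks \<omega> t" "car_pos \<omega> c (Suc t) = car_pos \<omega> d (Suc t)"
  shows "c = d"
  using assms unfolding in_parks_iff by (metis order_less_asym)

text \<open>Collects the almost sure properties that the combinatorics needs, so that it can be done
  outcome by outcome. Steps along edges let only finitely many cars reach a vertex at a given time;
  distinct tie-breaking values then give exactly one winner at each free spot that is
  reached.\<close>

definition regular :: "('v \<Rightarrow> 'v \<Rightarrow> bool) \<Rightarrow> 'v outcome \<Rightarrow> bool" where
  "regular E \<omega> \<longleftrightarrow> (\<forall>c t x. E x (next_vertex \<omega> (c, t, x))) \<and>
     (\<forall>t c d. c \<noteq> d \<longrightarrow> tie_break \<omega> (c, t) \<noteq> tie_break \<omega> (d, t))"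

lemma regular_step: "regular E \<omega> \<Longrightarrow> E (car_pos \<omega> c t) (car_pos \<omega> c (Suc t))"
  by (simp add: regular_def)

lemma regular_car_pos: "regular E \<omega> \<Longrightarrow> (E ^^ t) c (car_pos \<omega> c t)"
proof (induction t)
  case (Suc t) then show ?case using regular_step[of E \<omega> c t] by auto
qed auto

lemma finite_car_pos:
  assumes "locally_finite_graph E" "symp E" "regular E \<omega>"
  shows "finite {c. car_pos \<omega> c t = x}"
proof (rule finite_subset[OF _ finite_relpowp[OF assms(1)]])
  show "{c. car_pos \<omega> c t = x} \<subseteq> {y. (E ^^ t) x y}"
    using regular_car_pos[OF assms(3)] symp_relpowp[OF assms(2)] by blast
qed

text \<open>A finite nonempty set of competitors has a least tie-breaking value, and distinctness
  makes this minimum strict.\<close>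

lemma ex_parking_car:
  assumes "locally_finite_graph E" "symp E" "regular E \<omega>" and "c \<in> A" "car_pos \<omega> c t \<in> F"
  shows "\<exists>d\<in>parking_cars \<omega> t A F. car_pos \<omega> d t = car_pos \<omega> c t"
proof -
  let ?S = "{d \<in> A. car_pos \<omega> d t = car_pos \<omega> c t}"
  let ?f = "\<lambda>d. tie_break \<omega> (d, t)"
  have "finite ?S" by (rule finite_subset[OF _ finite_car_pos[OF assms(1-3)]]) auto
  moreover have "?S \<noteq> {}" using assms by auto
  ultimately have am: "arg_min_on ?f ?S \<in> ?S" "\<not> (\<exists>e\<in>?S. ?f e < ?f (arg_min_on ?f ?S))"
    by (rule arg_min_if_finite)+
  define d where "d = arg_min_on ?f ?S"
  have d: "d \<in> ?S" "\<forall>e\<in>?S. ?f d \<le> ?f e"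
    using am unfolding d_def[symmetric] by (auto simp: not_less)
  have "?f d < ?f e" if "e \<in> ?S" "e \<noteq> d" for e
  proof -
    have "?f d \<noteq> ?f e" using assms(3) that(2) by (auto simp: regular_def)
    with d(2) that(1) show ?thesis by (simp add: order_less_le)
  qed
  then show ?thesis using d(1) assms(5) by (auto simp: parking_cars_def)
qed

lemma free_not_visited:
  assumes "locally_finite_graph E" "symp E" "regular E \<omega>" and "c \<in> unparked \<omega> t"
  shows "car_pos \<omega> c (Suc t) \<notin> free \<omega> (Suc t)"
proof
  assume *: "car_pos \<omega> c (Suc t) \<in> free \<omega> (Suc t)"
  then have "car_pos \<omega> c (Suc t) \<in> free \<omega> t" by (simp add: in_free_Suc_iff)
  then show False
    using ex_parking_car[OF assms, of "Suc t" "free \<omega> t"] *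
    unfolding in_free_Suc_iff parks_def by blast
qed

text \<open>A car starts on a vertex that is not a spot, and any free spot that it enters afterwards
  is filled at that very moment, by itself or by a competitor.\<close>

lemma unparked_pos_not_free:
  assumes "locally_finite_graph E" "symp E" "regular E \<omega>" and "c \<in> unparked \<omega> t" "s \<le> t"
  shows "car_pos \<omega> c s \<notin> free \<omega> t"
proof (cases s)
  case 0
  have "c \<in> unparked \<omega> 0" using unparked_antimono[of 0 t \<omega>] assms(4) by auto
  then show ?thesis using free_antimono[of 0 t \<omega>] 0 by (auto simp: unparked_0 free_0)
next
  case (Suc r)
  have "c \<in> unparked \<omega> r" using unparked_antimono[of r t \<omega>] assms Suc by auto
  then show ?thesis using free_antimono[of "Suc r" t \<omega>] free_not_visited[OF assms(1-3)] Suc assms(5) by blast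
qed

text \<open>The process started from arbitrary sets of cars and spots: a car can be deleted without
  turning its starting vertex into a spot, which no initial configuration achieves.\<close>

primrec evolve :: "'v outcome \<Rightarrow> 'v set \<times> 'v set \<Rightarrow> nat \<Rightarrow> 'v set \<times> 'v set" where
  "evolve \<omega> S 0 = S"
| "evolve \<omega> S (Suc t) =
     (let (A, F) = evolve \<omega> S t; P = parking_cars \<omega> (Suc t) A F
      in (A - P, F - (\<lambda>c. car_pos \<omega> c (Suc t)) ` P))"

lemma parking_state_eq_evolve:
  "parking_state \<omega> t = evolve \<omega> ({c. init_car \<omega> c}, {x. \<not> init_car \<omega> x}) t"
  by (induction t) auto

lemma unparked_eq_evolve: "unparked \<omega> t = fst (evolve \<omega> ({c. init_car \<omega> c}, {x. \<not> init_car \<omega> x}) t)"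
  and free_eq_evolve: "free \<omega> t = snd (evolve \<omega> ({c. init_car \<omega> c}, {x. \<not> init_car \<omega> x}) t)"
  by (simp_all add: unparked_def free_def parking_state_eq_evolve)

lemma fst_evolve_subset: "fst (evolve \<omega> (A, F) t) \<subseteq> A"
  by (induction t) (auto simp: Let_def case_prod_beta)

lemma parking_cars_cong:
  assumes "\<And>c. c \<in> A \<Longrightarrow> car_pos \<omega> c t = car_pos \<omega>' c t \<and> tie_break \<omega> (c, t) = tie_break \<omega>' (c, t)"
  shows "parking_cars \<omega> t A F = parking_cars \<omega>' t A F"
  using assms unfolding parking_cars_def by (intro Collect_cong) (metis (no_types, lifting))

lemma evolve_cong:
  assumes "\<And>c s. c \<in> A \<Longrightarrow> s \<le> t \<Longrightarrow> car_pos \<omega> c s = car_pos \<omega>' c s \<and> tie_break \<omega> (c, s) = tie_break \<omega>' (c, s)"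
  shows "evolve \<omega> (A, F) t = evolve \<omega>' (A, F) t"
  using assms
proof (induction t)
  case (Suc t)
  obtain A1 F1 where AF: "evolve \<omega> (A, F) t = (A1, F1)" by (cases "evolve \<omega> (A, F) t")
  then have AF': "evolve \<omega>' (A, F) t = (A1, F1)" using Suc by simp
  have "A1 \<subseteq> A" using fst_evolve_subset[of \<omega> A F t] AF by simp
  then have P: "parking_cars \<omega> (Suc t) A1 F1 = parking_cars \<omega>' (Suc t) A1 F1"
    using Suc.prems by (intro parking_cars_cong) blast
  have "(\<lambda>c. car_pos \<omega> c (Suc t)) ` parking_cars \<omega>' (Suc t) A1 F1 = (\<lambda>c. car_pos \<omega>' c (Suc t)) ` parking_cars \<omega>' (Suc t) A1 F1"
    using Suc.prems \<open>A1 \<subseteq> A\<close> by (intro image_cong) (auto simp: parking_cars_def simp del: car_pos.simps)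
  then show ?case by (simp add: AF AF' P Let_def del: car_pos.simps)
qed simp

text \<open>A car present in both systems that wins a spot against more competitors also wins
  against fewer, so at each step parking in the larger system forces parking in the smaller one. In
  the other direction, a spot free in both that is filled in the smaller system is reached by a car
  of the larger one, hence filled there too.\<close>

lemma evolve_mono:
  assumes E: "locally_finite_graph E" "symp E" "regular E \<omega>" and "A' \<subseteq> A" "F \<subseteq> F'"
  shows "fst (evolve \<omega> (A', F') t) \<subseteq> fst (evolve \<omega> (A, F) t) \<and> snd (evolve \<omega> (A, F) t) \<subseteq> snd (evolve \<omega> (A', F') t)"
proof (induction t)
  case 0 then show ?case using assms by simp
next
  case (Suc t)
  obtain A1 F1 where AF: "evolve \<omega> (A, F) t = (A1, F1)" by (cases "evolve \<omega> (A, F) t")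
  obtain A1' F1' where AF': "evolve \<omega> (A', F') t = (A1', F1')" by (cases "evolve \<omega> (A', F') t")
  have sub: "A1' \<subseteq> A1" "F1 \<subseteq> F1'" using Suc AF AF' by auto
  let ?P = "parking_cars \<omega> (Suc t) A1 F1" and ?P' = "parking_cars \<omega> (Suc t) A1' F1'"
  have 1: "?P \<inter> A1' \<subseteq> ?P'" using sub unfolding parking_cars_def by auto
  have 2: "car_pos \<omega> d (Suc t) \<in> (\<lambda>c. car_pos \<omega> c (Suc t)) ` ?P" if "d \<in> ?P'" "car_pos \<omega> d (Suc t) \<in> F1" for d
  proof -
    have "d \<in> A1" using that sub by (auto simp: parking_cars_def)
    from ex_parking_car[OF E this that(2)] show ?thesis by (metis imageI)
  qed
  have "A1' - ?P' \<subseteq> A1 - ?P" using 1 sub by auto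
  moreover have "F1 - (\<lambda>c. car_pos \<omega> c (Suc t)) ` ?P \<subseteq> F1' - (\<lambda>c. car_pos \<omega> c (Suc t)) ` ?P'"
    using 2 sub by blast
  ultimately show ?case by (simp add: AF AF' Let_def)
qed

text \<open>As long as \<open>c\<close> has not parked, it was beaten at every free spot that it
  entered, so it never changed the winner: with a smaller value than the winner \<open>d\<close> of
  the process without it, it would have parked itself.\<close>

lemma evolve_insert:
  assumes E: "regular E \<omega>" and c: "c \<notin> A"
  shows "c \<in> fst (evolve \<omega> (insert c A, F) t) \<Longrightarrow>
    fst (evolve \<omega> (insert c A, F) t) = insert c (fst (evolve \<omega> (A, F) t)) \<and>
    snd (evolve \<omega> (insert c A, F) t) = snd (evolve \<omega> (A, F) t)"
proof (induction t)
  case (Suc t)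
  obtain A1 F1 where AF: "evolve \<omega> (A, F) t = (A1, F1)" by (cases "evolve \<omega> (A, F) t")
  have "c \<in> fst (evolve \<omega> (insert c A, F) t)" using Suc.prems by (auto simp: Let_def case_prod_beta)
  then have AF': "evolve \<omega> (insert c A, F) t = (insert c A1, F1)"
    using Suc.IH AF by (cases "evolve \<omega> (insert c A, F) t") simp
  have cA: "c \<notin> A1" using fst_evolve_subset[of \<omega> A F t] AF c by auto
  have cP: "c \<notin> parking_cars \<omega> (Suc t) (insert c A1) F1"
    using Suc.prems by (auto simp: AF' Let_def)
  have "parking_cars \<omega> (Suc t) (insert c A1) F1 = parking_cars \<omega> (Suc t) A1 F1"
  proof (intro equalityI subsetI)
    fix d assume "d \<in> parking_cars \<omega> (Suc t) (insert c A1) F1"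
    with cP show "d \<in> parking_cars \<omega> (Suc t) A1 F1" unfolding parking_cars_def by auto
  next
    fix d assume d: "d \<in> parking_cars \<omega> (Suc t) A1 F1"
    have "tie_break \<omega> (d, Suc t) < tie_break \<omega> (c, Suc t)" if *: "car_pos \<omega> d (Suc t) = car_pos \<omega> c (Suc t)"
    proof (rule ccontr)
      assume n: "\<not> ?thesis"
      have "c \<noteq> d" using d cA by (auto simp: parking_cars_def)
      then have "tie_break \<omega> (c, Suc t) < tie_break \<omega> (d, Suc t)"
        using E n by (metis linorder_less_linear regular_def)
      then have "c \<in> parking_cars \<omega> (Suc t) (insert c A1) F1"
        using d * by (fastforce simp: parking_cars_def simp del: car_pos.simps)
      with cP show False by simp
    qed
    then show "d \<in> parking_cars \<omega> (Suc t) (insert c A1) F1"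
      using d by (auto simp: parking_cars_def simp del: car_pos.simps)
  qed
  then show ?case using cP by (auto simp: AF AF' Let_def insert_Diff_if)
qed simp

lemma car_pos_cong:
  assumes "\<And>s x. s < t \<Longrightarrow> next_vertex \<omega> (c, s, x) = next_vertex \<omega>' (c, s, x)"
  shows "car_pos \<omega> c t = car_pos \<omega>' c t"
  using assms by (induction t) auto

text \<open>Pulls an outcome back along \<phi>: car \<open>c\<close> in
  \<open>act \<phi> \<omega>\<close> does what car \<open>\<phi> c\<close> does in \<omega>, seen
  through the inverse of \<phi>. An event about \<open>v\<close> in
  \<open>act \<phi> \<omega>\<close> is thus the event about \<open>\<phi> v\<close> in
  \<omega>.\<close>

definition act :: "('v \<Rightarrow> 'v) \<Rightarrow> 'v outcome \<Rightarrow> 'v outcome" where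
  "act \<phi> \<omega> = (\<lambda>x. init_car \<omega> (\<phi> x),
     \<lambda>(c, t, x). inv_into UNIV \<phi> (next_vertex \<omega> (\<phi> c, t, \<phi> x)),
     \<lambda>(c, t). tie_break \<omega> (\<phi> c, t))"

lemma car_pos_act:
  assumes "bij \<phi>"
  shows "\<phi> (car_pos (act \<phi> \<omega>) c t) = car_pos \<omega> (\<phi> c) t"
  using assms by (induction t) (auto simp: act_def bij_is_surj surj_f_inv_f)

lemma car_pos_act_eq_iff:
  assumes "bij \<phi>"
  shows "car_pos (act \<phi> \<omega>) c t = car_pos (act \<phi> \<omega>) d s \<longleftrightarrow> car_pos \<omega> (\<phi> c) t = car_pos \<omega> (\<phi> d) s"
  using car_pos_act[OF assms] by (metis assms bij_is_inj inj_eq)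

lemma tie_break_act: "tie_break (act \<phi> \<omega>) (c, t) = tie_break \<omega> (\<phi> c, t)"
  by (simp add: act_def)

lemma unparked_free_act:
  assumes \<phi>: "bij \<phi>"
  shows "unparked (act \<phi> \<omega>) t = \<phi> -` unparked \<omega> t \<and> free (act \<phi> \<omega>) t = \<phi> -` free \<omega> t"
proof (induction t)
  case 0
  then show ?case by (auto simp: unparked_0 free_0 act_def)
next
  case (Suc t)
  have P: "c \<in> parks (act \<phi> \<omega>) t \<longleftrightarrow> \<phi> c \<in> parks \<omega> t" for c
  proof -
    have all: "(\<forall>d. Q (\<phi> d)) = (\<forall>d. Q d)" for Q using \<phi> by (metis bij_pointE)
    have "c \<in> parks (act \<phi> \<omega>) t \<longleftrightarrow> \<phi> c \<in> unparked \<omega> t \<and> car_pos \<omega> (\<phi> c) (Suc t) \<in> free \<omega> t \<and>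
      (\<forall>d. \<phi> d \<in> unparked \<omega> t \<and> \<phi> d \<noteq> \<phi> c \<and> car_pos \<omega> (\<phi> d) (Suc t) = car_pos \<omega> (\<phi> c) (Suc t) \<longrightarrow>
       tie_break \<omega> (\<phi> c, Suc t) < tie_break \<omega> (\<phi> d, Suc t))"
      using Suc \<phi> by (simp add: in_parks_iff car_pos_act car_pos_act_eq_iff tie_break_act inj_eq[OF bij_is_inj] del: car_pos.simps)
    also have "\<dots> \<longleftrightarrow> \<phi> c \<in> parks \<omega> t"
      unfolding in_parks_iff using all[of "\<lambda>d. d \<in> unparked \<omega> t \<and> d \<noteq> \<phi> c \<and> car_pos \<omega> d (Suc t) = car_pos \<omega> (\<phi> c) (Suc t) \<longrightarrow>
       tie_break \<omega> (\<phi> c, Suc t) < tie_break \<omega> (d, Suc t)"] by simp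
    finally show ?thesis .
  qed
  have ex: "(\<exists>d. Q (\<phi> d)) = (\<exists>d. Q d)" for Q using \<phi> by (metis bij_pointE)
  have F: "x \<in> free (act \<phi> \<omega>) (Suc t) \<longleftrightarrow> \<phi> x \<in> free \<omega> (Suc t)" for x
  proof -
    have "x \<in> free (act \<phi> \<omega>) (Suc t) \<longleftrightarrow> \<phi> x \<in> free \<omega> t \<and> \<not> (\<exists>c. \<phi> c \<in> parks \<omega> t \<and> \<phi> (car_pos (act \<phi> \<omega>) c (Suc t)) = \<phi> x)"
      using Suc \<phi> by (simp add: in_free_Suc_iff P inj_eq[OF bij_is_inj] del: car_pos.simps)
    also have "\<dots> \<longleftrightarrow> \<phi> x \<in> free \<omega> (Suc t)"
      unfolding in_free_Suc_iff car_pos_act[OF \<phi>] using ex[of "\<lambda>c. c \<in> parks \<omega> t \<and> car_pos \<omega> c (Suc t) = \<phi> x"] by simp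
    finally show ?thesis .
  qed
  show ?case using Suc F by (auto simp: unparked_Suc P)
qed

lemma in_parks_act:
  assumes \<phi>: "bij \<phi>"
  shows "c \<in> parks (act \<phi> \<omega>) t \<longleftrightarrow> \<phi> c \<in> parks \<omega> t"
proof -
  have "parks \<omega> t = unparked \<omega> t - unparked \<omega> (Suc t)" for \<omega> :: "'a outcome"
    unfolding unparked_Suc using in_parks_iff[of _ \<omega> t] by blast
  then show ?thesis using unparked_free_act[OF \<phi>, of \<omega>] by auto
qed

section \<open>The parking measure\<close>

lemma pred_all_countable:
  assumes "countable (UNIV :: 'b set)" "\<And>i. Measurable.pred M (P i)"
  shows "Measurable.pred M (\<lambda>x. \<forall>i::'b. P i x)" "Measurable.pred M (\<lambda>x. \<exists>i::'b. P i x)"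
  using sets.sets_Collect_countable_All'[of UNIV M P, OF _ assms(1)] sets.sets_Collect_countable_Ex'[of UNIV M P, OF _ assms(1)] assms(2)
  by (auto simp: pred_def)

section \<open>Components of the parking measure and resampling\<close>

abbreviation "init_measure p \<equiv> \<Pi>\<^sub>M x\<in>UNIV. measure_pmf (bernoulli_pmf p)"
abbreviation move_measure :: "('v \<Rightarrow> 'v \<Rightarrow> real) \<Rightarrow> ('v \<times> nat \<times> 'v \<Rightarrow> 'v) measure" where
  "move_measure K \<equiv> \<Pi>\<^sub>M i\<in>UNIV. case i of (c, t, x) \<Rightarrow> measure_pmf (step_pmf K x)"
abbreviation tie_measure :: "('v \<times> nat \<Rightarrow> real) measure" where
  "tie_measure \<equiv> \<Pi>\<^sub>M i\<in>UNIV. uniform_measure lborel {0..1::real}"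

lemma prob_space_move_factor: "prob_space (case i of (c, t, x) \<Rightarrow> measure_pmf (step_pmf K x))"
  by (cases i) (simp add: prob_space_measure_pmf)

lemma prob_space_uniform01: "prob_space (uniform_measure lborel {0..1::real})"
  by (rule prob_space_uniform_measure) auto

lemma prob_space_init: "prob_space (init_measure p)"
  by (intro prob_space_PiM prob_space_measure_pmf)

lemma prob_space_move: "prob_space (move_measure K)"
  by (intro prob_space_PiM prob_space_move_factor)

lemma prob_space_tie: "prob_space tie_measure"
  by (intro prob_space_PiM prob_space_uniform01)

lemma prob_space_move_tie: "prob_space (move_measure K \<Otimes>\<^sub>M tie_measure)"
  by (intro prob_space_pair prob_space_move prob_space_tie)

lemma prob_space_parking: "prob_space (parking_measure K p)"
  unfolding parking_measure_def by (intro prob_space_pair prob_space_init prob_space_move_tie)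

lemma space_move_factor: "space (case i of (c, t, x) \<Rightarrow> measure_pmf (step_pmf K x)) = UNIV"
  by (cases i) simp

lemma space_init [simp]: "space (init_measure p) = UNIV"
  and space_move [simp]: "space (move_measure K) = UNIV"
  and space_tie [simp]: "space tie_measure = UNIV"
  by (auto simp: space_PiM space_move_factor PiE_def extensional_def)

lemma space_parking [simp]: "space (parking_measure K p) = UNIV"
  by (simp add: parking_measure_def space_pair_measure)

lemma measurable_init_component [measurable]: "(\<lambda>\<omega>. \<omega> x) \<in> measurable (init_measure p) (count_space UNIV)"
  using measurable_component_singleton[of x UNIV "\<lambda>_. measure_pmf (bernoulli_pmf p)"] by simp

lemma measurable_move_component [measurable]: "(\<lambda>\<omega>. \<omega> i) \<in> measurable (move_measure K) (count_space UNIV)"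
proof -
  have "(\<lambda>\<omega>. \<omega> i) \<in> measurable (move_measure K) (case i of (c, t, x) \<Rightarrow> measure_pmf (step_pmf K x))"
    by (rule measurable_component_singleton) simp
  also have "\<dots> = measurable (move_measure K) (count_space UNIV)"
    by (intro measurable_cong_sets) (auto split: prod.split)
  finally show ?thesis .
qed

lemma measurable_tie_component [measurable]: "(\<lambda>\<omega>. \<omega> i) \<in> measurable tie_measure borel"
  using measurable_component_singleton[of i UNIV "\<lambda>_. uniform_measure lborel {0..1::real}"] by simp

lemma measurable_fst_parking [measurable]: "fst \<in> measurable (parking_measure K p) (init_measure p)"
  and measurable_snd_parking [measurable]: "snd \<in> measurable (parking_measure K p) (move_measure K \<Otimes>\<^sub>M tie_measure)"
  unfolding parking_measure_def by simp_all

lemma measurable_init_car [measurable]: "(\<lambda>\<omega>. init_car \<omega> x) \<in> measurable (parking_measure K p) (count_space UNIV)"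
  and measurable_next_vertex [measurable]: "(\<lambda>\<omega>. next_vertex \<omega> i) \<in> measurable (parking_measure K p) (count_space UNIV)"
  and measurable_tie_break [measurable]: "(\<lambda>\<omega>. tie_break \<omega> j) \<in> measurable (parking_measure K p) borel"
  by measurable

lemma measurable_to_init:
  assumes "\<And>x. (\<lambda>w. f w x) \<in> measurable N (count_space UNIV)"
  shows "f \<in> measurable N (init_measure p)"
proof -
  have "(\<lambda>w x. f w x) \<in> measurable N (init_measure p)"
    using assms by (intro measurable_PiM_single') (auto simp: measurable_def)
  then show ?thesis by simp
qed

lemma measurable_to_move:
  assumes "\<And>i. (\<lambda>w. f w i) \<in> measurable N (count_space UNIV)"
  shows "f \<in> measurable N (move_measure K)"
proof -
  have "(\<lambda>w i. f w i) \<in> measurable N (move_measure K)"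
  proof (rule measurable_PiM_single')
    show "(\<lambda>w. f w i) \<in> measurable N (case i of (c, t, x) \<Rightarrow> measure_pmf (step_pmf K x))" for i
      using assms[of i] by (cases i) (auto simp: measurable_def)
  qed (auto simp: space_move_factor)
  then show ?thesis by simp
qed

lemma measurable_to_tie:
  assumes "\<And>x. (\<lambda>w. f w x) \<in> measurable N borel"
  shows "f \<in> measurable N tie_measure"
proof -
  have "(\<lambda>w x. f w x) \<in> measurable N tie_measure"
    using assms by (intro measurable_PiM_single') (auto simp: measurable_def)
  then show ?thesis by simp
qed

lemma measurable_to_parking:
  assumes "\<And>x. (\<lambda>w. init_car (f w) x) \<in> measurable N (count_space UNIV)"
    "\<And>i. (\<lambda>w. next_vertex (f w) i) \<in> measurable N (count_space UNIV)"
    "\<And>j. (\<lambda>w. tie_break (f w) j) \<in> measurable N borel"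
  shows "f \<in> measurable N (parking_measure K p)"
proof -
  have "(\<lambda>w. (fst (f w), (fst (snd (f w)), snd (snd (f w))))) \<in> measurable N (parking_measure K p)"
    unfolding parking_measure_def
    by (intro measurable_Pair measurable_to_init measurable_to_move measurable_to_tie assms)
  then show ?thesis by simp
qed

text \<open>Every use of independence below replaces some coordinates of the outcome by those of an
  independent copy.\<close>

definition resample_init :: "'v set \<Rightarrow> 'v outcome \<Rightarrow> ('v \<Rightarrow> bool) \<Rightarrow> 'v outcome" where
  "resample_init S \<omega> y = (\<lambda>x. if x \<in> S then y x else init_car \<omega> x, snd \<omega>)"

definition resample_move :: "('v \<times> nat \<times> 'v) set \<Rightarrow> 'v outcome \<Rightarrow> ('v \<times> nat \<times> 'v \<Rightarrow> 'v) \<Rightarrow> 'v outcome" where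
  "resample_move S \<omega> y = (fst \<omega>, \<lambda>i. if i \<in> S then y i else next_vertex \<omega> i, snd (snd \<omega>))"

lemma measurable_resample_init [measurable]:
  "(\<lambda>(\<omega>, y). resample_init S \<omega> y) \<in> measurable (parking_measure K p \<Otimes>\<^sub>M init_measure p) (parking_measure K p)"
proof (rule measurable_to_parking)
  show "(\<lambda>w. init_car (case w of (\<omega>, y) \<Rightarrow> resample_init S \<omega> y) x) \<in> measurable (parking_measure K p \<Otimes>\<^sub>M init_measure p) (count_space UNIV)" for x
    by (cases "x \<in> S") (simp_all add: resample_init_def case_prod_beta)
qed (simp_all add: resample_init_def case_prod_beta)

lemma measurable_resample_move [measurable]:
  "(\<lambda>(\<omega>, y). resample_move S \<omega> y) \<in> measurable (parking_measure K p \<Otimes>\<^sub>M move_measure K) (parking_measure K p)"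
proof (rule measurable_to_parking)
  show "(\<lambda>w. next_vertex (case w of (\<omega>, y) \<Rightarrow> resample_move S \<omega> y) i) \<in> measurable (parking_measure K p \<Otimes>\<^sub>M move_measure K) (count_space UNIV)" for i
    by (cases "i \<in> S") (simp_all add: resample_move_def case_prod_beta)
qed (simp_all add: resample_move_def case_prod_beta)

text \<open>Fubini moves the fresh copy next to the initial configuration and the other components
  to the inside; there \<open>PiM_resample\<close> says that the merged configuration has the
  original law.\<close>

lemma nn_integral_resample_init:
  assumes F [measurable]: "F \<in> borel_measurable (parking_measure K p)"
  shows "(\<integral>\<^sup>+\<omega>. \<integral>\<^sup>+y. F (resample_init S \<omega> y) \<partial>init_measure p \<partial>parking_measure K p) = (\<integral>\<^sup>+\<omega>. F \<omega> \<partial>parking_measure K p)"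
proof -
  let ?I = "init_measure p" and ?R = "move_measure K \<Otimes>\<^sub>M tie_measure"
  let ?m = "\<lambda>x y i. if i \<in> S then y i else x i"
  interpret I: prob_space ?I by (rule prob_space_init)
  interpret R: prob_space ?R by (rule prob_space_move_tie)
  interpret RI: pair_sigma_finite ?I ?R ..
  have F': "F \<in> borel_measurable (?I \<Otimes>\<^sub>M ?R)" using F by (simp add: parking_measure_def)
  note [measurable] = F'
  have m [measurable]: "(\<lambda>(x, y). ?m x y) \<in> measurable (?I \<Otimes>\<^sub>M ?I) ?I"
  proof (rule measurable_to_init)
    show "(\<lambda>w. (case w of (x, y) \<Rightarrow> ?m x y) i) \<in> measurable (?I \<Otimes>\<^sub>M ?I) (count_space UNIV)" for i
      by (cases "i \<in> S") (simp_all add: case_prod_beta)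
  qed
  have m2 [measurable]: "(\<lambda>y. ?m x y) \<in> measurable ?I ?I" for x
    using measurable_compose[OF measurable_Pair1'[of x ?I ?I] m] by simp
  have meas: "(\<lambda>\<omega>. \<integral>\<^sup>+y. F (resample_init S \<omega> y) \<partial>?I) \<in> borel_measurable (parking_measure K p)"
    by measurable
  have "(\<integral>\<^sup>+\<omega>. \<integral>\<^sup>+y. F (resample_init S \<omega> y) \<partial>?I \<partial>parking_measure K p)
     = (\<integral>\<^sup>+x. \<integral>\<^sup>+r. \<integral>\<^sup>+y. F (?m x y, r) \<partial>?I \<partial>?R \<partial>?I)"
    using meas unfolding parking_measure_def
    by (subst R.nn_integral_fst[symmetric]) (simp_all add: resample_init_def)
  also have "\<dots> = (\<integral>\<^sup>+x. \<integral>\<^sup>+y. \<integral>\<^sup>+r. F (?m x y, r) \<partial>?R \<partial>?I \<partial>?I)"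
    by (intro nn_integral_cong RI.Fubini') measurable
  also have "\<dots> = (\<integral>\<^sup>+z. (\<integral>\<^sup>+r. F ((case z of (x, y) \<Rightarrow> ?m x y), r) \<partial>?R) \<partial>(?I \<Otimes>\<^sub>M ?I))"
    by (subst I.nn_integral_fst[symmetric]) simp_all
  also have "\<dots> = (\<integral>\<^sup>+x. (\<integral>\<^sup>+r. F (x, r) \<partial>?R) \<partial>distr (?I \<Otimes>\<^sub>M ?I) ?I (\<lambda>(x, y). ?m x y))"
    by (subst nn_integral_distr) simp_all
  also have "distr (?I \<Otimes>\<^sub>M ?I) ?I (\<lambda>(x, y). ?m x y) = ?I"
    by (rule PiM_resample) (rule prob_space_measure_pmf)
  also have "(\<integral>\<^sup>+x. (\<integral>\<^sup>+r. F (x, r) \<partial>?R) \<partial>?I) = (\<integral>\<^sup>+\<omega>. F \<omega> \<partial>parking_measure K p)"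
    unfolding parking_measure_def by (rule R.nn_integral_fst) simp
  finally show ?thesis .
qed

lemma nn_integral_merge_move:
  assumes F [measurable]: "F \<in> borel_measurable (move_measure K)"
  shows "(\<integral>\<^sup>+x. \<integral>\<^sup>+y. F (\<lambda>i. if i \<in> S then y i else x i) \<partial>move_measure K \<partial>move_measure K) = (\<integral>\<^sup>+x. F x \<partial>move_measure K)"
proof -
  let ?N = "move_measure K"
  let ?m = "\<lambda>x y i. if i \<in> S then y i else x i"
  interpret N: prob_space ?N by (rule prob_space_move)
  have m [measurable]: "(\<lambda>(x, y). ?m x y) \<in> measurable (?N \<Otimes>\<^sub>M ?N) ?N"
  proof (rule measurable_to_move)
    show "(\<lambda>w. (case w of (x, y) \<Rightarrow> ?m x y) i) \<in> measurable (?N \<Otimes>\<^sub>M ?N) (count_space UNIV)" for i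
      by (cases "i \<in> S") (simp_all add: case_prod_beta)
  qed
  have "(\<integral>\<^sup>+x. \<integral>\<^sup>+y. F (?m x y) \<partial>?N \<partial>?N) = (\<integral>\<^sup>+w. F (case w of (x, y) \<Rightarrow> ?m x y) \<partial>(?N \<Otimes>\<^sub>M ?N))"
    by (subst N.nn_integral_fst[symmetric]) simp_all
  also have "\<dots> = (\<integral>\<^sup>+x. F x \<partial>distr (?N \<Otimes>\<^sub>M ?N) ?N (\<lambda>(x, y). ?m x y))"
    by (subst nn_integral_distr) simp_all
  also have "distr (?N \<Otimes>\<^sub>M ?N) ?N (\<lambda>(x, y). ?m x y) = ?N"
    by (rule PiM_resample) (rule prob_space_move_factor)
  finally show ?thesis .
qed

lemma nn_integral_resample_move:
  assumes F [measurable]: "F \<in> borel_measurable (parking_measure K p)"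
  shows "(\<integral>\<^sup>+\<omega>. \<integral>\<^sup>+y. F (resample_move S \<omega> y) \<partial>move_measure K \<partial>parking_measure K p) = (\<integral>\<^sup>+\<omega>. F \<omega> \<partial>parking_measure K p)"
proof -
  let ?I = "init_measure p" and ?N = "move_measure K" and ?T = "tie_measure"
  let ?m = "\<lambda>x y i. if i \<in> S then y i else x i"
  interpret I: prob_space ?I by (rule prob_space_init)
  interpret N: prob_space ?N by (rule prob_space_move)
  interpret T: prob_space ?T by (rule prob_space_tie)
  interpret R: prob_space "?N \<Otimes>\<^sub>M ?T" by (rule prob_space_move_tie)
  interpret TN: pair_sigma_finite ?N ?T ..
  have F': "F \<in> borel_measurable (?I \<Otimes>\<^sub>M (?N \<Otimes>\<^sub>M ?T))" using F by (simp add: parking_measure_def)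
  note [measurable] = F'
  have m [measurable]: "(\<lambda>(x, y). ?m x y) \<in> measurable (?N \<Otimes>\<^sub>M ?N) ?N"
  proof (rule measurable_to_move)
    show "(\<lambda>w. (case w of (x, y) \<Rightarrow> ?m x y) i) \<in> measurable (?N \<Otimes>\<^sub>M ?N) (count_space UNIV)" for i
      by (cases "i \<in> S") (simp_all add: case_prod_beta)
  qed
  have m2 [measurable]: "(\<lambda>y. ?m x y) \<in> measurable ?N ?N" for x
    using measurable_compose[OF measurable_Pair1'[of x ?N ?N] m] by simp
  have meas: "(\<lambda>\<omega>. \<integral>\<^sup>+y. F (resample_move S \<omega> y) \<partial>?N) \<in> borel_measurable (parking_measure K p)"
    by measurable
  have meas': "(\<lambda>r. \<integral>\<^sup>+y. F (resample_move S (z, r) y) \<partial>?N) \<in> borel_measurable (?N \<Otimes>\<^sub>M ?T)" for z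
    using measurable_compose[OF measurable_Pair1'[of z ?I "?N \<Otimes>\<^sub>M ?T"] meas[unfolded parking_measure_def]] by simp
  have "(\<integral>\<^sup>+\<omega>. \<integral>\<^sup>+y. F (resample_move S \<omega> y) \<partial>?N \<partial>parking_measure K p)
     = (\<integral>\<^sup>+z. \<integral>\<^sup>+r. \<integral>\<^sup>+y. F (resample_move S (z, r) y) \<partial>?N \<partial>(?N \<Otimes>\<^sub>M ?T) \<partial>?I)"
    using meas unfolding parking_measure_def
    by (subst R.nn_integral_fst[symmetric]) simp_all
  also have "\<dots> = (\<integral>\<^sup>+z. \<integral>\<^sup>+x. \<integral>\<^sup>+s. \<integral>\<^sup>+y. F (z, ?m x y, s) \<partial>?N \<partial>?T \<partial>?N \<partial>?I)"
    using meas' by (subst T.nn_integral_fst[symmetric]) (simp_all add: resample_move_def cong: if_cong)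
  also have "\<dots> = (\<integral>\<^sup>+z. \<integral>\<^sup>+x. \<integral>\<^sup>+y. \<integral>\<^sup>+s. F (z, ?m x y, s) \<partial>?T \<partial>?N \<partial>?N \<partial>?I)"
    by (intro nn_integral_cong TN.Fubini') measurable
  also have "\<dots> = (\<integral>\<^sup>+z. \<integral>\<^sup>+x. (\<integral>\<^sup>+s. F (z, x, s) \<partial>?T) \<partial>?N \<partial>?I)"
    by (intro nn_integral_cong nn_integral_merge_move) measurable
  also have "(\<integral>\<^sup>+z. \<integral>\<^sup>+x. (\<integral>\<^sup>+s. F (z, x, s) \<partial>?T) \<partial>?N \<partial>?I) = (\<integral>\<^sup>+z. \<integral>\<^sup>+r. F (z, r) \<partial>(?N \<Otimes>\<^sub>M ?T) \<partial>?I)"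
    by (subst T.nn_integral_fst[symmetric]) simp_all
  also have "\<dots> = (\<integral>\<^sup>+\<omega>. F \<omega> \<partial>parking_measure K p)"
    unfolding parking_measure_def by (rule R.nn_integral_fst) simp
  finally show ?thesis .
qed

lemma emeasure_init_box:
  assumes "finite J" "p \<in> {0..1}"
  shows "emeasure (init_measure p) {y. \<forall>x\<in>J. y x} = ennreal (p ^ card J)"
    "emeasure (init_measure p) {y. \<forall>x\<in>J. \<not> y x} = ennreal ((1 - p) ^ card J)"
proof -
  have *: "emeasure (init_measure p) {y. \<forall>x\<in>J. y x \<in> B} = (\<Prod>x\<in>J. emeasure (measure_pmf (bernoulli_pmf p)) B)" for B
  proof -
    have "{y. \<forall>x\<in>J. y x \<in> B} = prod_emb UNIV (\<lambda>_. measure_pmf (bernoulli_pmf p)) J (\<Pi>\<^sub>E x\<in>J. B)"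
      by (auto simp: prod_emb_def)
    then show ?thesis using assms(1) by (simp only:) (rule emeasure_PiM_emb, auto simp: prob_space_measure_pmf)
  qed
  show "emeasure (init_measure p) {y. \<forall>x\<in>J. y x} = ennreal (p ^ card J)"
    using *[of "{True}"] assms by (simp add: emeasure_pmf_single ennreal_power)
  show "emeasure (init_measure p) {y. \<forall>x\<in>J. \<not> y x} = ennreal ((1 - p) ^ card J)"
    using *[of "{False}"] assms by (simp add: emeasure_pmf_single ennreal_power)
qed

lemma emeasure_move_box:
  assumes "finite J"
  shows "emeasure (move_measure K) {y. \<forall>i\<in>J. y i \<in> B i} = (\<Prod>i\<in>J. emeasure (measure_pmf (step_pmf K (snd (snd i)))) (B i))"
proof -
  let ?M = "\<lambda>i. case i of (c, t, x) \<Rightarrow> measure_pmf (step_pmf K x)"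
  have "{y. \<forall>i\<in>J. y i \<in> B i} = prod_emb UNIV ?M J (Pi\<^sub>E J B)"
    by (auto simp: prod_emb_def space_move_factor)
  then have "emeasure (move_measure K) {y. \<forall>i\<in>J. y i \<in> B i} = (\<Prod>i\<in>J. emeasure (?M i) (B i))"
    using assms by (simp only:) (rule emeasure_PiM_emb, auto simp: prob_space_move_factor split: prod.split)
  then show ?thesis by (simp add: case_prod_beta)
qed

section \<open>Standing assumptions and measurability of the process\<close>

locale parking_graph =
  fixes E :: "'v \<Rightarrow> 'v \<Rightarrow> bool" and K :: "'v \<Rightarrow> 'v \<Rightarrow> real" and \<Gamma> :: "('v \<Rightarrow> 'v) set"
  assumes simple: "simple_graph E"
    and loc_fin: "locally_finite_graph E"
    and conn: "connected_graph E"
    and kernel: "markov_kernel E K"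
    and subgp: "subgroup \<Gamma> (kernel_aut_group E K)"
    and trans: "transitive_triple \<Gamma>"
    and unimod: "unimodular_triple \<Gamma>"
    and inf_acc: "infinitely_accessible E K \<Gamma>"
begin

lemma symE: "symp E" using simple by (simp add: simple_graph_def)

lemma countable_V: "countable (UNIV :: 'v set)"
  using countable_vertices[OF loc_fin conn] .

lemma K_nonneg: "0 \<le> K x y" and K_le_1: "K x y \<le> 1" and K_edge: "\<not> E x y \<Longrightarrow> K x y = 0"
  using kernel by (auto simp: markov_kernel_def)

lemma pmf_step: "pmf (step_pmf K x) y = K x y"
  by (rule pmf_step_pmf[OF loc_fin kernel])

lemma aut:
  assumes "\<phi> \<in> \<Gamma>"
  shows "bij \<phi>" "E (\<phi> x) (\<phi> y) \<longleftrightarrow> E x y" "K (\<phi> x) (\<phi> y) = K x y"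
  using subgroup.subset[OF subgp] assms by (auto simp: kernel_aut_group_def)

lemma \<Gamma>_id: "id \<in> \<Gamma>"
  using subgroup.one_closed[OF subgp] by (simp add: kernel_aut_group_def)

lemma \<Gamma>_comp: "\<phi> \<in> \<Gamma> \<Longrightarrow> \<psi> \<in> \<Gamma> \<Longrightarrow> \<phi> \<circ> \<psi> \<in> \<Gamma>"
  using subgroup.m_closed[OF subgp] by (simp add: kernel_aut_group_def)

lemma \<Gamma>_inv:
  assumes "\<phi> \<in> \<Gamma>"
  shows "inv_into UNIV \<phi> \<in> \<Gamma>"
proof -
  interpret group "kernel_aut_group E K" by (rule group_kernel_aut_group)
  obtain \<psi> where \<psi>: "\<psi> = m_inv (kernel_aut_group E K) \<phi>" by simp
  have \<psi>\<Gamma>: "\<psi> \<in> \<Gamma>" using subgroup.m_inv_closed[OF subgp assms] \<psi> by simp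
  have "\<psi> \<otimes>\<^bsub>kernel_aut_group E K\<^esub> \<phi> = \<one>\<^bsub>kernel_aut_group E K\<^esub>"
    using assms subgroup.subset[OF subgp] unfolding \<psi> by (intro l_inv) auto
  then have "\<psi> \<circ> \<phi> = id" by (simp add: kernel_aut_group_def)
  then have "\<psi> = inv_into UNIV \<phi>"
    using aut(1)[OF assms] by (metis bij_is_inj bij_is_surj comp_assoc comp_id id_comp inj_iff surj_iff)
  then show ?thesis using \<psi>\<Gamma> by simp
qed

lemma \<Gamma>_funpow: "\<phi> \<in> \<Gamma> \<Longrightarrow> \<phi> ^^ n \<in> \<Gamma>"
  by (induction n) (auto simp: \<Gamma>_id \<Gamma>_comp)

lemma ex_transport: "\<exists>\<phi>\<in>\<Gamma>. \<phi> u = v"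
  using trans by (auto simp: transitive_triple_def transporter_def)

lemma aut_relpowp:
  assumes "\<phi> \<in> \<Gamma>"
  shows "(E ^^ n) x y \<Longrightarrow> (E ^^ n) (\<phi> x) (\<phi> y)"
proof (induction n arbitrary: y)
  case (Suc n)
  then show ?case using aut(2)[OF assms] by fastforce
qed auto

lemma measurable_car_pos [measurable]:
  "(\<lambda>\<omega>. car_pos \<omega> c t) \<in> measurable (parking_measure K' p) (count_space (UNIV :: 'v set))"
proof (induction t)
  case (Suc t)
  have "(\<lambda>\<omega>. next_vertex \<omega> (c, t, car_pos \<omega> c t)) \<in> measurable (parking_measure K' p) (count_space UNIV)"
    by (rule measurable_compose_countable'[OF _ Suc countable_V]) simp
  then show ?case by simp
qed simp

text \<open>Cars and spots go together because each step of one reads the other. Conditions at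
  random positions are split over the countably many vertices.\<close>

lemma measurable_unparked_free:
  "Measurable.pred (parking_measure K' p) (\<lambda>\<omega>. (c::'v) \<in> unparked \<omega> t)
   \<and> Measurable.pred (parking_measure K' p) (\<lambda>\<omega>. (x::'v) \<in> free \<omega> t)"
proof (induction t arbitrary: c x)
  case 0
  show ?case by (simp add: unparked_0 free_0)
next
  case (Suc t)
  note [measurable] = Suc.IH[THEN conjunct1] Suc.IH[THEN conjunct2]
  have eqm [measurable]: "Measurable.pred (parking_measure K' p) (\<lambda>\<omega>. car_pos \<omega> c s = x)" for c s and x :: 'v
    by measurable
  have eqm' [measurable]: "Measurable.pred (parking_measure K' p) (\<lambda>\<omega>. car_pos \<omega> c s = car_pos \<omega> d s)" for s and c d :: 'v
  proof -
    have "(\<lambda>\<omega>. car_pos \<omega> c s = car_pos \<omega> d s) = (\<lambda>\<omega>. \<exists>x. car_pos \<omega> c s = x \<and> car_pos \<omega> d s = x)" by auto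
    also have "Measurable.pred (parking_measure K' p) \<dots>"
      by (intro pred_all_countable countable_V) measurable
    finally show ?thesis .
  qed
  have F: "Measurable.pred (parking_measure K' p) (\<lambda>\<omega>. car_pos \<omega> c s \<in> free \<omega> t)" for s and c :: 'v
  proof -
    have "(\<lambda>\<omega>. car_pos \<omega> c s \<in> free \<omega> t) = (\<lambda>\<omega>. \<exists>x. car_pos \<omega> c s = x \<and> x \<in> free \<omega> t)" by auto
    also have "Measurable.pred (parking_measure K' p) \<dots>"
      by (intro pred_all_countable countable_V) measurable
    finally show ?thesis .
  qed
  note [measurable] = F
  have P [measurable]: "Measurable.pred (parking_measure K' p) (\<lambda>\<omega>. c \<in> parks \<omega> t)" for c :: 'v
    unfolding in_parks_iff
    by (intro pred_intros_logic pred_all_countable countable_V) (simp_all del: car_pos.simps)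
  have "Measurable.pred (parking_measure K' p) (\<lambda>\<omega>. x \<in> free \<omega> (Suc t))"
    unfolding in_free_Suc_iff
    by (intro pred_intros_logic pred_all_countable countable_V) (simp_all del: car_pos.simps)
  then show ?case by (simp add: unparked_Suc)
qed

lemma measurable_unparked [measurable]: "Measurable.pred (parking_measure K' p) (\<lambda>\<omega>. (c::'v) \<in> unparked \<omega> t)"
  and measurable_free [measurable]: "Measurable.pred (parking_measure K' p) (\<lambda>\<omega>. (x::'v) \<in> free \<omega> t)"
  using measurable_unparked_free by auto

lemma measurable_parks [measurable]: "Measurable.pred (parking_measure K' p) (\<lambda>\<omega>. (c::'v) \<in> parks \<omega> t)"
proof -
  have "c \<in> parks \<omega> t \<longleftrightarrow> c \<in> unparked \<omega> t \<and> c \<notin> unparked \<omega> (Suc t)" for \<omega>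
    unfolding unparked_Suc using in_parks_iff[of c \<omega> t] by blast
  then show ?thesis by simp
qed

end

section \<open>Almost sure regularity; invariance and mixing under automorphisms\<close>

lemma distr_pair_fst:
  assumes "prob_space N"
  shows "distr (M \<Otimes>\<^sub>M N) M fst = M"
proof (rule measure_eqI)
  interpret N: prob_space N by fact
  fix A assume "A \<in> sets (distr (M \<Otimes>\<^sub>M N) M fst)"
  then have A: "A \<in> sets M" by simp
  have "fst -` A \<inter> space (M \<Otimes>\<^sub>M N) = A \<times> space N"
    using sets.sets_into_space[OF A] by (auto simp: space_pair_measure)
  then show "emeasure (distr (M \<Otimes>\<^sub>M N) M fst) A = emeasure M A"
    using A by (simp add: emeasure_distr N.emeasure_pair_measure_Times N.emeasure_space_1)
qed simp

lemma distr_pair_snd: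
  assumes "prob_space M" "sigma_finite_measure N"
  shows "distr (M \<Otimes>\<^sub>M N) N snd = N"
proof (rule measure_eqI)
  interpret M: prob_space M by fact
  interpret N: sigma_finite_measure N by fact
  fix A assume "A \<in> sets (distr (M \<Otimes>\<^sub>M N) N snd)"
  then have A: "A \<in> sets N" by simp
  have "snd -` A \<inter> space (M \<Otimes>\<^sub>M N) = space M \<times> A"
    using sets.sets_into_space[OF A] by (auto simp: space_pair_measure)
  then show "emeasure (distr (M \<Otimes>\<^sub>M N) N snd) A = emeasure N A"
    using A by (simp add: emeasure_distr N.emeasure_pair_measure_Times M.emeasure_space_1)
qed simp

lemma distr_parking_init: "distr (parking_measure K p) (init_measure p) fst = init_measure p"
  unfolding parking_measure_def by (rule distr_pair_fst) (rule prob_space_move_tie)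

lemma distr_parking_snd:
  "distr (parking_measure K p) (move_measure K \<Otimes>\<^sub>M tie_measure) snd = move_measure K \<Otimes>\<^sub>M tie_measure"
  unfolding parking_measure_def
  by (rule distr_pair_snd) (simp_all add: prob_space_init prob_space_move_tie prob_space_imp_sigma_finite)

lemma AE_parking_move:
  assumes "AE y in move_measure K. P y"
  shows "AE \<omega> in parking_measure K p. P (next_vertex \<omega>)"
proof -
  have "AE r in move_measure K \<Otimes>\<^sub>M tie_measure. P (fst r)"
    by (rule AE_distrD[OF measurable_fst]) (simp only: distr_pair_fst[OF prob_space_tie] assms)
  then show ?thesis
    by (rule AE_distrD[OF measurable_snd_parking, unfolded distr_parking_snd])
qed

lemma AE_parking_tie:
  assumes "AE y in tie_measure. P y"
  shows "AE \<omega> in parking_measure K p. P (tie_break \<omega>)"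
proof -
  have "AE r in move_measure K \<Otimes>\<^sub>M tie_measure. P (snd r)"
    by (rule AE_distrD[OF measurable_snd])
      (simp only: distr_pair_snd[OF prob_space_move prob_space_imp_sigma_finite[OF prob_space_tie]] assms)
  then show ?thesis
    by (rule AE_distrD[OF measurable_snd_parking, unfolded distr_parking_snd])
qed

text \<open>Taking coordinate \<open>j\<close> from a fresh copy decouples it from coordinate
  \<open>i\<close>; for a fixed value of the latter, a coincidence has probability 0 under the
  uniform law.\<close>

lemma AE_tie_neq:
  fixes i j :: "'v \<times> nat"
  assumes "i \<noteq> j"
  shows "AE y in tie_measure. y i \<noteq> y j"
proof -
  let ?T = "tie_measure :: ('v \<times> nat \<Rightarrow> real) measure"
  let ?m = "\<lambda>x y k. if k \<in> {j} then y k else x k"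
  interpret T: prob_space ?T by (rule prob_space_tie)
  have m: "(\<lambda>(x, y). ?m x y) \<in> measurable (?T \<Otimes>\<^sub>M ?T) ?T"
  proof (rule measurable_to_tie)
    show "(\<lambda>w. (case w of (x, y) \<Rightarrow> ?m x y) k) \<in> borel_measurable (?T \<Otimes>\<^sub>M ?T)" for k
      by (cases "k \<in> {j}") (simp_all add: case_prod_beta)
  qed
  have B [measurable]: "{y. y i = y j} \<in> sets ?T"
  proof -
    have "{y \<in> space ?T. y i = y j} \<in> sets ?T" by measurable
    then show ?thesis by simp
  qed
  have "emeasure ?T {y. y i = y j} = emeasure (distr (?T \<Otimes>\<^sub>M ?T) ?T (\<lambda>(x, y). ?m x y)) {y. y i = y j}"
    by (subst PiM_resample) (simp_all add: prob_space_uniform01)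
  also have "\<dots> = emeasure (?T \<Otimes>\<^sub>M ?T) {z \<in> space (?T \<Otimes>\<^sub>M ?T). fst z i = snd z j}"
    using assms by (subst emeasure_distr[OF m B]) (auto intro!: arg_cong2[where f=emeasure])
  also have "\<dots> = (\<integral>\<^sup>+x. emeasure ?T {y. x i = y j} \<partial>?T)"
  proof (subst T.emeasure_pair_measure_alt)
    show "{z \<in> space (?T \<Otimes>\<^sub>M ?T). fst z i = snd z j} \<in> sets (?T \<Otimes>\<^sub>M ?T)" by measurable
  qed (auto intro!: nn_integral_cong arg_cong2[where f=emeasure] simp: space_pair_measure)
  also have "\<dots> = (\<integral>\<^sup>+x. 0 \<partial>?T)"
  proof (rule nn_integral_cong)
    fix x :: "'v \<times> nat \<Rightarrow> real"
    have "emeasure ?T {y. x i = y j} = emeasure (distr ?T (uniform_measure lborel {0..1::real}) (\<lambda>y. y j)) {x i}"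
      by (subst emeasure_distr) (auto intro!: arg_cong2[where f=emeasure])
    also have "distr ?T (uniform_measure lborel {0..1::real}) (\<lambda>y. y j) = uniform_measure lborel {0..1::real}"
      by (rule distr_PiM_component) (simp_all add: prob_space_uniform01)
    also have "emeasure (uniform_measure lborel {0..1::real}) {x i} = 0"
    proof -
      have "emeasure lborel ({0..1} \<inter> {x i}) \<le> emeasure lborel {x i}" by (rule emeasure_mono) auto
      then show ?thesis by simp
    qed
    finally show "emeasure ?T {y. x i = y j} = 0" .
  qed
  finally have "emeasure ?T {y. y i = y j} = 0" by simp
  then show ?thesis by (intro AE_I[of _ _ "{y. y i = y j}"]) (use B in auto)
qed

text \<open>Displays \<open>act\<close> as a product of three relabellings, so that invariance and
  mixing can be proved one component at a time.\<close>

lemma act_eq_components: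
  "act \<phi> = (\<lambda>(x, y). ((\<lambda>i. x (\<phi> i)), (\<lambda>(a, b).
     ((\<lambda>i. inv_into UNIV \<phi> (a (case i of (c, t, x) \<Rightarrow> (\<phi> c, t, \<phi> x)))), (\<lambda>i. b (case i of (c, t) \<Rightarrow> (\<phi> c, t))))) y))"
  by (auto simp: act_def fun_eq_iff)

context parking_graph
begin

lemma AE_regular: "AE \<omega> in parking_measure K p. regular E \<omega>"
proof -
  have cntI: "countable (UNIV :: ('v \<times> nat \<times> 'v) set)" "countable (UNIV :: ('v \<times> nat) set)"
  proof -
    have "countable ((UNIV :: 'v set) \<times> (UNIV :: nat set) \<times> (UNIV :: 'v set))" "countable ((UNIV :: 'v set) \<times> (UNIV :: nat set))"
      by (intro countable_SIGMA countable_V countableI_type)+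
    then show "countable (UNIV :: ('v \<times> nat \<times> 'v) set)" "countable (UNIV :: ('v \<times> nat) set)"
      by simp_all
  qed
  have 1: "AE y in move_measure K. \<forall>i\<in>UNIV. E (snd (snd i)) (y i)"
  proof (rule AE_ball_countable'[OF _ cntI(1)])
    fix i :: "'v \<times> nat \<times> 'v"
    obtain c t x where i: "i = (c, t, x)" by (cases i)
    have "AE z in measure_pmf (step_pmf K x). E x z"
    proof (rule AE_pmfI)
      fix z assume "z \<in> set_pmf (step_pmf K x)"
      then have "K x z \<noteq> 0" by (simp add: set_pmf_iff pmf_step)
      then show "E x z" using K_edge by blast
    qed
    then show "AE y in move_measure K. E (snd (snd i)) (y i)"
      using AE_PiM_component[of UNIV "\<lambda>i. case i of (c, t, x) \<Rightarrow> measure_pmf (step_pmf K x)" i "\<lambda>z. E (snd (snd i)) z"]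
      by (auto simp: i prob_space_measure_pmf split: prod.split)
  qed
  have "AE y in tie_measure. i \<noteq> j \<longrightarrow> y i \<noteq> y j" for i j :: "'v \<times> nat"
    by (cases "i = j") (use AE_tie_neq[of i j] in simp_all)
  then have 2: "AE y in tie_measure. \<forall>i\<in>UNIV. \<forall>j\<in>(UNIV :: ('v \<times> nat) set). i \<noteq> j \<longrightarrow> y i \<noteq> y j"
    by (intro AE_ball_countable' cntI)
  show ?thesis
    using AE_parking_move[OF 1, of p] AE_parking_tie[OF 2, of K p]
    by eventually_elim (auto simp: regular_def)
qed

lemma measurable_act [measurable]: "act \<phi> \<in> measurable (parking_measure K p) (parking_measure K' (q::real))" for \<phi> :: "'v \<Rightarrow> 'v"
proof (rule measurable_to_parking)
  show "(\<lambda>w. next_vertex (act \<phi> w) i) \<in> measurable (parking_measure K p) (count_space UNIV)" for i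
  proof -
    obtain c t x where i: "i = (c, t, x)" by (cases i)
    have "(\<lambda>w. inv_into UNIV \<phi> (next_vertex w (\<phi> c, t, \<phi> x))) \<in> measurable (parking_measure K p) (count_space UNIV)"
      by (rule measurable_compose[OF measurable_next_vertex]) simp
    then show ?thesis by (simp add: i act_def)
  qed
qed (auto simp: act_def split: prod.split)

lemma distr_step_aut:
  assumes "\<phi> \<in> \<Gamma>"
  shows "distr (measure_pmf (step_pmf K (\<phi> x))) (measure_pmf (step_pmf K x)) (inv_into UNIV \<phi>) = measure_pmf (step_pmf K x)"
proof -
  have b: "bij \<phi>" by (rule aut(1)[OF assms])
  have "map_pmf (inv_into UNIV \<phi>) (step_pmf K (\<phi> x)) = step_pmf K x"
  proof (rule pmf_eqI)
    fix y
    have "inj (inv_into UNIV \<phi>)" using bij_imp_bij_inv[OF b] by (rule bij_is_inj)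
    then have "pmf (map_pmf (inv_into UNIV \<phi>) (step_pmf K (\<phi> x))) (inv_into UNIV \<phi> (\<phi> y)) = pmf (step_pmf K (\<phi> x)) (\<phi> y)"
      by (rule pmf_map_inj')
    then show "pmf (map_pmf (inv_into UNIV \<phi>) (step_pmf K (\<phi> x))) y = pmf (step_pmf K x) y"
      by (simp add: pmf_step aut(3)[OF assms] inv_into_f_f[OF bij_is_inj[OF b]])
  qed
  then have "measure_pmf (step_pmf K x) = distr (measure_pmf (step_pmf K (\<phi> x))) (count_space UNIV) (inv_into UNIV \<phi>)"
    by (metis map_pmf_rep_eq)
  also have "\<dots> = distr (measure_pmf (step_pmf K (\<phi> x))) (measure_pmf (step_pmf K x)) (inv_into UNIV \<phi>)"
    by (rule distr_cong) auto
  finally show ?thesis by simp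
qed

lemma init_act:
  fixes \<phi> :: "'v \<Rightarrow> 'v"
  shows "(\<lambda>x i. x (\<phi> i)) \<in> measurable (init_measure p) (init_measure p)"
    and "\<phi> \<in> \<Gamma> \<Longrightarrow> distr (init_measure p) (init_measure p) (\<lambda>x i. x (\<phi> i)) = init_measure p"
proof -
  show "(\<lambda>x i. x (\<phi> i)) \<in> measurable (init_measure p) (init_measure p)"
    by (rule measurable_to_init) simp
  show "distr (init_measure p) (init_measure p) (\<lambda>x i. x (\<phi> i)) = init_measure p" if "\<phi> \<in> \<Gamma>"
    by (rule distr_PiM_transform[where M="\<lambda>_. measure_pmf (bernoulli_pmf p)" and \<sigma>=\<phi> and h="\<lambda>_ x. x"])
      (simp_all add: prob_space_measure_pmf distr_id2 bij_is_inj[OF aut(1)[OF that]])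
qed

lemma inj_index:
  assumes "\<phi> \<in> \<Gamma>"
  shows "inj (\<lambda>i :: 'v \<times> nat \<times> 'v. case i of (c, t, x) \<Rightarrow> (\<phi> c, t, \<phi> x))" "inj (\<lambda>i :: 'v \<times> nat. case i of (c, t) \<Rightarrow> (\<phi> c, t))"
  using inj_eq[OF bij_is_inj[OF aut(1)[OF assms]]] by (auto simp: inj_def)

lemma tie_act:
  fixes \<phi> :: "'v \<Rightarrow> 'v"
  shows "(\<lambda>b i. b (case i of (c, t) \<Rightarrow> (\<phi> c, t))) \<in> measurable tie_measure tie_measure"
    and "\<phi> \<in> \<Gamma> \<Longrightarrow> distr tie_measure tie_measure (\<lambda>b i. b (case i of (c, t) \<Rightarrow> (\<phi> c, t))) = tie_measure"
proof -
  show "(\<lambda>b i. b (case i of (c, t) \<Rightarrow> (\<phi> c, t))) \<in> measurable tie_measure tie_measure"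
    by (rule measurable_to_tie) simp
  show "distr tie_measure tie_measure (\<lambda>b i. b (case i of (c, t) \<Rightarrow> (\<phi> c, t))) = tie_measure" if "\<phi> \<in> \<Gamma>"
    by (rule distr_PiM_transform[where M="\<lambda>_. uniform_measure lborel {0..1::real}" and \<sigma>="\<lambda>i :: 'v \<times> nat. case i of (c, t) \<Rightarrow> (\<phi> c, t)" and h="\<lambda>_ x. x"])
      (simp_all add: prob_space_uniform01 distr_id2 inj_index[OF that])
qed

lemma move_factor_aut:
  fixes \<phi> :: "'v \<Rightarrow> 'v"
  shows "inv_into UNIV \<phi> \<in> measurable (case (case i of (c, t, x) \<Rightarrow> (\<phi> c, t, \<phi> x)) of (c, t, x) \<Rightarrow> measure_pmf (step_pmf K x))
      (case i of (c, t, x) \<Rightarrow> measure_pmf (step_pmf K x))"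
    and "\<phi> \<in> \<Gamma> \<Longrightarrow> distr (case (case i of (c, t, x) \<Rightarrow> (\<phi> c, t, \<phi> x)) of (c, t, x) \<Rightarrow> measure_pmf (step_pmf K x))
      (case i of (c, t, x) \<Rightarrow> measure_pmf (step_pmf K x)) (inv_into UNIV \<phi>) = (case i of (c, t, x) \<Rightarrow> measure_pmf (step_pmf K x))"
  by (auto simp: distr_step_aut split: prod.split)

lemma move_act:
  fixes \<phi> :: "'v \<Rightarrow> 'v"
  shows "(\<lambda>a i. inv_into UNIV \<phi> (a (case i of (c, t, x) \<Rightarrow> (\<phi> c, t, \<phi> x)))) \<in> measurable (move_measure K) (move_measure K)"
    and "\<phi> \<in> \<Gamma> \<Longrightarrow> distr (move_measure K) (move_measure K) (\<lambda>a i. inv_into UNIV \<phi> (a (case i of (c, t, x) \<Rightarrow> (\<phi> c, t, \<phi> x)))) = move_measure K"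
proof -
  show "(\<lambda>a i. inv_into UNIV \<phi> (a (case i of (c, t, x) \<Rightarrow> (\<phi> c, t, \<phi> x)))) \<in> measurable (move_measure K) (move_measure K)"
    by (rule measurable_to_move, rule measurable_compose[OF measurable_move_component]) simp
  show "distr (move_measure K) (move_measure K) (\<lambda>a i. inv_into UNIV \<phi> (a (case i of (c, t, x) \<Rightarrow> (\<phi> c, t, \<phi> x)))) = move_measure K" if "\<phi> \<in> \<Gamma>"
    by (rule distr_PiM_transform[where M="\<lambda>i. case i of (c, t, x) \<Rightarrow> measure_pmf (step_pmf K x)"
          and \<sigma>="\<lambda>i :: 'v \<times> nat \<times> 'v. case i of (c, t, x) \<Rightarrow> (\<phi> c, t, \<phi> x)" and h="\<lambda>_. inv_into UNIV \<phi>"])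
      (rule prob_space_move_factor inj_index(1)[OF that] move_factor_aut(1) move_factor_aut(2)[OF that])+
qed

lemma move_tie_act:
  fixes \<phi> :: "'v \<Rightarrow> 'v"
  shows "(\<lambda>(a, b). ((\<lambda>i. inv_into UNIV \<phi> (a (case i of (c, t, x) \<Rightarrow> (\<phi> c, t, \<phi> x)))), (\<lambda>i. b (case i of (c, t) \<Rightarrow> (\<phi> c, t)))))
     \<in> measurable (move_measure K \<Otimes>\<^sub>M tie_measure) (move_measure K \<Otimes>\<^sub>M tie_measure)"
    and "\<phi> \<in> \<Gamma> \<Longrightarrow> distr (move_measure K \<Otimes>\<^sub>M tie_measure) (move_measure K \<Otimes>\<^sub>M tie_measure)
     (\<lambda>(a, b). ((\<lambda>i. inv_into UNIV \<phi> (a (case i of (c, t, x) \<Rightarrow> (\<phi> c, t, \<phi> x)))), (\<lambda>i. b (case i of (c, t) \<Rightarrow> (\<phi> c, t))))) =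
     move_measure K \<Otimes>\<^sub>M tie_measure"
proof -
  note m = measurable_compose[OF measurable_fst move_act(1)] measurable_compose[OF measurable_snd tie_act(1)]
  show "(\<lambda>(a, b). ((\<lambda>i. inv_into UNIV \<phi> (a (case i of (c, t, x) \<Rightarrow> (\<phi> c, t, \<phi> x)))), (\<lambda>i. b (case i of (c, t) \<Rightarrow> (\<phi> c, t)))))
     \<in> measurable (move_measure K \<Otimes>\<^sub>M tie_measure) (move_measure K \<Otimes>\<^sub>M tie_measure)"
    unfolding case_prod_beta by (intro measurable_Pair m[unfolded case_prod_beta])
  assume \<phi>: "\<phi> \<in> \<Gamma>"
  show "distr (move_measure K \<Otimes>\<^sub>M tie_measure) (move_measure K \<Otimes>\<^sub>M tie_measure)
     (\<lambda>(a, b). ((\<lambda>i. inv_into UNIV \<phi> (a (case i of (c, t, x) \<Rightarrow> (\<phi> c, t, \<phi> x)))), (\<lambda>i. b (case i of (c, t) \<Rightarrow> (\<phi> c, t))))) =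
     move_measure K \<Otimes>\<^sub>M tie_measure"
    using pair_measure_distr[OF move_act(1) tie_act(1), of \<phi> \<phi>]
    unfolding tie_act(2)[OF \<phi>] move_act(2)[OF \<phi>] by (simp add: prob_space_tie prob_space_imp_sigma_finite)
qed

lemma distr_act:
  assumes \<phi>: "\<phi> \<in> \<Gamma>"
  shows "distr (parking_measure K p) (parking_measure K p) (act \<phi>) = parking_measure K p"
  unfolding act_eq_components parking_measure_def
  using pair_measure_distr[OF init_act(1) move_tie_act(1), of \<phi> p \<phi>]
  unfolding init_act(2)[OF \<phi>] move_tie_act(2)[OF \<phi>]
  by (simp add: prob_space_move_tie prob_space_imp_sigma_finite)

lemma emeasure_act:
  assumes "\<phi> \<in> \<Gamma>" and P: "Measurable.pred (parking_measure K p) P"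
  shows "emeasure (parking_measure K p) {\<omega>. P (act \<phi> \<omega>)} = emeasure (parking_measure K p) {\<omega>. P \<omega>}"
proof -
  have S: "{\<omega>. P \<omega>} \<in> sets (parking_measure K p)" using P by (simp add: pred_def)
  have "emeasure (parking_measure K p) {\<omega>. P \<omega>} = emeasure (distr (parking_measure K p) (parking_measure K p) (act \<phi>)) {\<omega>. P \<omega>}"
    by (simp add: distr_act[OF assms(1)])
  also have "\<dots> = emeasure (parking_measure K p) {\<omega>. P (act \<phi> \<omega>)}"
    using S by (subst emeasure_distr) (auto simp: vimage_def)
  finally show ?thesis by simp
qed

text \<open>A walk of k steps from \<open>o'\<close> to \<open>w\<close> is carried along by \<phi>
  n, so having \<open>\<phi> n w\<close> in F would put \<open>\<phi> n o'\<close> within k steps of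
  F, which is a finite set.\<close>

lemma escape_all:
  assumes "\<And>n. \<phi> n \<in> \<Gamma>" and esc: "\<And>F. finite F \<Longrightarrow> eventually (\<lambda>n. \<phi> n o' \<notin> F) sequentially" and "finite F"
  shows "eventually (\<lambda>n. \<phi> n w \<notin> F) sequentially"
proof -
  obtain k where k: "(E ^^ k) o' w" using conn by (auto simp: connected_graph_def rtranclp_power)
  let ?G = "\<Union>f\<in>F. {y. (E ^^ k) f y}"
  have "finite ?G" using \<open>finite F\<close> finite_relpowp[OF loc_fin] by auto
  from esc[OF this] show ?thesis
  proof eventually_elim
    case (elim n)
    have "(E ^^ k) (\<phi> n w) (\<phi> n o')"
      using symp_relpowp[OF symE aut_relpowp[OF assms(1) k]] .
    with elim show ?case by auto
  qed
qed

lemma mixing_act: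
  assumes \<phi>: "\<And>n. \<phi> n \<in> \<Gamma>" and esc: "\<And>F. finite F \<Longrightarrow> eventually (\<lambda>n. \<phi> n o' \<notin> F) sequentially"
  shows "mixing_along (parking_measure K p) (\<lambda>n. act (\<phi> n))"
proof -
  \<comment> \<open>The first entry of an index is the name of a car; moving these names out of a
    finite set already separates the index sets.\<close>
  have ev: "eventually (\<lambda>n. J \<inter> g n ` J' = {}) sequentially" if J: "finite J" "finite J'" and g: "\<And>n i. fst (g n i) = \<phi> n (fst i)"
    for J J' :: "('v \<times> 'b) set" and g
  proof -
    have "eventually (\<lambda>n. \<forall>i\<in>J'. \<phi> n (fst i) \<notin> fst ` J) sequentially"
      using J by (intro eventually_ball_finite ballI escape_all[OF \<phi> esc]) auto
    then show ?thesis by eventually_elim (use g in \<open>force simp: image_iff\<close>)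
  qed
  have ev1: "eventually (\<lambda>n. J \<inter> \<phi> n ` J' = {}) sequentially" if J: "finite J" "finite J'" for J J'
  proof -
    have "eventually (\<lambda>n. \<forall>i\<in>J'. \<phi> n i \<notin> J) sequentially"
      using J by (intro eventually_ball_finite ballI escape_all[OF \<phi> esc]) auto
    then show ?thesis by eventually_elim auto
  qed
  have 1: "mixing_along (init_measure p) (\<lambda>n x i. x (\<phi> n i))"
    by (rule mixing_along_PiM[where M="\<lambda>_. measure_pmf (bernoulli_pmf p)" and \<sigma>=\<phi> and h="\<lambda>_ _ x. x"])
      (simp_all add: ev1 bij_is_inj[OF aut(1)[OF \<phi>]] prob_space_measure_pmf distr_id2)
  have 2: "mixing_along (move_measure K) (\<lambda>n a i. inv_into UNIV (\<phi> n) (a (case i of (c, t, x) \<Rightarrow> (\<phi> n c, t, \<phi> n x))))"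
  proof (rule mixing_along_PiM[where M="\<lambda>i. case i of (c, t, x) \<Rightarrow> measure_pmf (step_pmf K x)"
        and \<sigma>="\<lambda>n (i :: 'v \<times> nat \<times> 'v). case i of (c, t, x) \<Rightarrow> (\<phi> n c, t, \<phi> n x)" and h="\<lambda>n _. inv_into UNIV (\<phi> n)"])
    show "eventually (\<lambda>n. J \<inter> (\<lambda>i. case i of (c, t, x) \<Rightarrow> (\<phi> n c, t, \<phi> n x)) ` J' = {}) sequentially"
      if "finite J" "finite J'" for J J' using that by (rule ev) (auto split: prod.split)
  qed (rule prob_space_move_factor inj_index(1)[OF \<phi>] move_factor_aut(1) move_factor_aut(2)[OF \<phi>])+
  have 3: "mixing_along tie_measure (\<lambda>n b i. b (case i of (c, t) \<Rightarrow> (\<phi> n c, t)))"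
  proof (rule mixing_along_PiM[where M="\<lambda>_. uniform_measure lborel {0..1::real}"
        and \<sigma>="\<lambda>n (i :: 'v \<times> nat). case i of (c, t) \<Rightarrow> (\<phi> n c, t)" and h="\<lambda>_ _ x. x"])
    show "eventually (\<lambda>n. J \<inter> (\<lambda>i. case i of (c, t) \<Rightarrow> (\<phi> n c, t)) ` J' = {}) sequentially"
      if "finite J" "finite J'" for J J' using that by (rule ev) (auto split: prod.split)
  qed (simp_all add: distr_id2 prob_space_uniform01 inj_index(2)[OF \<phi>])
  show ?thesis
    unfolding act_eq_components parking_measure_def
    by (intro mixing_along_pair prob_space_init prob_space_move prob_space_tie prob_space_move_tie init_act move_act tie_act move_tie_act \<phi> 1 2 3)
qed

lemma tendsto_act_inter:
  assumes "\<And>n. \<phi> n \<in> \<Gamma>" "\<And>F. finite F \<Longrightarrow> eventually (\<lambda>n. \<phi> n o' \<notin> F) sequentially"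
    and "Measurable.pred (parking_measure K p) P" "Measurable.pred (parking_measure K p) Q"
  shows "(\<lambda>n. measure (parking_measure K p) {\<omega>. P \<omega> \<and> Q (act (\<phi> n) \<omega>)}) \<longlonglongrightarrow>
    measure (parking_measure K p) {\<omega>. P \<omega>} * measure (parking_measure K p) {\<omega>. Q \<omega>}"
proof -
  have "{\<omega>. P \<omega>} \<in> sets (parking_measure K p)" "{\<omega>. Q \<omega>} \<in> sets (parking_measure K p)"
    using assms(3,4) by (simp_all add: pred_def)
  with mixing_act[where \<phi>=\<phi> and o'=o', OF assms(1,2)] show ?thesis
    unfolding mixing_along_def by (force simp: vimage_def Collect_conj_eq)
qed


section \<open>Mass transport\<close>

text \<open>Two automorphisms that take \<open>o'\<close> to \<open>w\<close> differ by an element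
  of the stabiliser of \<open>o'\<close>, and likewise two that take \<open>v\<close> to
  \<open>o'\<close>; this identifies both fibres. The last identity is conjugation by \<phi>, which
  carries the stabiliser of \<open>v\<close> to that of \<open>o'\<close>. Together with
  unimodularity, the two fibres have the same size.\<close>

lemma stab_orbit_eq_fibre:
  assumes \<phi>: "\<phi> \<in> \<Gamma>" "\<phi> o' = w" "\<phi> v = o'"
  shows "{v'. \<exists>\<psi>\<in>\<Gamma>. \<psi> o' = w \<and> \<psi> v' = o'} = stab_orbit \<Gamma> o' v"
    and "{w'. \<exists>\<psi>\<in>\<Gamma>. \<psi> o' = w' \<and> \<psi> v = o'} = stab_orbit \<Gamma> o' w"
    and "stab_orbit \<Gamma> o' w = \<phi> ` stab_orbit \<Gamma> v o'"
proof -
  let ?i = "inv_into UNIV"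
  have i: "?i \<psi> \<in> \<Gamma>" "?i \<psi> (\<psi> x) = x" "\<psi> (?i \<psi> x) = x" if "\<psi> \<in> \<Gamma>" for \<psi> x
    using aut(1)[OF that] \<Gamma>_inv[OF that] by (auto simp: bij_is_inj bij_is_surj surj_f_inv_f)
  have iw: "?i \<phi> w = o'" "?i \<phi> o' = v" using i(2)[OF \<phi>(1)] \<phi> by metis+
  show "{v'. \<exists>\<psi>\<in>\<Gamma>. \<psi> o' = w \<and> \<psi> v' = o'} = stab_orbit \<Gamma> o' v"
  proof (intro equalityI subsetI)
    fix v' assume "v' \<in> {v'. \<exists>\<psi>\<in>\<Gamma>. \<psi> o' = w \<and> \<psi> v' = o'}"
    then obtain \<psi> where \<psi>: "\<psi> \<in> \<Gamma>" "\<psi> o' = w" "\<psi> v' = o'" by auto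
    have "?i \<psi> w = o'" "?i \<psi> o' = v'" using i(2)[OF \<psi>(1)] \<psi> by metis+
    then have "?i \<psi> \<circ> \<phi> \<in> transporter \<Gamma> o' o'" "(?i \<psi> \<circ> \<phi>) v = v'"
      using i(1)[OF \<psi>(1)] \<Gamma>_comp \<phi> by (auto simp: transporter_def)
    then show "v' \<in> stab_orbit \<Gamma> o' v" unfolding stab_orbit_def by blast
  next
    fix v' assume "v' \<in> stab_orbit \<Gamma> o' v"
    then obtain \<theta> where \<theta>: "\<theta> \<in> \<Gamma>" "\<theta> o' = o'" "v' = \<theta> v" by (auto simp: stab_orbit_def transporter_def)
    have "\<phi> \<circ> ?i \<theta> \<in> \<Gamma>" "(\<phi> \<circ> ?i \<theta>) v' = o'" using i[OF \<theta>(1)] \<Gamma>_comp \<phi> \<theta> by auto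
    moreover have "(\<phi> \<circ> ?i \<theta>) o' = w" using i(2)[OF \<theta>(1), of o'] \<theta> \<phi> by simp
    ultimately show "v' \<in> {v'. \<exists>\<psi>\<in>\<Gamma>. \<psi> o' = w \<and> \<psi> v' = o'}" by blast
  qed
  show "{w'. \<exists>\<psi>\<in>\<Gamma>. \<psi> o' = w' \<and> \<psi> v = o'} = stab_orbit \<Gamma> o' w"
  proof (intro equalityI subsetI)
    fix w' assume "w' \<in> {w'. \<exists>\<psi>\<in>\<Gamma>. \<psi> o' = w' \<and> \<psi> v = o'}"
    then obtain \<psi> where \<psi>: "\<psi> \<in> \<Gamma>" "\<psi> o' = w'" "\<psi> v = o'" by auto
    have "\<psi> \<circ> ?i \<phi> \<in> transporter \<Gamma> o' o'" "(\<psi> \<circ> ?i \<phi>) w = w'"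
      using i[OF \<phi>(1)] \<Gamma>_comp \<psi> iw by (auto simp: transporter_def)
    then show "w' \<in> stab_orbit \<Gamma> o' w" unfolding stab_orbit_def by blast
  next
    fix w' assume "w' \<in> stab_orbit \<Gamma> o' w"
    then obtain \<theta> where \<theta>: "\<theta> \<in> \<Gamma>" "\<theta> o' = o'" "w' = \<theta> w" by (auto simp: stab_orbit_def transporter_def)
    have "\<theta> \<circ> \<phi> \<in> \<Gamma>" "(\<theta> \<circ> \<phi>) o' = w'" "(\<theta> \<circ> \<phi>) v = o'" using \<Gamma>_comp \<phi> \<theta> by auto
    then show "w' \<in> {w'. \<exists>\<psi>\<in>\<Gamma>. \<psi> o' = w' \<and> \<psi> v = o'}" by blast
  qed
  show "stab_orbit \<Gamma> o' w = \<phi> ` stab_orbit \<Gamma> v o'"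
  proof (intro equalityI subsetI)
    fix w' assume "w' \<in> stab_orbit \<Gamma> o' w"
    then obtain \<theta> where \<theta>: "\<theta> \<in> \<Gamma>" "\<theta> o' = o'" "w' = \<theta> w" by (auto simp: stab_orbit_def transporter_def)
    have "?i \<phi> \<circ> \<theta> \<circ> \<phi> \<in> transporter \<Gamma> v v"
      using i(1)[OF \<phi>(1)] \<Gamma>_comp \<phi> \<theta> iw by (auto simp: transporter_def)
    moreover have "w' = \<phi> ((?i \<phi> \<circ> \<theta> \<circ> \<phi>) o')" using i[OF \<phi>(1)] \<phi> \<theta> by simp
    ultimately show "w' \<in> \<phi> ` stab_orbit \<Gamma> v o'" unfolding stab_orbit_def by blast
  next
    fix w' assume "w' \<in> \<phi> ` stab_orbit \<Gamma> v o'"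
    then obtain \<theta> where \<theta>: "\<theta> \<in> \<Gamma>" "\<theta> v = v" "w' = \<phi> (\<theta> o')" by (auto simp: stab_orbit_def transporter_def)
    have "\<phi> \<circ> \<theta> \<circ> ?i \<phi> \<in> transporter \<Gamma> o' o'"
      using i(1)[OF \<phi>(1)] \<Gamma>_comp \<phi> \<theta> iw by (auto simp: transporter_def)
    moreover have "w' = (\<phi> \<circ> \<theta> \<circ> ?i \<phi>) w" using iw \<theta> by simp
    ultimately show "w' \<in> stab_orbit \<Gamma> o' w" unfolding stab_orbit_def by blast
  qed
qed

lemma mass_transport:
  fixes f :: "'v \<Rightarrow> 'v \<Rightarrow> ennreal"
  assumes f: "\<And>\<phi> u v. \<phi> \<in> \<Gamma> \<Longrightarrow> f (\<phi> u) (\<phi> v) = f u v"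
  shows "(\<integral>\<^sup>+v. f o' v \<partial>count_space UNIV) = (\<integral>\<^sup>+v. f v o' \<partial>count_space UNIV)"
proof -
  \<comment> \<open>\<open>r v w\<close> says that \<open>(o', v)\<close> and \<open>(w, o')\<close> lie in the same orbit of \<open>\<Gamma>\<close> on pairs. By unimodularity
    both fibres of \<open>r\<close> have equal finite size, so each value can be spread evenly over its fibre.\<close>
  define r where "r v w \<longleftrightarrow> (\<exists>\<psi>\<in>\<Gamma>. \<psi> o' = w \<and> \<psi> v = o')" for v w
  define n where "n v = card {w. r v w}" for v
  define m where "m w = card {v. r v w}" for w
  have U: "finite (stab_orbit \<Gamma> u v)" "card (stab_orbit \<Gamma> u v) = card (stab_orbit \<Gamma> v u)" for u v
    using unimod unfolding unimodular_triple_def by blast+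
  have fin: "finite {w. r v w}" "finite {v. r v w}" "n v = m w" and feq: "f o' v = f w o'" if "r v w" for v w
  proof -
    from that obtain \<phi> where \<phi>: "\<phi> \<in> \<Gamma>" "\<phi> o' = w" "\<phi> v = o'" by (auto simp: r_def)
    note o = stab_orbit_eq_fibre[OF \<phi>]
    have r: "{w. r v w} = stab_orbit \<Gamma> o' w" "{v. r v w} = stab_orbit \<Gamma> o' v"
      using o(1,2) by (simp_all only: r_def)
    show "finite {w. r v w}" "finite {v. r v w}"
      unfolding r by (rule U(1))+
    have "card (\<phi> ` stab_orbit \<Gamma> v o') = card (stab_orbit \<Gamma> v o')"
      by (rule card_image, rule inj_on_subset[OF bij_is_inj[OF aut(1)[OF \<phi>(1)]]]) simp
    then show "n v = m w"
      unfolding n_def m_def r using U(2)[of v o'] by (simp only: o(3))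
    show "f o' v = f w o'" using f[OF \<phi>(1), of o' v] \<phi> by simp
  qed
  have ex: "\<exists>w. r v w" "\<exists>w. r w v" for v
  proof -
    obtain \<phi> where "\<phi> \<in> \<Gamma>" "\<phi> v = o'" using ex_transport by blast
    then show "\<exists>w. r v w" unfolding r_def by blast
    obtain \<psi> where "\<psi> \<in> \<Gamma>" "\<psi> o' = v" using ex_transport by blast
    moreover from this have "\<psi> (inv_into UNIV \<psi> o') = o'" using aut(1) by (simp add: bij_is_surj surj_f_inv_f)
    ultimately show "\<exists>w. r w v" unfolding r_def by blast
  qed
  have pos: "n v > 0" "m v > 0" "finite {w. r v w}" "finite {w. r w v}" for v
  proof -
    obtain w u where wu: "r v w" "r u v" using ex[of v] by blast
    then show "n v > 0" "m v > 0" "finite {w. r v w}" "finite {w. r w v}"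
      unfolding n_def m_def card_gt_0_iff using fin(1)[OF wu(1)] fin(2)[OF wu(2)] by blast+
  qed
  have cancel: "ennreal (1 / real k) * of_nat k = 1" if "k > 0" for k :: nat
    using that by (simp add: ennreal_of_nat_eq_real_of_nat flip: ennreal_mult)
  have nm: "card {w. r v w} = n v" "card {w. r w v} = m v" for v by (simp_all add: n_def m_def)
  \<comment> \<open>Weight \<open>1 / k\<close> on each of the \<open>k\<close> points of a fibre
    restores the full mass \<open>z\<close>.\<close>
  have c: "(\<integral>\<^sup>+w. (z * ennreal (1 / real k)) * indicator A w \<partial>count_space UNIV) = z"
    if "finite A" "card A = k" "k > 0" for z k and A :: "'v set"
    using cancel[OF that(3)] that(1,2)
    by (subst nn_integral_cmult_indicator) (simp_all add: mult.assoc)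
  note 1 = c[OF pos(3) nm(1) pos(1)] and 2 = c[OF pos(4) nm(2) pos(2)]
  have "(\<integral>\<^sup>+v. f o' v \<partial>count_space UNIV) =
      (\<integral>\<^sup>+v. \<integral>\<^sup>+w. (f o' v * ennreal (1 / real (n v))) * indicator {w. r v w} w \<partial>count_space UNIV \<partial>count_space UNIV)"
    by (simp only: 1)
  also have "\<dots> = (\<integral>\<^sup>+v. \<integral>\<^sup>+w. (f w o' * ennreal (1 / real (m w))) * indicator {v. r v w} v \<partial>count_space UNIV \<partial>count_space UNIV)"
  proof (intro nn_integral_cong)
    fix v w
    show "(f o' v * ennreal (1 / real (n v))) * indicator {w. r v w} w = (f w o' * ennreal (1 / real (m w))) * indicator {v. r v w} v"
      using fin(3)[of v w] feq[of v w] by (cases "r v w") (simp_all add: indicator_def)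
  qed
  also have "\<dots> = (\<integral>\<^sup>+w. \<integral>\<^sup>+v. (f w o' * ennreal (1 / real (m w))) * indicator {v. r v w} v \<partial>count_space UNIV \<partial>count_space UNIV)"
    by (intro nn_integral_count_space_nn_integral countable_V) simp
  also have "\<dots> = (\<integral>\<^sup>+w. f w o' \<partial>count_space UNIV)" by (simp only: 2)
  finally show ?thesis .
qed

section \<open>Expected counts of parking cars and of visits\<close>

lemma emeasure_count_eq:
  "emeasure (count_space UNIV) {v. P v} = (\<integral>\<^sup>+v. of_bool (P v) \<partial>count_space UNIV)"
  using nn_integral_indicator[of "{v. P v}" "count_space UNIV"] by (simp add: indicator_def)

lemma nn_integral_emeasure_count:
  assumes "\<And>v :: 'v. Measurable.pred M (Q v)" and "space M = UNIV"
  shows "(\<integral>\<^sup>+\<omega>. emeasure (count_space UNIV) {v. Q v \<omega>} \<partial>M) = (\<integral>\<^sup>+v. emeasure M {\<omega>. Q v \<omega>} \<partial>count_space UNIV)"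
proof -
  have S: "{\<omega>. Q v \<omega>} \<in> sets M" for v using assms by (simp add: pred_def)
  have "(\<integral>\<^sup>+\<omega>. emeasure (count_space UNIV) {v. Q v \<omega>} \<partial>M) = (\<integral>\<^sup>+\<omega>. \<integral>\<^sup>+v. indicator {\<omega>. Q v \<omega>} \<omega> \<partial>count_space UNIV \<partial>M)"
    by (simp add: emeasure_count_eq indicator_def)
  also have "\<dots> = (\<integral>\<^sup>+v. \<integral>\<^sup>+\<omega>. indicator {\<omega>. Q v \<omega>} \<omega> \<partial>M \<partial>count_space UNIV)"
    using S by (intro nn_integral_count_space_nn_integral countable_V) auto
  also have "\<dots> = (\<integral>\<^sup>+v. emeasure M {\<omega>. Q v \<omega>} \<partial>count_space UNIV)"
    using S by (intro nn_integral_cong) simp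
  finally show ?thesis .
qed

text \<open>Invariance of the law under \<open>act\<close> makes the probability of
  \<open>Q u v\<close> a diagonally invariant function, and expected counts are sums of such
  probabilities.\<close>

lemma mass_transport_prob:
  assumes Q: "\<And>u v. Measurable.pred (parking_measure K p) (Q u v)"
    and inv: "\<And>\<phi> u v \<omega>. \<phi> \<in> \<Gamma> \<Longrightarrow> Q u v (act \<phi> \<omega>) \<longleftrightarrow> Q (\<phi> u) (\<phi> v) \<omega>"
  shows "(\<integral>\<^sup>+\<omega>. emeasure (count_space UNIV) {v. Q o' v \<omega>} \<partial>parking_measure K p) =
    (\<integral>\<^sup>+\<omega>. emeasure (count_space UNIV) {v. Q v o' \<omega>} \<partial>parking_measure K p)"
proof -
  have "(\<integral>\<^sup>+v. emeasure (parking_measure K p) {\<omega>. Q o' v \<omega>} \<partial>count_space UNIV) =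
    (\<integral>\<^sup>+v. emeasure (parking_measure K p) {\<omega>. Q v o' \<omega>} \<partial>count_space UNIV)"
  proof (rule mass_transport)
    fix \<phi> u v assume "\<phi> \<in> \<Gamma>"
    from emeasure_act[OF this Q] inv[OF this]
    show "emeasure (parking_measure K p) {\<omega>. Q (\<phi> u) (\<phi> v) \<omega>} = emeasure (parking_measure K p) {\<omega>. Q u v \<omega>}"
      by simp
  qed
  then show ?thesis using Q by (simp add: nn_integral_emeasure_count)
qed

lemma measurable_car_pos_eq [measurable]: "Measurable.pred (parking_measure K p) (\<lambda>\<omega>. car_pos \<omega> (c::'v) t = x)"
  by measurable

lemma emeasure_count_unique:
  assumes "\<And>x y. P x \<Longrightarrow> P y \<Longrightarrow> x = y"
  shows "emeasure (count_space UNIV) {x. P x} = (if \<exists>x. P x then 1 else 0)"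
proof (cases "\<exists>x. P x")
  case True
  then obtain x where "P x" by auto
  then have "{x. P x} = {x}" using assms by auto
  with True show ?thesis by simp
next
  case False
  then have "{x. P x} = {}" by auto
  then show ?thesis using False by simp
qed

lemma car_pos_act': "\<phi> \<in> \<Gamma> \<Longrightarrow> car_pos (act \<phi> \<omega>) c t = x \<longleftrightarrow> car_pos \<omega> (\<phi> c) t = \<phi> x"
  using car_pos_act[OF aut(1), of \<phi> \<omega> c t] inj_eq[OF bij_is_inj[OF aut(1)], of \<phi> "car_pos (act \<phi> \<omega>) c t" x] by auto

definition unparked_prob :: "real \<Rightarrow> 'v \<Rightarrow> nat \<Rightarrow> real" where
  "unparked_prob p v t = measure (parking_measure K p) {\<omega>. v \<in> unparked \<omega> t}"

definition free_prob :: "real \<Rightarrow> 'v \<Rightarrow> nat \<Rightarrow> real" where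
  "free_prob p v t = measure (parking_measure K p) {\<omega>. v \<in> free \<omega> t}"

lemma sets_parking_Collect: "Measurable.pred (parking_measure K p) P \<Longrightarrow> {\<omega>. P \<omega>} \<in> sets (parking_measure K p)"
  by (simp add: pred_def)

lemma nn_integral_indicator_parking:
  "Measurable.pred (parking_measure K p) P \<Longrightarrow>
   (\<integral>\<^sup>+\<omega>. (if P \<omega> then 1 else 0) \<partial>parking_measure K p) = emeasure (parking_measure K p) {\<omega>. P \<omega>}"
  using nn_integral_indicator[OF sets_parking_Collect] by (simp add: indicator_def of_bool_def)

text \<open>Both counts in the transport are 0 or 1: a car has one position at time
  \<open>Suc t\<close>, and \<open>parks_unique\<close> allows one parking car per spot.\<close>

lemma prob_parks_eq_filled:
  "emeasure (parking_measure K p) {\<omega>. v \<in> parks \<omega> t} =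
   emeasure (parking_measure K p) {\<omega>. v \<in> free \<omega> t \<and> v \<notin> free \<omega> (Suc t)}"
proof -
  let ?Q = "\<lambda>c x \<omega>. c \<in> parks \<omega> t \<and> car_pos \<omega> c (Suc t) = x"
  have mt: "(\<integral>\<^sup>+\<omega>. emeasure (count_space UNIV) {x. ?Q v x \<omega>} \<partial>parking_measure K p) =
    (\<integral>\<^sup>+\<omega>. emeasure (count_space UNIV) {c. ?Q c v \<omega>} \<partial>parking_measure K p)"
  proof (rule mass_transport_prob)
    show "?Q u w (act \<phi> \<omega>) \<longleftrightarrow> ?Q (\<phi> u) (\<phi> w) \<omega>" if "\<phi> \<in> \<Gamma>" for \<phi> u w \<omega>
      using that in_parks_act[OF aut(1)[OF that]] car_pos_act'[OF that] by (simp del: car_pos.simps)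
    show "Measurable.pred (parking_measure K p) (?Q u w)" for u w
      by (intro pred_intros_logic measurable_parks measurable_car_pos_eq)
  qed
  have 1: "emeasure (count_space UNIV) {x. ?Q v x \<omega>} = (if v \<in> parks \<omega> t then 1 else 0)" for \<omega>
    by (subst emeasure_count_unique) (blast, simp del: car_pos.simps)
  have 2: "emeasure (count_space UNIV) {c. ?Q c v \<omega>} = (if v \<in> free \<omega> t \<and> v \<notin> free \<omega> (Suc t) then 1 else 0)" for \<omega>
  proof -
    have "(\<exists>c. ?Q c v \<omega>) \<longleftrightarrow> v \<in> free \<omega> t \<and> v \<notin> free \<omega> (Suc t)"
      unfolding in_free_Suc_iff using parks_imp(2) by fast
    moreover have "c = d" if "?Q c v \<omega>" "?Q d v \<omega>" for c d
      using that by (intro parks_unique[of c \<omega> t d]) (simp_all only:)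
    ultimately show ?thesis by (subst emeasure_count_unique) (simp_all del: car_pos.simps)
  qed
  have "Measurable.pred (parking_measure K p) (\<lambda>\<omega>. v \<in> free \<omega> t \<and> v \<notin> free \<omega> (Suc t))"
    by (intro pred_intros_logic measurable_free)
  note m = nn_integral_indicator_parking[OF measurable_parks] nn_integral_indicator_parking[OF this]
  show ?thesis
    using mt unfolding 1 2 m .
qed

text \<open>The constant is p - (1 - p), the difference at time 0; afterwards both probabilities
  drop by the same amount at each step.\<close>

lemma prob_unparked_free:
  assumes "p \<in> {0..1}"
  shows "unparked_prob p v t = 2 * p - 1 + free_prob p v t"
proof (induction t)
  case 0
  interpret prob_space "parking_measure K p" by (rule prob_space_parking)
  have S: "{x. x v} \<in> sets (init_measure p)"
    using measurable_init_component[of v p] by (simp add: pred_def)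
  have "emeasure (parking_measure K p) {\<omega>. init_car \<omega> v} = emeasure (distr (parking_measure K p) (init_measure p) fst) {x. x v}"
    using S by (subst emeasure_distr) (auto simp: vimage_def)
  also have "\<dots> = p"
    using emeasure_init_box(1)[of "{v}" p] assms by (simp add: distr_parking_init)
  finally have a0: "unparked_prob p v 0 = p" using assms by (simp add: unparked_prob_def unparked_0 emeasure_eq_measure)
  have "{\<omega>. init_car \<omega> v} \<in> sets (parking_measure K p)" by (rule sets_parking_Collect) measurable
  from prob_compl[OF this] have "free_prob p v 0 = 1 - unparked_prob p v 0"
    by (simp add: unparked_prob_def free_prob_def unparked_0 free_0 Compl_eq_Diff_UNIV[symmetric] Collect_neg_eq)
  then show ?case using a0 by simp
next
  case (Suc t)
  interpret prob_space "parking_measure K p" by (rule prob_space_parking)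
  have parks: "v \<in> parks \<omega> t \<longleftrightarrow> v \<in> unparked \<omega> t \<and> v \<notin> unparked \<omega> (Suc t)" for \<omega>
    unfolding unparked_Suc using in_parks_iff[of v \<omega> t] by blast
  have "measure (parking_measure K p) ({\<omega>. v \<in> unparked \<omega> t} - {\<omega>. v \<in> unparked \<omega> (Suc t)}) = unparked_prob p v t - unparked_prob p v (Suc t)"
    unfolding unparked_prob_def by (rule finite_measure_Diff[OF sets_parking_Collect[OF measurable_unparked] sets_parking_Collect[OF measurable_unparked]]) (auto simp: unparked_Suc)
  moreover have "measure (parking_measure K p) ({\<omega>. v \<in> free \<omega> t} - {\<omega>. v \<in> free \<omega> (Suc t)}) = free_prob p v t - free_prob p v (Suc t)"
    unfolding free_prob_def by (rule finite_measure_Diff[OF sets_parking_Collect[OF measurable_free] sets_parking_Collect[OF measurable_free]]) (auto simp: free_Suc)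
  moreover have "measure (parking_measure K p) ({\<omega>. v \<in> unparked \<omega> t} - {\<omega>. v \<in> unparked \<omega> (Suc t)}) =
    measure (parking_measure K p) ({\<omega>. v \<in> free \<omega> t} - {\<omega>. v \<in> free \<omega> (Suc t)})"
    using prob_parks_eq_filled[of p v t] unfolding parks by (simp add: measure_def set_diff_eq)
  ultimately show ?case using Suc by simp
qed

lemma visitors_Suc:
  "visitors E \<omega> v (Suc t) = {c. c \<in> unparked \<omega> t \<and> E (car_pos \<omega> c t) v \<and> car_pos \<omega> c (Suc t) = v}"
  using symE by (auto simp: visitors_def neighbors_def dest: sympD)

lemma measurable_visitors [measurable]:
  "Measurable.pred (parking_measure K p) (\<lambda>\<omega>. c \<in> unparked \<omega> t \<and> E (car_pos \<omega> c t) v \<and> car_pos \<omega> c (Suc t) = v)" for c v :: 'v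
  by (intro pred_intros_logic measurable_unparked measurable_car_pos_eq measurable_compose[OF measurable_car_pos]) simp

text \<open>An unparked car moves to exactly one vertex, on regular outcomes an adjacent one, so the
  count on the other side of the transport is an indicator.\<close>

lemma nn_integral_visitors:
  "(\<integral>\<^sup>+\<omega>. emeasure (count_space UNIV) (visitors E \<omega> v (Suc t)) \<partial>parking_measure K p) = ennreal (unparked_prob p v t)"
proof -
  interpret prob_space "parking_measure K p" by (rule prob_space_parking)
  let ?Q = "\<lambda>v c \<omega>. c \<in> unparked \<omega> t \<and> E (car_pos \<omega> c t) v \<and> car_pos \<omega> c (Suc t) = v"
  have "(\<integral>\<^sup>+\<omega>. emeasure (count_space UNIV) (visitors E \<omega> v (Suc t)) \<partial>parking_measure K p) =
     (\<integral>\<^sup>+\<omega>. emeasure (count_space UNIV) {c. ?Q v c \<omega>} \<partial>parking_measure K p)"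
    by (simp only: visitors_Suc)
  also have "\<dots> = (\<integral>\<^sup>+\<omega>. emeasure (count_space UNIV) {x. ?Q x v \<omega>} \<partial>parking_measure K p)"
  proof (rule mass_transport_prob)
    show "?Q u w (act \<phi> \<omega>) \<longleftrightarrow> ?Q (\<phi> u) (\<phi> w) \<omega>" if "\<phi> \<in> \<Gamma>" for \<phi> u w \<omega>
      using that unparked_free_act[OF aut(1)[OF that], of \<omega> t] car_pos_act'[OF that]
        car_pos_act[OF aut(1)[OF that], of \<omega> w t] aut(2)[OF that, of "car_pos (act \<phi> \<omega>) w t" u] by (auto simp del: car_pos.simps)
    show "Measurable.pred (parking_measure K p) (?Q u w)" for u w
      by (rule measurable_visitors)
  qed
  also have "\<dots> = (\<integral>\<^sup>+\<omega>. (if v \<in> unparked \<omega> t then 1 else 0) \<partial>parking_measure K p)"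
    by (rule nn_integral_cong_AE, use AE_regular[of p] in eventually_elim, subst emeasure_count_unique)
       (auto simp: regular_def)
  also have "\<dots> = ennreal (unparked_prob p v t)"
    unfolding unparked_prob_def by (simp add: nn_integral_indicator_parking emeasure_eq_measure)
  finally show ?thesis .
qed

lemma measurable_visits [measurable]:
  "(\<lambda>\<omega>. emeasure (count_space UNIV) (visitors E \<omega> v (Suc t))) \<in> borel_measurable (parking_measure K p)"
proof -
  let ?Q = "\<lambda>c \<omega>. c \<in> unparked \<omega> t \<and> E (car_pos \<omega> c t) v \<and> car_pos \<omega> c (Suc t) = v"
  have eq: "emeasure (count_space UNIV) (visitors E \<omega> v (Suc t)) = (\<integral>\<^sup>+c. indicator {\<omega>. ?Q c \<omega>} \<omega> \<partial>count_space UNIV)" for \<omega>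
    unfolding visitors_Suc emeasure_count_eq by (simp add: indicator_def del: car_pos.simps)
  interpret sigma_finite_measure "count_space (UNIV :: 'v set)"
    by (rule sigma_finite_measure_count_space_countable) (rule countable_V)
  show ?thesis unfolding eq
  proof (rule borel_measurable_nn_integral)
    show "(\<lambda>(\<omega>, c). indicator {\<omega>. ?Q c \<omega>} \<omega> :: ennreal) \<in> borel_measurable (parking_measure K p \<Otimes>\<^sub>M count_space UNIV)"
    proof -
      have "(\<lambda>z. indicator {\<omega>. ?Q (fst z) \<omega>} (snd z) :: ennreal) \<in> borel_measurable (count_space UNIV \<Otimes>\<^sub>M parking_measure K p)"
        by (rule measurable_pair_measure_countable1[OF countable_V])
          (simp only: fst_conv snd_conv, intro borel_measurable_indicator sets_parking_Collect measurable_visitors)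
      from measurable_pair_swap[OF this] show ?thesis by simp
    qed
  qed
qed

lemma visits_eq: "visits E v t \<omega> = (\<Sum>s<t. emeasure (count_space UNIV) (visitors E \<omega> v (Suc s)))"
  unfolding visits_def by (rule sum.reindex_bij_witness[of _ Suc "\<lambda>i. i - 1"]) auto

lemma measurable_visits' [measurable]: "visits E v t \<in> borel_measurable (parking_measure K p)"
  unfolding visits_eq[abs_def] by measurable

lemma nn_integral_visits:
  "(\<integral>\<^sup>+\<omega>. visits E v t \<omega> \<partial>parking_measure K p) = ennreal (\<Sum>s<t. unparked_prob p v s)"
  unfolding visits_eq by (simp add: nn_integral_sum nn_integral_visitors unparked_prob_def)

lemma total_visits_eq: "total_visits E v \<omega> = (SUP t. visits E v t \<omega>)"
proof -
  have "incseq (\<lambda>t. visits E v t \<omega>)"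
    unfolding visits_eq by (intro incseq_SucI) (simp add: add_increasing2)
  then show ?thesis unfolding total_visits_def by (intro limI LIMSEQ_SUP)
qed

lemma nn_integral_total_visits:
  "(\<integral>\<^sup>+\<omega>. total_visits E v \<omega> \<partial>parking_measure K p) = (SUP t. ennreal (\<Sum>s<t. unparked_prob p v s))"
proof -
  have "incseq (\<lambda>t. visits E v t)"
    unfolding visits_eq[abs_def] by (intro incseq_SucI) (simp add: add_increasing2 le_fun_def)
  then show ?thesis
    unfolding total_visits_eq by (subst nn_integral_monotone_convergence_SUP) (auto simp: nn_integral_visits)
qed

lemma unparked_prob_nonneg: "0 \<le> unparked_prob p v t"
  by (simp add: unparked_prob_def)

end

section \<open>The range of a walk\<close>

text \<open>The trajectory depends only on the moves; the two other components are dummies.\<close>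

definition wpos :: "('v \<times> nat \<times> 'v \<Rightarrow> 'v) \<Rightarrow> 'v \<Rightarrow> nat \<Rightarrow> 'v" where
  "wpos y = car_pos (\<lambda>_. False, y, \<lambda>_. 0)"

lemma wpos_0: "wpos y c 0 = c"
  and wpos_Suc: "wpos y c (Suc t) = y (c, t, wpos y c t)"
  by (simp_all add: wpos_def)

lemma car_pos_eq_wpos: "car_pos \<omega> c t = wpos (next_vertex \<omega>) c t"
  by (induction t) (simp_all add: wpos_0 wpos_Suc)

lemma wpos_cong:
  assumes "\<And>s x. s < t \<Longrightarrow> y (c, s, x) = y' (c, s, x)"
  shows "wpos y c t = wpos y' c t"
  using assms by (induction t) (auto simp: wpos_0 wpos_Suc)

lemma wpos_follow:
  assumes "wpos y c t = \<gamma> 0" "\<And>i. i < r \<Longrightarrow> y (c, t + i, \<gamma> i) = \<gamma> (Suc i)"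
  shows "i \<le> r \<Longrightarrow> wpos y c (t + i) = \<gamma> i"
proof (induction i)
  case (Suc i)
  then show ?case using assms(2)[of i] by (simp add: wpos_Suc)
qed (simp add: assms)

context parking_graph
begin

lemma accessible_imp_rtranclp:
  assumes "accessible_from E K u v"
  shows "(\<lambda>x y. 0 < K x y)\<^sup>*\<^sup>* v u"
proof -
  from assms obtain n x where x: "x 0 = v" "x n = u" and pos: "(\<Prod>i<n. K (x i) (x (Suc i))) > 0"
    unfolding accessible_from_def by blast
  have "0 < K (x i) (x (Suc i))" if "i < n" for i
  proof -
    have "K (x i) (x (Suc i)) \<noteq> 0" using pos that by (metis finite_lessThan lessThan_iff less_irrefl prod_zero_iff)
    then show ?thesis using K_nonneg[of "x i" "x (Suc i)"] by linarith
  qed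
  then show ?thesis unfolding rtranclp_power relpowp_fun_conv using x by auto
qed

lemma K_pos_aut:
  assumes "\<phi> \<in> \<Gamma>"
  shows "(\<lambda>x y. 0 < K x y)\<^sup>*\<^sup>* x y \<Longrightarrow> (\<lambda>x y. 0 < K x y)\<^sup>*\<^sup>* (\<phi> x) (\<phi> y)"
proof (induction rule: rtranclp_induct)
  case (step y z)
  then show ?case using aut(3)[OF assms] by (metis (mono_tags, lifting) rtranclp.rtrancl_into_rtrancl)
qed simp

text \<open>Applying the powers of \<phi> to a path from \<open>\<phi> u\<close> to \<open>u\<close>
  and chaining the results leads from any point of the forward orbit back to
  \<open>u\<close>.\<close>

lemma reach_orbit:
  obtains \<phi> u where "\<phi> \<in> \<Gamma>" "infinite (range (\<lambda>n. (\<phi> ^^ n) u))" "\<And>n. (\<lambda>x y. 0 < K x y)\<^sup>*\<^sup>* ((\<phi> ^^ n) u) u"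
proof -
  let ?R = "\<lambda>x y. 0 < K x y"
  obtain \<phi> u where \<phi>: "\<phi> \<in> \<Gamma>" and inf: "infinite (range (\<lambda>n. (\<phi> ^^ n) u))" and acc: "accessible_from E K u (\<phi> u)"
    using inf_acc unfolding infinitely_accessible_def by blast
  have "?R\<^sup>*\<^sup>* ((\<phi> ^^ n) u) u" for n
  proof (induction n)
    case (Suc n)
    have "?R\<^sup>*\<^sup>* (\<phi> ((\<phi> ^^ n) u)) (\<phi> u)" using K_pos_aut[OF \<phi> Suc] .
    also have "?R\<^sup>*\<^sup>* (\<phi> u) u" by (rule accessible_imp_rtranclp[OF acc])
    finally show ?case by simp
  qed simp
  with \<phi> inf show ?thesis by (rule that)
qed

text \<open>Infinite accessibility yields an orbit point \<open>y\<close> at distance at least r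
  from \<open>u\<close>. A shortest path of positive kernel steps from \<open>y\<close> to
  \<open>u\<close> repeats no vertex, so its first r steps, moved by an automorphism to start at
  \<open>x\<close>, will do.\<close>

lemma ex_long_path:
  "\<exists>\<gamma>. \<gamma> 0 = x \<and> (\<forall>i<r. 0 < K (\<gamma> i) (\<gamma> (Suc i))) \<and> inj_on \<gamma> {..r}"
proof -
  let ?R = "\<lambda>x y. 0 < K x y"
  obtain \<phi> u where inf: "infinite (range (\<lambda>n. (\<phi> ^^ n) u))" and reach: "\<And>n. ?R\<^sup>*\<^sup>* ((\<phi> ^^ n) u) u"
    using reach_orbit by blast
  have sub: "(?R ^^ k) y u \<Longrightarrow> (E ^^ k) y u" for k y
  proof (induction k arbitrary: y)
    case (Suc k)
    then obtain z where "0 < K y z" "(?R ^^ k) z u" by (metis relpowp_Suc_E2)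
    then have "E y z" "(E ^^ k) z u" using K_edge[of y z] Suc.IH by auto
    then show ?case by (rule relpowp_Suc_I2)
  qed simp
  have "finite (\<Union>k<r. {y. (E ^^ k) u y})" using finite_relpowp[OF loc_fin] by auto
  then obtain y where y: "y \<in> range (\<lambda>n. (\<phi> ^^ n) u)" "y \<notin> (\<Union>k<r. {y. (E ^^ k) u y})"
    using inf by (meson finite_subset subsetI)
  obtain k where "(?R ^^ k) y u" using reach y(1) by (auto simp: rtranclp_power)
  define m where "m = (LEAST k. (?R ^^ k) y u)"
  have m: "(?R ^^ m) y u" unfolding m_def using \<open>(?R ^^ k) y u\<close> by (rule LeastI)
  have least: "m \<le> k" if "(?R ^^ k) y u" for k unfolding m_def using that by (rule Least_le)
  have "r \<le> m"
  proof (rule ccontr)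
    assume "\<not> r \<le> m"
    moreover have "(E ^^ m) u y" using symp_relpowp[OF symE sub[OF m]] .
    ultimately show False using y(2) by auto
  qed
  obtain f where f: "f 0 = y" "f m = u" "\<And>i. i < m \<Longrightarrow> ?R (f i) (f (Suc i))"
    using m unfolding relpowp_fun_conv by blast
  have neq: "f i \<noteq> f j" if "i < j" "j \<le> m" for i j
  proof
    assume eq: "f i = f j"
    have "(?R ^^ i) y (f i)" unfolding relpowp_fun_conv using f that by (intro exI[of _ f]) auto
    moreover have "(?R ^^ (m - j)) (f j) u"
      unfolding relpowp_fun_conv using f that by (intro exI[of _ "\<lambda>n. f (j + n)"]) auto
    ultimately have "(?R ^^ (i + (m - j))) y u" using eq by (metis relpowp_trans)
    from least[OF this] that show False by simp
  qed
  obtain \<psi> where \<psi>: "\<psi> \<in> \<Gamma>" "\<psi> y = x" using ex_transport by blast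
  have "inj_on (\<lambda>i. \<psi> (f i)) {..r}"
  proof (rule inj_onI)
    fix i j assume ij: "i \<in> {..r}" "j \<in> {..r}" and "\<psi> (f i) = \<psi> (f j)"
    then have "f i = f j" using bij_is_inj[OF aut(1)[OF \<psi>(1)]] by (simp add: inj_eq)
    then show "i = j" using neq[of i j] neq[of j i] ij \<open>r \<le> m\<close> by (metis atMost_iff le_trans linorder_neqE_nat)
  qed
  then show ?thesis
    using f \<psi> aut(3)[OF \<psi>(1)] \<open>r \<le> m\<close> by (intro exI[of _ "\<lambda>i. \<psi> (f i)"]) auto
qed

lemma ex_min_K: "\<exists>d>0. d \<le> 1 \<and> (\<forall>x y. 0 < K x y \<longrightarrow> d \<le> K x y)"
proof -
  fix o' :: 'v
  \<comment> \<open>By transitivity every positive value of K occurs among the finitely many at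
    \<open>o'\<close>; the extra 1 keeps the minimum at most 1.\<close>
  let ?S = "insert 1 (K o' ` {y \<in> neighbors E o'. 0 < K o' y})"
  have fin: "finite ?S" using loc_fin by (auto simp: locally_finite_graph_def)
  have "Min ?S > 0" using fin by (subst Min_gr_iff) auto
  moreover have "Min ?S \<le> 1" using fin by (intro Min_le) auto
  moreover have "Min ?S \<le> K x y" if "0 < K x y" for x y
  proof -
    obtain \<phi> where \<phi>: "\<phi> \<in> \<Gamma>" "\<phi> x = o'" using ex_transport by blast
    have "K x y = K o' (\<phi> y)" using aut(3)[OF \<phi>(1), of x y] \<phi> by simp
    moreover have "E o' (\<phi> y)" using that K_edge[of o' "\<phi> y"] \<open>K x y = _\<close> by auto
    ultimately show ?thesis using that fin by (intro Min_le) (auto simp: neighbors_def)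
  qed
  ultimately show ?thesis by blast
qed

definition min_step :: real where
  "min_step = (SOME d. 0 < d \<and> d \<le> 1 \<and> (\<forall>x y. 0 < K x y \<longrightarrow> d \<le> K x y))"

lemma min_step: "0 < min_step" "min_step \<le> 1" "0 < K x y \<Longrightarrow> min_step \<le> K x y"
  using someI_ex[OF ex_min_K] unfolding min_step_def by blast+

definition long_path :: "nat \<Rightarrow> 'v \<Rightarrow> nat \<Rightarrow> 'v" where
  "long_path r x = (SOME \<gamma>. \<gamma> 0 = x \<and> (\<forall>i<r. 0 < K (\<gamma> i) (\<gamma> (Suc i))) \<and> inj_on \<gamma> {..r})"

lemma long_path: "long_path r x 0 = x" "i < r \<Longrightarrow> 0 < K (long_path r x i) (long_path r x (Suc i))" "inj_on (long_path r x) {..r}"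
  using someI_ex[OF ex_long_path[of x r]] unfolding long_path_def by blast+

text \<open>The moves along the path carry different times, hence different indices, so they are
  independent.\<close>

lemma prob_follow:
  "ennreal (min_step ^ r) \<le> emeasure (move_measure K) {y. \<forall>i<r. y (c, t + i, long_path r x i) = long_path r x (Suc i)}"
proof -
  let ?\<gamma> = "long_path r x"
  let ?f = "\<lambda>i. (c, t + i, ?\<gamma> i)"
  let ?B = "\<lambda>k::'v \<times> nat \<times> 'v. {?\<gamma> (Suc (fst (snd k) - t))}"
  have inj: "inj_on ?f {..<r}" by (auto simp: inj_on_def)
  have "min_step ^ r = (\<Prod>i<r. min_step)" by simp
  also have "\<dots> \<le> (\<Prod>i<r. K (?\<gamma> i) (?\<gamma> (Suc i)))"
    using min_step(1,3) long_path(2) by (intro prod_mono) (auto simp: less_imp_le)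
  finally have "ennreal (min_step ^ r) \<le> ennreal (\<Prod>i<r. K (?\<gamma> i) (?\<gamma> (Suc i)))" by (rule ennreal_leI)
  also have "\<dots> = (\<Prod>i<r. emeasure (measure_pmf (step_pmf K (?\<gamma> i))) {?\<gamma> (Suc i)})"
    by (simp add: prod_ennreal[symmetric] K_nonneg emeasure_pmf_single pmf_step)
  also have "\<dots> = (\<Prod>k\<in>?f ` {..<r}. emeasure (measure_pmf (step_pmf K (snd (snd k)))) (?B k))"
    by (subst prod.reindex[OF inj]) simp
  also have "\<dots> = emeasure (move_measure K) {y. \<forall>k\<in>?f ` {..<r}. y k \<in> ?B k}"
    by (rule emeasure_move_box[symmetric]) simp
  also have "{y. \<forall>k\<in>?f ` {..<r}. y k \<in> ?B k} = {y. \<forall>i<r. y (c, t + i, ?\<gamma> i) = ?\<gamma> (Suc i)}"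
    by auto
  finally show ?thesis .
qed

text \<open>A walk that has visited at most \<open>r\<close> vertices by time \<open>k * r\<close> cannot have followed, in any of its
  first \<open>k\<close> blocks of \<open>r\<close> steps, the self-avoiding path chosen at the start of the block.\<close>

definition no_block :: "'v \<Rightarrow> nat \<Rightarrow> nat \<Rightarrow> ('v \<times> nat \<times> 'v \<Rightarrow> 'v) \<Rightarrow> bool" where
  "no_block c r k y \<longleftrightarrow> (\<forall>j<k. \<not> (\<forall>i\<le>r. wpos y c (j * r + i) = long_path r (wpos y c (j * r)) i))"

lemma measurable_wpos [measurable]: "(\<lambda>y. wpos y c t) \<in> measurable (move_measure K) (count_space (UNIV :: 'v set))"
proof -
  have "(\<lambda>y. (\<lambda>_. False, y, \<lambda>_. 0)) \<in> measurable (move_measure K) (parking_measure K (1/2))"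
    by (rule measurable_to_parking) simp_all
  from measurable_compose[OF this measurable_car_pos] show ?thesis by (simp add: wpos_def)
qed

lemma measurable_wpos_eq_fun: "Measurable.pred (move_measure K) (\<lambda>y. wpos y c t = g (wpos y c s))" for g :: "'v \<Rightarrow> 'v"
proof -
  have "Measurable.pred (move_measure K) (\<lambda>y. \<exists>x. wpos y c s = x \<and> wpos y c t = g x)"
    by (intro pred_all_countable countable_V) measurable
  then show ?thesis by simp
qed

lemma measurable_no_block [measurable]: "Measurable.pred (move_measure K) (no_block c r k)"
  unfolding no_block_def
  by (intro pred_intros_logic pred_intros_countable measurable_wpos_eq_fun) simp_all

lemma sets_move_Collect: "Measurable.pred (move_measure K) P \<Longrightarrow> {y. P y} \<in> sets (move_measure K)"
  by (simp add: pred_def)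

text \<open>The Markov property at time \<open>k * r\<close> in the form of resampling: the earlier
  moves fix the vertex where the next block starts, and the fresh later moves follow its path with
  probability at least \<open>min_step ^ r\<close>.\<close>

lemma prob_no_block: "emeasure (move_measure K) {y. no_block c r k y} \<le> ennreal ((1 - min_step ^ r) ^ k)"
proof (induction k)
  case 0
  interpret prob_space "move_measure K" by (rule prob_space_move)
  show ?case by (simp add: no_block_def emeasure_space_1[simplified])
next
  case (Suc k)
  interpret prob_space "move_measure K" by (rule prob_space_move)
  let ?S = "{i :: 'v \<times> nat \<times> 'v. k * r \<le> fst (snd i)}"
  let ?m = "\<lambda>x y i. if i \<in> ?S then y i else x i"
  let ?fol = "\<lambda>z y. \<forall>i<r. y (c, k * r + i, long_path r z i) = long_path r z (Suc i)"
  have q: "0 \<le> 1 - min_step ^ r" using min_step by (simp add: power_le_one)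
  have "emeasure (move_measure K) {y. no_block c r (Suc k) y} = (\<integral>\<^sup>+y. indicator {y. no_block c r (Suc k) y} y \<partial>move_measure K)"
    by (rule nn_integral_indicator[symmetric]) (rule sets_move_Collect, rule measurable_no_block)
  also have "\<dots> = (\<integral>\<^sup>+x. \<integral>\<^sup>+y. indicator {y. no_block c r (Suc k) y} (?m x y) \<partial>move_measure K \<partial>move_measure K)"
    by (rule nn_integral_merge_move[symmetric]) (rule borel_measurable_indicator, rule sets_move_Collect, rule measurable_no_block)
  also have "\<dots> \<le> (\<integral>\<^sup>+x. ennreal (1 - min_step ^ r) * indicator {y. no_block c r k y} x \<partial>move_measure K)"
  proof (rule nn_integral_mono)
    fix x
    have pos: "wpos (?m x y) c s = wpos x c s" if "s \<le> k * r" for s y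
      using that by (intro wpos_cong) auto
    have 1: "no_block c r k x" if nb: "no_block c r (Suc k) (?m x y)" for y
      unfolding no_block_def
    proof (intro allI impI notI)
      fix j assume "j < k" and *: "\<forall>i\<le>r. wpos x c (j * r + i) = long_path r (wpos x c (j * r)) i"
      have eq: "wpos (?m x y) c (j * r + i) = wpos x c (j * r + i)" if "i \<le> r" for i
      proof (rule pos)
        have "Suc j * r \<le> k * r" using \<open>j < k\<close> by (intro mult_le_mono1) simp
        then show "j * r + i \<le> k * r" using \<open>i \<le> r\<close> by simp
      qed
      have eq0: "wpos (?m x y) c (j * r) = wpos x c (j * r)" using eq[of 0] by simp
      have "\<forall>i\<le>r. wpos (?m x y) c (j * r + i) = long_path r (wpos (?m x y) c (j * r)) i"
        unfolding eq0 using * eq by simp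
      then show False using nb less_SucI[OF \<open>j < k\<close>] unfolding no_block_def by blast
    qed
    have 2: "\<not> ?fol (wpos x c (k * r)) y" if nb: "no_block c r (Suc k) (?m x y)" for y
    proof
      assume fol: "?fol (wpos x c (k * r)) y"
      have "wpos (?m x y) c (k * r + i) = long_path r (wpos x c (k * r)) i" if "i \<le> r" for i
        by (rule wpos_follow[OF _ _ that]) (use fol pos[of "k * r" y] in \<open>auto simp: long_path(1)\<close>)
      then show False using nb pos[of "k * r" y] unfolding no_block_def by auto
    qed
    let ?X = "{y. ?fol (wpos x c (k * r)) y}"
    have X: "?X \<in> sets (move_measure K)"
      by (rule sets_move_Collect) measurable
    have "emeasure (move_measure K) (UNIV - ?X) = 1 - emeasure (move_measure K) ?X"
      using emeasure_compl[OF X] emeasure_space_1 by simp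
    also have "\<dots> \<le> 1 - ennreal (min_step ^ r)"
      by (rule ennreal_minus_mono[OF order_refl prob_follow])
    also have "\<dots> = ennreal (1 - min_step ^ r)" using min_step by (simp add: ennreal_minus flip: ennreal_1)
    finally have le: "emeasure (move_measure K) (UNIV - ?X) \<le> ennreal (1 - min_step ^ r)" .
    have "(\<integral>\<^sup>+y. indicator {y. no_block c r (Suc k) y} (?m x y) \<partial>move_measure K) \<le>
      (\<integral>\<^sup>+y. indicator {y. no_block c r k y} x * indicator (UNIV - ?X) y \<partial>move_measure K)"
      using 1 2 by (intro nn_integral_mono) (auto simp: indicator_def)
    also have "\<dots> = indicator {y. no_block c r k y} x * emeasure (move_measure K) (UNIV - ?X)"
      using sets.compl_sets[OF X] by (intro nn_integral_cmult_indicator) simp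
    also have "\<dots> \<le> ennreal (1 - min_step ^ r) * indicator {y. no_block c r k y} x"
      using le by (auto simp: indicator_def)
    finally show "(\<integral>\<^sup>+y. indicator {y. no_block c r (Suc k) y} (?m x y) \<partial>move_measure K) \<le> ennreal (1 - min_step ^ r) * indicator {y. no_block c r k y} x" .
  qed
  also have "\<dots> = ennreal (1 - min_step ^ r) * emeasure (move_measure K) {y. no_block c r k y}"
    by (rule nn_integral_cmult_indicator) (rule sets_move_Collect, rule measurable_no_block)
  also have "\<dots> \<le> ennreal (1 - min_step ^ r) * ennreal ((1 - min_step ^ r) ^ k)"
    by (rule mult_left_mono[OF Suc]) simp
  also have "\<dots> = ennreal ((1 - min_step ^ r) ^ Suc k)"
    using q by (simp add: ennreal_mult)
  finally show ?case .
qed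

lemma card_range_le_imp_no_block:
  assumes "card (wpos y c ` {..k * r}) \<le> r"
  shows "no_block c r k y"
  unfolding no_block_def
proof (intro allI impI notI)
  fix j assume "j < k" and *: "\<forall>i\<le>r. wpos y c (j * r + i) = long_path r (wpos y c (j * r)) i"
  have "Suc j * r \<le> k * r" using \<open>j < k\<close> by (intro mult_le_mono1) simp
  then have "j * r + i \<in> {..k * r}" if "i \<le> r" for i using that by simp
  then have "long_path r (wpos y c (j * r)) ` {..r} \<subseteq> wpos y c ` {..k * r}"
    using * by (intro image_subsetI) (metis atMost_iff imageI)
  then have "card (long_path r (wpos y c (j * r)) ` {..r}) \<le> card (wpos y c ` {..k * r})"
    by (intro card_mono) auto
  then show False using assms card_image[OF long_path(3)[of r "wpos y c (j * r)"]] by simp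
qed

text \<open>For each r the bound \<open>(1 - min_step ^ r) ^ k\<close> tends to 0 in k, so almost
  surely some block follows a path with r + 1 distinct vertices.\<close>

lemma AE_infinite_range: "AE y in move_measure K. infinite (range (wpos y c))"
proof -
  interpret prob_space "move_measure K" by (rule prob_space_move)
  have "AE y in move_measure K. \<exists>k. \<not> no_block c r k y" for r
  proof -
    have S: "{y. \<forall>k. no_block c r k y} \<in> sets (move_measure K)"
      by (rule sets_move_Collect) measurable
    have "measure (move_measure K) {y. \<forall>k. no_block c r k y} \<le> (1 - min_step ^ r) ^ k" for k
    proof -
      have "emeasure (move_measure K) {y. \<forall>k. no_block c r k y} \<le> emeasure (move_measure K) {y. no_block c r k y}"
        by (rule emeasure_mono) (auto intro!: sets_move_Collect)
      also note prob_no_block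
      finally show ?thesis using min_step by (simp add: emeasure_eq_measure power_le_one)
    qed
    moreover have "(\<lambda>k. (1 - min_step ^ r) ^ k) \<longlonglongrightarrow> 0"
      using min_step by (intro LIMSEQ_realpow_zero) (simp_all add: power_le_one)
    ultimately have "measure (move_measure K) {y. \<forall>k. no_block c r k y} \<le> 0"
      by (intro LIMSEQ_le_const) auto
    then have "emeasure (move_measure K) {y. \<forall>k. no_block c r k y} = 0"
      using measure_nonneg[of "move_measure K" "{y. \<forall>k. no_block c r k y}"]
      unfolding emeasure_eq_measure by (metis ennreal_0 order_antisym)
    with S show ?thesis by (intro AE_I[of _ _ "{y. \<forall>k. no_block c r k y}"]) auto
  qed
  then have "AE y in move_measure K. \<forall>r. \<exists>k. \<not> no_block c r k y" by (simp add: AE_all_countable)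
  then show ?thesis
  proof eventually_elim
    case (elim y)
    show ?case
    proof
      assume fin: "finite (range (wpos y c))"
      obtain k where "\<not> no_block c (card (range (wpos y c))) k y" using elim by blast
      moreover have "card (wpos y c ` {..k * card (range (wpos y c))}) \<le> card (range (wpos y c))"
        using fin by (intro card_mono) auto
      ultimately show False using card_range_le_imp_no_block by blast
    qed
  qed
qed

end

lemma eventually_notin:
  fixes e :: "nat \<Rightarrow> 'a"
  assumes "inj e" "finite F"
  shows "eventually (\<lambda>n. e n \<notin> F) sequentially"
proof -
  have "finite (e -` F)" using assms(2,1) by (rule finite_vimageI)
  then obtain N where "\<forall>n\<in>e -` F. n < N" using finite_nat_set_iff_bounded by blast
  then have "\<forall>n\<ge>N. e n \<notin> F" by (metis leD vimageI2)
  then show ?thesis unfolding eventually_sequentially by blast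
qed

section \<open>High density\<close>

lemma evolve_snd_cong:
  assumes "snd \<omega> = snd \<omega>'"
  shows "evolve \<omega> S t = evolve \<omega>' S t"
proof -
  have "car_pos \<omega> c s = car_pos \<omega>' c s" for c s using assms by (intro car_pos_cong) simp
  then show ?thesis using assms by (cases S) (auto intro!: evolve_cong)
qed

lemma regular_snd_cong: "snd \<omega> = snd \<omega>' \<Longrightarrow> regular E \<omega> \<longleftrightarrow> regular E \<omega>'"
  by (simp add: regular_def)

text \<open>Removing a car here also turns its starting vertex into a spot; both changes point in
  the same direction of \<open>evolve_mono\<close>.\<close>

lemma unparked_mono_init:
  assumes "locally_finite_graph E" "symp E" "regular E \<omega>"
    and "snd \<omega> = snd \<omega>'" "\<And>x. init_car \<omega>' x \<Longrightarrow> init_car \<omega> x"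
  shows "unparked \<omega>' t \<subseteq> unparked \<omega> t" "free \<omega> t \<subseteq> free \<omega>' t"
  using evolve_mono[OF assms(1-3), of "{c. init_car \<omega>' c}" "{c. init_car \<omega> c}" "{x. \<not> init_car \<omega> x}" "{x. \<not> init_car \<omega>' x}" t] assms(5)
  unfolding unparked_eq_evolve free_eq_evolve evolve_snd_cong[OF assms(4)[symmetric]] by auto

text \<open>Cesaro averaging; it turns the convergence of \<open>free_prob\<close> to 0 into the
  o(t) error of the expected number of visits.\<close>

lemma sum_mean_tendsto_zero:
  fixes b :: "nat \<Rightarrow> real"
  assumes b: "b \<longlonglongrightarrow> 0"
  shows "(\<lambda>t. (\<Sum>s<t. b s) / real t) \<longlonglongrightarrow> 0"
proof (rule LIMSEQ_I)
  fix e :: real assume e: "0 < e"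
  obtain N where N: "\<And>n. n \<ge> N \<Longrightarrow> \<bar>b n\<bar> < e / 2"
    using LIMSEQ_D[OF b, of "e/2"] e by auto
  define C where "C = (\<Sum>s<N. \<bar>b s\<bar>)"
  have C: "0 \<le> C" unfolding C_def by (simp add: sum_nonneg)
  obtain M where M: "real M > 2 * C / e" using reals_Archimedean2 by blast
  have "\<bar>(\<Sum>s<t. b s) / real t\<bar> < e" if t: "t \<ge> max (Suc N) M" for t
  proof -
    have "\<bar>\<Sum>s<t. b s\<bar> \<le> (\<Sum>s<t. \<bar>b s\<bar>)" by (rule sum_abs)
    also have "\<dots> = C + (\<Sum>s\<in>{N..<t}. \<bar>b s\<bar>)"
      unfolding C_def lessThan_atLeast0 using t by (intro sum.atLeastLessThan_concat[symmetric]) auto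
    also have "(\<Sum>s\<in>{N..<t}. \<bar>b s\<bar>) \<le> (\<Sum>s\<in>{N..<t}. e / 2)"
      using N by (intro sum_mono) (auto simp: less_imp_le)
    also have "\<dots> \<le> real t * (e / 2)" using e by (simp add: mult_right_mono)
    finally have 1: "\<bar>\<Sum>s<t. b s\<bar> \<le> C + real t * (e / 2)" by simp
    have "2 * C / e < real t" using M t by linarith
    then have "C < real t * (e / 2)" using e by (simp add: field_simps)
    with 1 have "\<bar>\<Sum>s<t. b s\<bar> < real t * e" by linarith
    then show ?thesis using t e by (simp add: field_simps abs_divide)
  qed
  then show "\<exists>no. \<forall>n\<ge>no. norm ((\<Sum>s<n. b s) / real n - 0) < e" by (intro exI[of _ "max (Suc N) M"]) auto
qed

context parking_graph
begin

text \<open>The limit q of the overview, as \<open>free_prob_tendsto\<close> shows.\<close>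

definition never_filled_prob :: "real \<Rightarrow> 'v \<Rightarrow> real" where
  "never_filled_prob p v = measure (parking_measure K p) {\<omega>. \<forall>t. v \<in> free \<omega> t}"

lemma free_prob_tendsto: "free_prob p v \<longlonglongrightarrow> never_filled_prob p v"
proof -
  interpret prob_space "parking_measure K p" by (rule prob_space_parking)
  have "(\<lambda>t. measure (parking_measure K p) {\<omega>. v \<in> free \<omega> t}) \<longlonglongrightarrow> measure (parking_measure K p) (\<Inter>t. {\<omega>. v \<in> free \<omega> t})"
    by (rule finite_Lim_measure_decseq) (auto intro!: sets_parking_Collect decseq_SucI simp: free_Suc)
  moreover have "(\<Inter>t. {\<omega> :: 'v outcome. v \<in> free \<omega> t}) = {\<omega>. \<forall>t. v \<in> free \<omega> t}" by auto
  ultimately show ?thesis by (simp add: never_filled_prob_def free_prob_def[abs_def])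
qed

lemma unparked_prob_tendsto: "unparked_prob p v \<longlonglongrightarrow> measure (parking_measure K p) {\<omega>. \<forall>t. v \<in> unparked \<omega> t}"
proof -
  interpret prob_space "parking_measure K p" by (rule prob_space_parking)
  have "(\<lambda>t. measure (parking_measure K p) {\<omega>. v \<in> unparked \<omega> t}) \<longlonglongrightarrow> measure (parking_measure K p) (\<Inter>t. {\<omega>. v \<in> unparked \<omega> t})"
    by (rule finite_Lim_measure_decseq) (auto intro!: sets_parking_Collect decseq_SucI simp: unparked_Suc)
  moreover have "(\<Inter>t. {\<omega> :: 'v outcome. v \<in> unparked \<omega> t}) = {\<omega>. \<forall>t. v \<in> unparked \<omega> t}" by auto
  ultimately show ?thesis by (simp add: unparked_prob_def[abs_def])
qed

lemma never_parks_eq: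
  assumes "p \<in> {0..1}"
  shows "measure (parking_measure K p) {\<omega>. \<forall>t. v \<in> unparked \<omega> t} = 2 * p - 1 + never_filled_prob p v"
proof -
  have "unparked_prob p v = (\<lambda>t. 2 * p - 1 + free_prob p v t)" using prob_unparked_free[OF assms] by auto
  then have "unparked_prob p v \<longlonglongrightarrow> 2 * p - 1 + never_filled_prob p v" using free_prob_tendsto[of p v] by (auto intro!: tendsto_intros)
  with unparked_prob_tendsto show ?thesis using LIMSEQ_unique by blast
qed

text \<open>The automorphisms \<phi> n send \<open>v\<close> to distinct points of S. The event that
  no point of S stays free forever excludes that \<open>\<phi> n v\<close> does, yet by mixing the
  probability of both together tends to the product of the two probabilities.\<close>

lemma prob_avoid_free:
  assumes S: "infinite S" and q: "never_filled_prob p v > 0"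
  shows "emeasure (parking_measure K p) {\<omega>. \<forall>x. x \<in> S \<longrightarrow> \<not> (\<forall>t. x \<in> free \<omega> t)} = 0"
proof -
  interpret prob_space "parking_measure K p" by (rule prob_space_parking)
  obtain e :: "nat \<Rightarrow> 'v" where e: "inj e" "range e \<subseteq> S" using infinite_countable_subset[OF S] by blast
  have "\<forall>n. \<exists>\<phi>. \<phi> \<in> \<Gamma> \<and> \<phi> v = e n" using ex_transport by blast
  then obtain \<phi> where \<phi>: "\<And>n. \<phi> n \<in> \<Gamma>" "\<And>n. \<phi> n v = e n" by metis
  have esc: "eventually (\<lambda>n. \<phi> n v \<notin> F) sequentially" if "finite F" for F
    using eventually_notin[OF e(1) that] by (simp add: \<phi>)
  let ?P = "\<lambda>\<omega>. \<forall>x. x \<in> S \<longrightarrow> \<not> (\<forall>t. x \<in> free \<omega> t)"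
  let ?Q = "\<lambda>\<omega>. \<forall>t. v \<in> free \<omega> t"
  have mQ: "Measurable.pred (parking_measure K p) (\<lambda>\<omega>. \<forall>t. x \<in> free \<omega> t)" for x by measurable
  have mP: "Measurable.pred (parking_measure K p) ?P"
    by (intro pred_all_countable countable_V pred_intros_logic) (use mQ in simp_all)
  have empty: "{\<omega>. ?P \<omega> \<and> ?Q (act (\<phi> n) \<omega>)} = {}" for n
  proof -
    have "e n \<in> S" using e(2) by auto
    moreover have "free (act (\<phi> n) \<omega>) t = \<phi> n -` free \<omega> t" for \<omega> t
      using unparked_free_act[OF aut(1)[OF \<phi>(1)[of n]], of \<omega> t] by simp
    ultimately show ?thesis by (simp add: \<phi>(2)) blast
  qed
  then have "(\<lambda>n. 0) \<longlonglongrightarrow> prob {\<omega>. ?P \<omega>} * prob {\<omega>. ?Q \<omega>}"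
    using tendsto_act_inter[where \<phi>=\<phi> and o'=v, OF \<phi>(1) esc mP mQ[of v]] unfolding empty by simp
  then have "prob {\<omega>. ?P \<omega>} * never_filled_prob p v = 0" unfolding never_filled_prob_def using LIMSEQ_unique tendsto_const by blast
  with q show ?thesis by (simp add: emeasure_eq_measure)
qed

text \<open>The process without car \<open>v\<close> is common to both outcomes: deleting \<open>v\<close> only frees spots of \<open>\<omega>\<close>, and
  it changes no spot of \<open>\<omega>'\<close> because there \<open>v\<close> never parks.\<close>

lemma never_parks_avoids_free:
  assumes reg: "regular E \<omega>" "regular E \<omega>'"
    and eq: "init_car \<omega> = init_car \<omega>'" "tie_break \<omega> = tie_break \<omega>'"
      "\<And>c t x. c \<noteq> v \<Longrightarrow> next_vertex \<omega> (c, t, x) = next_vertex \<omega>' (c, t, x)"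
    and never: "\<forall>t. v \<in> unparked \<omega>' t"
  shows "\<not> (\<forall>t. car_pos \<omega>' v s \<in> free \<omega> t)"
proof -
  let ?A = "{c. init_car \<omega> c} - {v}" and ?F = "{x. \<not> init_car \<omega> x}"
  have v: "init_car \<omega>' v" using never[rule_format, of 0] by (simp add: unparked_0)
  then have A: "{c. init_car \<omega> c} = insert v ?A" using eq by auto
  have "free \<omega> s \<subseteq> snd (evolve \<omega> (?A, ?F) s)"
    unfolding free_eq_evolve using evolve_mono[OF loc_fin symE reg(1), of ?A "{c. init_car \<omega> c}" ?F ?F s] by auto
  also have "evolve \<omega> (?A, ?F) s = evolve \<omega>' (?A, ?F) s"
    using eq(2,3) by (intro evolve_cong) (auto intro: car_pos_cong)
  also have "snd (evolve \<omega>' (?A, ?F) s) = free \<omega>' s"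
    using evolve_insert[OF reg(2), of v ?A ?F s] never A
    unfolding free_eq_evolve unparked_eq_evolve eq(1)[symmetric] by (metis DiffD2 singletonI)
  finally have "free \<omega> s \<subseteq> free \<omega>' s" .
  moreover have "car_pos \<omega>' v s \<notin> free \<omega>' s"
    using unparked_pos_not_free[OF loc_fin symE reg(2), of v s s] never by auto
  ultimately show ?thesis by blast
qed

text \<open>Resample the moves of \<open>v\<close>. If \<open>v\<close> never parks in the new
  outcome, its new trajectory contains no spot that stays free forever in the old one, and it is
  independent of the old outcome. Almost every trajectory has infinite range, so
  \<open>prob_avoid_free\<close> applies with the trajectory fixed.\<close>

lemma never_parks_null:
  assumes q: "never_filled_prob p v > 0"
  shows "emeasure (parking_measure K p) {\<omega>. \<forall>t. v \<in> unparked \<omega> t} = 0"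
proof -
  let ?M = "parking_measure K p" and ?N = "move_measure K"
  let ?S = "{i :: 'v \<times> nat \<times> 'v. fst i = v}"
  interpret M: prob_space ?M by (rule prob_space_parking)
  interpret N: prob_space ?N by (rule prob_space_move)
  interpret MN: pair_sigma_finite ?M ?N ..
  let ?U = "\<lambda>\<omega>. \<forall>t. v \<in> unparked \<omega> t"
  define G where "G y \<omega> \<longleftrightarrow> (\<forall>x. x \<in> range (wpos y v) \<longrightarrow> \<not> (\<forall>t. x \<in> free \<omega> t))" for y and \<omega> :: "'v outcome"
  have U: "Measurable.pred ?M ?U" by measurable
  have reg: "AE \<omega> in ?M. regular E \<omega>" by (rule AE_regular)
  have mG: "Measurable.pred (?M \<Otimes>\<^sub>M ?N) (\<lambda>z. G (snd z) (fst z))"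
  proof -
    have "Measurable.pred (?M \<Otimes>\<^sub>M ?N) (\<lambda>z. \<forall>x. (\<exists>s. wpos (snd z) v s = x) \<longrightarrow> \<not> (\<forall>t. x \<in> free (fst z) t))"
      by (intro pred_all_countable countable_V) measurable
    moreover have "(\<exists>s. wpos y v s = x) \<longleftrightarrow> x \<in> range (wpos y v)" for x y by auto
    ultimately show ?thesis by (simp add: G_def)
  qed
  have mR: "B \<in> sets ?M \<Longrightarrow>
     (\<lambda>\<omega>. indicator {\<omega>. ?U \<omega>} \<omega> * indicator (UNIV - B) \<omega> :: ennreal) \<in> borel_measurable ?M" for B
    using sets_parking_Collect[OF U] by (intro borel_measurable_times_ennreal borel_measurable_indicator) (auto simp: sets.compl_sets[of B ?M, simplified])
  \<comment> \<open>A measurable null set that contains the irregular outcomes. Its complement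
    enters the integrand, so that the resampled outcome can be taken regular as well.\<close>
  obtain B where B': "\<And>\<omega>. \<omega> \<in> space ?M - B \<Longrightarrow> regular E \<omega>" and B2: "B \<in> null_sets ?M"
  proof (rule AE_E3[OF reg])
    fix N assume "\<And>\<omega>. \<omega> \<in> space ?M - N \<Longrightarrow> regular E \<omega>" "N \<in> null_sets ?M"
    then show thesis by (rule that)
  qed
  have B: "{\<omega> \<in> space ?M. \<not> regular E \<omega>} \<subseteq> B" "B \<in> null_sets ?M"
  proof -
    show "{\<omega> \<in> space ?M. \<not> regular E \<omega>} \<subseteq> B"
    proof
      fix \<omega> assume "\<omega> \<in> {\<omega> \<in> space ?M. \<not> regular E \<omega>}"
      then show "\<omega> \<in> B" using B'[of \<omega>] by (cases "\<omega> \<in> B") simp_all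
    qed
  qed (rule B2)
  have BM: "B \<in> sets ?M" using B by auto
  let ?C = "\<lambda>\<omega>. indicator {\<omega>. ?U \<omega>} \<omega> * indicator (UNIV - B) \<omega> :: ennreal"
  have "emeasure ?M {\<omega>. ?U \<omega>} = (\<integral>\<^sup>+\<omega>. indicator {\<omega>. ?U \<omega>} \<omega> \<partial>?M)"
    by (rule nn_integral_indicator[symmetric]) (rule sets_parking_Collect[OF U])
  also have "\<dots> = (\<integral>\<^sup>+\<omega>. ?C \<omega> \<partial>?M)"
    by (rule nn_integral_cong_AE) (use AE_not_in[OF B(2)] in eventually_elim, simp)
  also have "\<dots> = (\<integral>\<^sup>+\<omega>. \<integral>\<^sup>+y. ?C (resample_move ?S \<omega> y) \<partial>?N \<partial>?M)"
    by (rule nn_integral_resample_move[where F="?C", symmetric]) (rule mR[OF BM])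
  also have "\<dots> \<le> (\<integral>\<^sup>+\<omega>. \<integral>\<^sup>+y. of_bool (G y \<omega>) \<partial>?N \<partial>?M)"
  proof (rule nn_integral_mono_AE, use reg in eventually_elim, rule nn_integral_mono)
    fix \<omega> y assume r: "regular E \<omega>"
    let ?\<omega> = "resample_move ?S \<omega> y"
    have "G y \<omega>" if "?U ?\<omega>" "?\<omega> \<notin> B"
    proof -
      have r': "regular E ?\<omega>" using that(2) B(1) by auto
      have pos: "car_pos ?\<omega> v s = wpos y v s" for s
        unfolding car_pos_eq_wpos by (rule wpos_cong) (simp add: resample_move_def)
      have "\<not> (\<forall>t. wpos y v s \<in> free \<omega> t)" for s
        by (subst pos[symmetric], rule never_parks_avoids_free[OF r r' _ _ _ that(1)])
          (simp_all add: resample_move_def)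
      then show ?thesis unfolding G_def by blast
    qed
    then show "?C ?\<omega> \<le> of_bool (G y \<omega>)"
      by (cases "?U ?\<omega>"; cases "?\<omega> \<in> B"; simp only: indicator_def mem_Collect_eq Diff_iff UNIV_I) simp_all
  qed
  also have "\<dots> = (\<integral>\<^sup>+y. \<integral>\<^sup>+\<omega>. of_bool (G y \<omega>) \<partial>?M \<partial>?N)"
  proof (rule MN.Fubini'[symmetric])
    have "(\<lambda>z. of_bool (G (snd z) (fst z)) :: ennreal) \<in> borel_measurable (?M \<Otimes>\<^sub>M ?N)"
      using mG by measurable
    then show "(\<lambda>(x, y). of_bool (G y x) :: ennreal) \<in> borel_measurable (?M \<Otimes>\<^sub>M ?N)" by (simp add: case_prod_beta)
  qed
  also have "\<dots> = (\<integral>\<^sup>+y. 0 \<partial>?N)"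
  proof (rule nn_integral_cong_AE, use AE_infinite_range[of v] in eventually_elim)
    fix y assume inf: "infinite (range (wpos y v))"
    have "(\<integral>\<^sup>+\<omega>. of_bool (G y \<omega>) \<partial>?M) = (\<integral>\<^sup>+\<omega>. indicator {\<omega>. G y \<omega>} \<omega> \<partial>?M)"
      by (simp add: indicator_def)
    also have "\<dots> = emeasure ?M {\<omega>. G y \<omega>}"
    proof (rule nn_integral_indicator, rule sets_parking_Collect)
      show "Measurable.pred ?M (G y)" unfolding G_def
        by (intro pred_all_countable countable_V) measurable
    qed
    also have "\<dots> = 0" unfolding G_def by (rule prob_avoid_free[OF inf q])
    finally show "(\<integral>\<^sup>+\<omega>. of_bool (G y \<omega>) \<partial>?M) = 0" .
  qed
  finally show ?thesis by simp
qed

lemma never_filled_prob_eq_0: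
  assumes "p \<in> {0..1}" "1/2 \<le> p"
  shows "never_filled_prob p v = 0"
proof (rule ccontr)
  assume "never_filled_prob p v \<noteq> 0"
  moreover have "0 \<le> never_filled_prob p v" by (simp add: never_filled_prob_def)
  ultimately have "never_filled_prob p v > 0" by simp
  from never_parks_null[OF this] never_parks_eq[OF assms(1), of v] this assms(2)
  show False by (simp add: measure_def)
qed

lemma expected_visits_asymp:
  assumes "p \<in> {0..1}" "1/2 \<le> p"
  shows "(\<lambda>t. enn2real (\<integral>\<^sup>+\<omega>. visits E v t \<omega> \<partial>parking_measure K p) - (2 * p - 1) * real t) \<in> o(\<lambda>t. real t)"
proof -
  have "enn2real (\<integral>\<^sup>+\<omega>. visits E v t \<omega> \<partial>parking_measure K p) - (2 * p - 1) * real t = (\<Sum>s<t. free_prob p v s)" for t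
    unfolding nn_integral_visits
    by (subst enn2real_ennreal) (simp_all add: sum_nonneg unparked_prob_nonneg, simp add: prob_unparked_free[OF assms(1)] sum.distrib)
  moreover have "(\<lambda>t. (\<Sum>s<t. free_prob p v s) / real t) \<longlonglongrightarrow> 0"
    using free_prob_tendsto[of p v] never_filled_prob_eq_0[OF assms] by (intro sum_mean_tendsto_zero) simp
  ultimately show ?thesis
    by (intro smalloI_tendsto) (auto intro: eventually_mono[OF eventually_gt_at_top[of 0]])
qed

section \<open>Infinitely many visits at densities of at least 1/2\<close>

lemma infinite_visits_imp:
  assumes "infinite {t. visitors E \<omega> v (Suc t) \<noteq> {}}"
  shows "total_visits E v \<omega> = \<infinity>"
proof (rule ccontr)
  assume "total_visits E v \<omega> \<noteq> \<infinity>"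
  then obtain r where r: "0 \<le> r" "total_visits E v \<omega> = ennreal r" by (cases "total_visits E v \<omega>") auto
  obtain N :: nat where N: "real N > r" using reals_Archimedean2 by blast
  obtain J where J: "J \<subseteq> {t. visitors E \<omega> v (Suc t) \<noteq> {}}" "finite J" "card J = N"
    using infinite_arbitrarily_large[OF assms] by blast
  obtain t where t: "J \<subseteq> {..<t}" using J(2) by (meson finite_nat_iff_bounded)
  have "ennreal (real N) = (\<Sum>s\<in>J. 1)" using J by (simp add: ennreal_of_nat_eq_real_of_nat)
  also have "\<dots> \<le> (\<Sum>s\<in>J. emeasure (count_space UNIV) (visitors E \<omega> v (Suc s)))"
  proof (rule sum_mono)
    fix s assume "s \<in> J"
    then obtain c where "{c} \<subseteq> visitors E \<omega> v (Suc s)" using J(1) by auto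
    then have "emeasure (count_space UNIV) {c} \<le> emeasure (count_space UNIV) (visitors E \<omega> v (Suc s))"
      by (rule emeasure_mono) simp
    then show "1 \<le> emeasure (count_space UNIV) (visitors E \<omega> v (Suc s))" by simp
  qed
  also have "\<dots> \<le> visits E v t \<omega>" unfolding visits_eq using t by (intro sum_mono2) auto
  also have "\<dots> \<le> total_visits E v \<omega>" unfolding total_visits_eq by (rule SUP_upper) simp
  finally show False using N r by simp
qed

lemma measurable_total_visits [measurable]: "total_visits E v \<in> borel_measurable (parking_measure K p)"
  unfolding total_visits_eq[abs_def] by measurable

lemma measurable_visitors_empty [measurable]:
  "Measurable.pred (parking_measure K p) (\<lambda>\<omega>. visitors E \<omega> v (Suc t) = {})"
proof -
  have "Measurable.pred (parking_measure K p) (\<lambda>\<omega>. emeasure (count_space UNIV) (visitors E \<omega> v (Suc t)) = 0)"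
    by measurable
  then show ?thesis by (simp add: emeasure_count_space_eq_0)
qed

text \<open>Visits up to time \<open>T\<close> come from cars within distance \<open>T\<close>; deleting these cars has positive
  probability and creates no new visits.\<close>

lemma eventually_not_visited_null:
  assumes p: "p \<in> {0..1}" "1/2 \<le> p" "p < 1"
  shows "emeasure (parking_measure K p) {\<omega>. \<forall>t\<ge>T. visitors E \<omega> v (Suc t) = {}} = 0"
proof -
  let ?M = "parking_measure K p" and ?I = "init_measure p"
  interpret M: prob_space ?M by (rule prob_space_parking)
  define S where "S = (\<Union>k\<le>T. {x. (E ^^ k) v x})"
  have S: "finite S" "v \<in> S" unfolding S_def using finite_relpowp[OF loc_fin] by (auto intro!: bexI[of _ 0])
  let ?D = "\<lambda>\<omega>. \<forall>t\<ge>T. visitors E \<omega> v (Suc t) = {}"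
  let ?X = "{y :: 'v \<Rightarrow> bool. \<forall>x\<in>S. \<not> y x}"
  have D: "{\<omega>. ?D \<omega>} \<in> sets ?M"
    by (rule sets_parking_Collect, intro pred_intros_countable pred_intros_logic) simp_all
  have Q: "{\<omega>. \<forall>t. v \<in> free \<omega> t} \<in> sets ?M" by (rule sets_parking_Collect) measurable
  have X: "?X \<in> sets ?I"
  proof -
    have "Measurable.pred ?I (\<lambda>y. \<forall>x\<in>S. \<not> y x)" by (intro pred_intros_finite S) measurable
    then show ?thesis by (simp add: pred_def)
  qed
  have det: "v \<in> free (resample_init S \<omega> y) t" if r: "regular E \<omega>" and d: "?D \<omega>" and y: "y \<in> ?X" for \<omega> y t
  proof (induction t)
    let ?\<omega> = "resample_init S \<omega> y"
    case 0
    then show ?case using y S by (simp add: free_0 resample_init_def)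
  next
    let ?\<omega> = "resample_init S \<omega> y"
    case (Suc t)
    have sn: "snd \<omega> = snd ?\<omega>" by (simp add: resample_init_def)
    have r': "regular E ?\<omega>" using r regular_snd_cong[OF sn] by blast
    have init: "init_car ?\<omega> x \<Longrightarrow> init_car \<omega> x \<and> x \<notin> S" for x
      using y by (auto simp: resample_init_def split: if_splits)
    have "False" if c: "c \<in> parks ?\<omega> t" "car_pos ?\<omega> c (Suc t) = v" for c
    proof -
      have cu: "c \<in> unparked ?\<omega> t" by (rule parks_imp(1)[OF c(1)])
      have "c \<in> unparked ?\<omega> 0" using unparked_antimono[of 0 t ?\<omega>] cu by auto
      then have cS: "c \<notin> S" using init by (simp add: unparked_0)
      have pos: "car_pos \<omega> c s = car_pos ?\<omega> c s" for s using sn by (intro car_pos_cong) simp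
      show False
      proof (cases "Suc t \<le> T")
        case True
        \<comment> \<open>Up to time T a visitor of \<open>v\<close> must have started inside the
          emptied set S.\<close>
        have "(E ^^ Suc t) v c" using symp_relpowp[OF symE regular_car_pos[OF r', of "Suc t" c]] c(2) by simp
        with True cS show False unfolding S_def by blast
      next
        case False
        \<comment> \<open>After time T a visitor in the emptied system would by monotonicity already
          visit \<open>v\<close> in \<omega>.\<close>
        have "c \<in> unparked \<omega> t"
          using unparked_mono_init(1)[OF loc_fin symE r sn, of t] init cu by blast
        moreover have "E (car_pos \<omega> c t) (car_pos \<omega> c (Suc t))" by (rule regular_step[OF r])
        moreover have "car_pos \<omega> c (Suc t) = v" using c(2) pos[of "Suc t"] by (simp only:)
        ultimately have "c \<in> visitors E \<omega> v (Suc t)" unfolding visitors_Suc by (simp del: car_pos.simps)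
        with d False show False by simp
      qed
    qed
    then show ?case using Suc unfolding in_free_Suc_iff by blast
  qed
  \<comment> \<open>The extra factor is the probability that the fresh copy has no car in S; it is
    positive because p < 1.\<close>
  have "emeasure ?M {\<omega>. ?D \<omega>} * ennreal ((1 - p) ^ card S) = (\<integral>\<^sup>+\<omega>. indicator {\<omega>. ?D \<omega>} \<omega> \<partial>?M) * emeasure ?I ?X"
    using D emeasure_init_box(2)[OF S(1) p(1)] by simp
  also have "\<dots> = (\<integral>\<^sup>+\<omega>. indicator {\<omega>. ?D \<omega>} \<omega> * emeasure ?I ?X \<partial>?M)"
    using D by (subst nn_integral_multc) auto
  also have "\<dots> = (\<integral>\<^sup>+\<omega>. \<integral>\<^sup>+y. indicator {\<omega>. ?D \<omega>} \<omega> * indicator ?X y \<partial>?I \<partial>?M)"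
    using X by (simp add: nn_integral_cmult_indicator)
  also have "\<dots> \<le> (\<integral>\<^sup>+\<omega>. \<integral>\<^sup>+y. indicator {\<omega>. \<forall>t. v \<in> free \<omega> t} (resample_init S \<omega> y) \<partial>?I \<partial>?M)"
    by (rule nn_integral_mono_AE, use AE_regular[of p] in eventually_elim, rule nn_integral_mono)
       (use det in \<open>auto simp: indicator_def\<close>)
  also have "\<dots> = (\<integral>\<^sup>+\<omega>. indicator {\<omega>. \<forall>t. v \<in> free \<omega> t} \<omega> \<partial>?M)"
    by (rule nn_integral_resample_init) (rule borel_measurable_indicator[OF Q])
  also have "\<dots> = ennreal (never_filled_prob p v)" using Q by (simp add: never_filled_prob_def M.emeasure_eq_measure)
  also have "\<dots> = 0" by (simp add: never_filled_prob_eq_0[OF p(1,2)])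
  finally show ?thesis using p by (simp add: mult_eq_0_iff)
qed

lemma total_visits_infinite_lt_1:
  assumes p: "p \<in> {0..1}" "1/2 \<le> p" "p < 1"
  shows "AE \<omega> in parking_measure K p. total_visits E v \<omega> = \<infinity>"
proof -
  have "AE \<omega> in parking_measure K p. \<not> (\<forall>t\<ge>T. visitors E \<omega> v (Suc t) = {})" for T
  proof (rule AE_I[OF _ eventually_not_visited_null[OF p, where T=T and v=v]])
    show "{\<omega>. \<forall>t\<ge>T. visitors E \<omega> v (Suc t) = {}} \<in> sets (parking_measure K p)"
      by (rule sets_parking_Collect, intro pred_intros_countable pred_intros_logic) simp_all
  qed auto
  then have "AE \<omega> in parking_measure K p. \<forall>T. \<not> (\<forall>t\<ge>T. visitors E \<omega> v (Suc t) = {})"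
    by (simp add: AE_all_countable)
  then show ?thesis
  proof eventually_elim
    case (elim \<omega>)
    then have "infinite {t. visitors E \<omega> v (Suc t) \<noteq> {}}"
      unfolding infinite_nat_iff_unbounded_le by blast
    then show ?case by (rule infinite_visits_imp)
  qed
qed

lemma total_visits_mono_init:
  assumes "regular E \<omega>" "snd \<omega> = snd \<omega>'" "\<And>x. init_car \<omega>' x \<Longrightarrow> init_car \<omega> x"
  shows "total_visits E v \<omega>' \<le> total_visits E v \<omega>"
proof -
  have pos: "car_pos \<omega> c s = car_pos \<omega>' c s" for c s using assms(2) by (intro car_pos_cong) simp
  have "visitors E \<omega>' v (Suc t) \<subseteq> visitors E \<omega> v (Suc t)" for t
    unfolding visitors_Suc pos using unparked_mono_init(1)[OF loc_fin symE assms(1,2,3), of t] by blast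
  then show ?thesis unfolding total_visits_eq visits_eq
    by (intro SUP_mono' sum_mono emeasure_mono) auto
qed

text \<open>At p = 1 no ball is ever free of cars. Instead the full configuration is compared with
  one of density 1/2 that has the same moves and tie-breaking values: more cars give at least as
  many visits.\<close>

lemma total_visits_infinite_1:
  "AE \<omega> in parking_measure K 1. total_visits E v \<omega> = \<infinity>"
proof -
  let ?f = "\<lambda>r. (\<lambda>_ :: 'v. True, r)" and ?R = "move_measure K \<Otimes>\<^sub>M tie_measure :: (('v \<times> nat \<times> 'v \<Rightarrow> 'v) \<times> ('v \<times> nat \<Rightarrow> real)) measure"
  have f: "?f \<in> measurable ?R (parking_measure K 1)"
    by (rule measurable_to_parking) simp_all
  have S: "{r \<in> space ?R. total_visits E v (?f r) = \<infinity>} \<in> sets ?R"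
    using measurable_compose[OF f measurable_total_visits] by measurable
  have "AE \<omega> in parking_measure K (1/2). total_visits E v (?f (snd \<omega>)) = \<infinity>"
    using AE_regular[of "1/2"] total_visits_infinite_lt_1[of "1/2" v, simplified]
  proof eventually_elim
    case (elim \<omega>)
    have "regular E (?f (snd \<omega>))" using elim(1) regular_snd_cong[of "?f (snd \<omega>)" \<omega>] by simp
    from total_visits_mono_init[OF this, of \<omega> v] elim(2) show ?case by (simp add: top_unique)
  qed
  then have "AE r in ?R. total_visits E v (?f r) = \<infinity>"
    by (subst distr_parking_snd[of K "1/2", symmetric], subst AE_distr_iff[OF measurable_snd_parking S])
  then have 1: "AE \<omega> in parking_measure K 1. total_visits E v (?f (snd \<omega>)) = \<infinity>"
    by (rule AE_distrD[OF measurable_snd_parking, unfolded distr_parking_snd])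
  have "AE z in measure_pmf (bernoulli_pmf 1). z"
  proof (rule AE_pmfI)
    show z if "z \<in> set_pmf (bernoulli_pmf 1)" for z using that by (cases z) (simp_all add: set_pmf_iff)
  qed
  then have "AE y in init_measure 1. y x" for x :: 'v
    using AE_PiM_component[of UNIV "\<lambda>_. measure_pmf (bernoulli_pmf 1)" x "\<lambda>z. z"] by (simp add: prob_space_measure_pmf)
  then have "AE y in init_measure 1. \<forall>x\<in>(UNIV :: 'v set). y x"
    by (intro AE_ball_countable' countable_V)
  then have 2: "AE \<omega> in parking_measure K 1. \<forall>x\<in>(UNIV :: 'v set). init_car \<omega> x"
    by (rule AE_distrD[OF measurable_fst_parking, unfolded distr_parking_init])
  show ?thesis using 1 2
  proof eventually_elim
    case (elim \<omega>)
    have "?f (snd \<omega>) = \<omega>" using elim(2) by (auto simp: prod_eq_iff fun_eq_iff)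
    then show ?case using elim(1) by simp
  qed
qed


section \<open>Low density\<close>

lemma finite_visitors: "regular E \<omega> \<Longrightarrow> finite (visitors E \<omega> v (Suc t))"
  unfolding visitors_Suc by (rule finite_subset[OF _ finite_car_pos[OF loc_fin symE, of \<omega> "Suc t" v]]) blast+

text \<open>At each time only finitely many cars visit \<open>v\<close>, so an infinite total needs
  infinitely many visit times.\<close>

lemma total_visits_infinite_imp:
  assumes r: "regular E \<omega>" and inf: "total_visits E v \<omega> = \<infinity>"
  shows "infinite {t. visitors E \<omega> v (Suc t) \<noteq> {}}"
proof
  let ?J = "{t. visitors E \<omega> v (Suc t) \<noteq> {}}"
  let ?e = "\<lambda>s. emeasure (count_space UNIV) (visitors E \<omega> v (Suc s))"
  assume fin: "finite ?J"
  have "visits E v t \<omega> \<le> (\<Sum>s\<in>?J. ?e s)" for t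
  proof -
    have "visits E v t \<omega> = (\<Sum>s\<in>{..<t} \<inter> ?J. ?e s)"
      unfolding visits_eq by (rule sum.mono_neutral_right) auto
    also have "\<dots> \<le> (\<Sum>s\<in>?J. ?e s)" using fin by (intro sum_mono2) auto
    finally show ?thesis .
  qed
  then have "total_visits E v \<omega> \<le> (\<Sum>s\<in>?J. ?e s)" unfolding total_visits_eq by (rule SUP_least)
  also have "\<dots> = (\<Sum>s\<in>?J. of_nat (card (visitors E \<omega> v (Suc s))))"
    using finite_visitors[OF r] by (intro sum.cong) auto
  also have "\<dots> < \<infinity>" using fin by (simp add: ennreal_of_nat_eq_real_of_nat)
  finally show False using inf by simp
qed

text \<open>Presence of an unparked car at \<open>x\<close>, as opposed to a filled spot: such a car
  still moves on, which gives every successor of \<open>x\<close> a chance of being visited.\<close>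

definition occupied :: "'v \<Rightarrow> 'v outcome \<Rightarrow> nat \<Rightarrow> bool" where
  "occupied x \<omega> s \<longleftrightarrow> (\<exists>c. c \<in> unparked \<omega> s \<and> car_pos \<omega> c s = x)"

lemma measurable_occupied [measurable]: "Measurable.pred (parking_measure K p) (\<lambda>\<omega>. occupied x \<omega> s)"
  unfolding occupied_def by (intro pred_all_countable countable_V) measurable

text \<open>A visit ends either with the visitor parked at \<open>v\<close>, which happens at most
  once, or with an unparked car standing at \<open>v\<close>.\<close>

lemma infinite_visits_imp_occupied:
  assumes "infinite {t. visitors E \<omega> v (Suc t) \<noteq> {}}"
  shows "infinite {t. occupied v \<omega> t}"
proof
  let ?J = "{t. visitors E \<omega> v (Suc t) \<noteq> {}}"
  assume fin: "finite {t. occupied v \<omega> t}"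
  have "finite {t. v \<in> free \<omega> t \<and> v \<notin> free \<omega> (Suc t)}"
  proof (cases "{t. v \<in> free \<omega> t \<and> v \<notin> free \<omega> (Suc t)} = {}")
    case False
    then obtain t where t: "v \<notin> free \<omega> (Suc t)" by auto
    have "{t. v \<in> free \<omega> t \<and> v \<notin> free \<omega> (Suc t)} \<subseteq> {..t}"
    proof
      fix s assume s: "s \<in> {t. v \<in> free \<omega> t \<and> v \<notin> free \<omega> (Suc t)}"
      show "s \<in> {..t}"
      proof (rule ccontr)
        assume "s \<notin> {..t}"
        then have "free \<omega> s \<subseteq> free \<omega> (Suc t)" by (intro free_antimono) simp
        with s t show False by auto
      qed
    qed
    then show ?thesis by (rule finite_subset) simp
  qed (simp only: finite.emptyI)
  moreover have "?J \<subseteq> (\<lambda>t. t - 1) ` {t. occupied v \<omega> t} \<union> {t. v \<in> free \<omega> t \<and> v \<notin> free \<omega> (Suc t)}"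
  proof
    fix t assume "t \<in> ?J"
    then obtain c where c: "c \<in> unparked \<omega> t" "car_pos \<omega> c (Suc t) = v" unfolding visitors_Suc by blast
    show "t \<in> (\<lambda>t. t - 1) ` {t. occupied v \<omega> t} \<union> {t. v \<in> free \<omega> t \<and> v \<notin> free \<omega> (Suc t)}"
    proof (cases "c \<in> parks \<omega> t")
      case True
      then have "v \<in> free \<omega> t \<and> v \<notin> free \<omega> (Suc t)"
        using c(2) parks_imp(2)[OF True] unfolding in_free_Suc_iff by blast
      then show ?thesis by simp
    next
      case False
      then have "occupied v \<omega> (Suc t)" using c unfolding occupied_def unparked_Suc by blast
      then have "t \<in> (\<lambda>t. t - 1) ` {t. occupied v \<omega> t}" by (intro image_eqI[of _ _ "Suc t"]) auto
      then show ?thesis by simp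
    qed
  qed
  ultimately have "finite ?J" using fin by (meson finite_UnI finite_imageI finite_subset)
  with assms show False by simp
qed

text \<open>A supermartingale in \<open>k\<close> if \<open>\<alpha> * (1 - K x z) \<le> 1\<close>. It tends to infinity on the event that unparked
  cars are at \<open>x\<close> infinitely often but none of them moves on to \<open>z\<close> after time \<open>T\<close>, which is therefore null.\<close>

definition weight :: "real \<Rightarrow> 'v \<Rightarrow> 'v \<Rightarrow> nat \<Rightarrow> nat \<Rightarrow> 'v outcome \<Rightarrow> ennreal" where
  "weight \<alpha> x z T k \<omega> = (\<Prod>j<k. of_bool (visitors E \<omega> z (Suc (T + j)) = {}) * (if occupied x \<omega> (T + j) then ennreal \<alpha> else 1))"

lemma measurable_weight [measurable]: "weight \<alpha> x z T k \<in> borel_measurable (parking_measure K p)"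
  unfolding weight_def by measurable

text \<open>Moves with time index t lead from time t to time t + 1, so the state at time t does not
  see them. Conditioning on the past thus becomes resampling these moves.\<close>

lemma unparked_resample_future:
  shows "s \<le> t \<Longrightarrow> unparked (resample_move {i. fst (snd i) = t} \<omega> y) s = unparked \<omega> s"
    "r \<le> t \<Longrightarrow> car_pos (resample_move {i. fst (snd i) = t} \<omega> y) c r = car_pos \<omega> c r"
proof -
  let ?\<omega> = "resample_move {i. fst (snd i) = t} \<omega> y"
  show pos: "car_pos ?\<omega> c r = car_pos \<omega> c r" if "r \<le> t" for r c
    using that by (intro car_pos_cong) (simp add: resample_move_def)
  show "unparked ?\<omega> s = unparked \<omega> s" if "s \<le> t"
  proof -
    have "evolve ?\<omega> (A, F) s = evolve \<omega> (A, F) s" for A F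
      using that pos by (intro evolve_cong) (auto simp: resample_move_def)
    then show ?thesis by (simp add: unparked_eq_evolve resample_move_def)
  qed
qed

text \<open>Resampling the moves made at time \<open>T + k\<close> leaves the earlier factors fixed.
  If an unparked car is at \<open>x\<close>, the new factor is at most \<alpha> times the indicator
  that this car does not move to \<open>z\<close>, with mean \<alpha> (1 - K x z); otherwise it is
  at most 1.\<close>

lemma nn_integral_weight:
  assumes Kz: "0 < K x z" and \<alpha>: "1 \<le> \<alpha>" "\<alpha> * (1 - K x z) \<le> 1"
  shows "(\<integral>\<^sup>+\<omega>. weight \<alpha> x z T k \<omega> \<partial>parking_measure K p) \<le> 1"
proof (induction k)
  case 0
  interpret prob_space "parking_measure K p" by (rule prob_space_parking)
  show ?case using emeasure_space_1 by (simp add: weight_def)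
next
  case (Suc k)
  let ?M = "parking_measure K p" and ?N = "move_measure K"
  let ?S = "{i :: 'v \<times> nat \<times> 'v. fst (snd i) = T + k}"
  interpret N: prob_space ?N by (rule prob_space_move)
  have Exz: "E x z" using Kz K_edge[of x z] by auto
  have "(\<integral>\<^sup>+\<omega>. weight \<alpha> x z T (Suc k) \<omega> \<partial>?M) = (\<integral>\<^sup>+\<omega>. \<integral>\<^sup>+y. weight \<alpha> x z T (Suc k) (resample_move ?S \<omega> y) \<partial>?N \<partial>?M)"
    by (rule nn_integral_resample_move[symmetric]) (rule measurable_weight)
  also have "\<dots> \<le> (\<integral>\<^sup>+\<omega>. weight \<alpha> x z T k \<omega> \<partial>?M)"
  proof (rule nn_integral_mono)
    fix \<omega> :: "'v outcome"
    let ?\<omega> = "\<lambda>y. resample_move ?S \<omega> y"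
    note un = unparked_resample_future[where t="T + k" and \<omega>=\<omega>]
    have vis: "visitors E (?\<omega> y) z (Suc (T + j)) = visitors E \<omega> z (Suc (T + j))" if "j < k" for y j
    proof -
      have "car_pos (?\<omega> y) c r = car_pos \<omega> c r" if "r \<le> Suc (T + j)" for c r
        using that \<open>j < k\<close> by (intro un(2)[of r]) simp_all
      moreover have "unparked (?\<omega> y) (T + j) = unparked \<omega> (T + j)" using \<open>j < k\<close> by (intro un(1)) simp
      ultimately show ?thesis unfolding visitors_Suc by (simp del: car_pos.simps)
    qed
    have occ: "occupied x (?\<omega> y) (T + j) = occupied x \<omega> (T + j)" if "j \<le> k" for y j
      unfolding occupied_def using that by (simp add: un)
    have step: "weight \<alpha> x z T (Suc k) (?\<omega> y) = weight \<alpha> x z T k \<omega> *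
       (of_bool (visitors E (?\<omega> y) z (Suc (T + k)) = {}) * (if occupied x \<omega> (T + k) then ennreal \<alpha> else 1))" for y
      unfolding weight_def by (simp add: vis occ)
    show "(\<integral>\<^sup>+y. weight \<alpha> x z T (Suc k) (?\<omega> y) \<partial>?N) \<le> weight \<alpha> x z T k \<omega>"
    proof (cases "occupied x \<omega> (T + k)")
      case False
      then have "(\<integral>\<^sup>+y. weight \<alpha> x z T (Suc k) (?\<omega> y) \<partial>?N) \<le> (\<integral>\<^sup>+y. weight \<alpha> x z T k \<omega> \<partial>?N)"
        unfolding step by (intro nn_integral_mono) (simp add: mult_left_le)
      then show ?thesis by (simp add: N.emeasure_space_1[simplified])
    next
      case True
      then obtain c where c: "c \<in> unparked \<omega> (T + k)" "car_pos \<omega> c (T + k) = x" unfolding occupied_def by blast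
      let ?X = "{y :: 'v \<times> nat \<times> 'v \<Rightarrow> 'v. \<forall>i\<in>{(c, T + k, x)}. y i \<in> - {z}}"
      have X: "?X \<in> sets ?N"
      proof (rule sets_move_Collect)
        have "Measurable.pred ?N (\<lambda>y. \<not> y (c, T + k, x) = z)" by measurable
        then show "Measurable.pred ?N (\<lambda>y. \<forall>i\<in>{(c, T + k, x)}. y i \<in> - {z})" by simp
      qed
      have em: "emeasure ?N ?X = ennreal (1 - K x z)"
      proof -
        have "emeasure ?N ?X = emeasure (measure_pmf (step_pmf K x)) (- {z})"
          by (subst emeasure_move_box) simp_all
        also have "\<dots> = ennreal (1 - pmf (step_pmf K x) z)"
          using measure_pmf.prob_compl[of "{z}" "step_pmf K x"]
          by (simp add: measure_pmf.emeasure_eq_measure Compl_eq_Diff_UNIV pmf.rep_eq)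
        finally show ?thesis by (simp add: pmf_step)
      qed
      have "weight \<alpha> x z T (Suc k) (?\<omega> y) \<le> (weight \<alpha> x z T k \<omega> * ennreal \<alpha>) * indicator ?X y" for y
      proof (cases "y \<in> ?X")
        case True
        then show ?thesis unfolding step using \<open>occupied x \<omega> (T + k)\<close> by (auto simp: mult.assoc intro!: mult_left_mono)
      next
        case False
        then have y: "y (c, T + k, x) = z" by simp
        have 1: "car_pos (?\<omega> y) c (T + k) = x" "c \<in> unparked (?\<omega> y) (T + k)" using c un by auto
        then have "car_pos (?\<omega> y) c (Suc (T + k)) = z" using y by (simp add: resample_move_def)
        then have "c \<in> visitors E (?\<omega> y) z (Suc (T + k))" unfolding visitors_Suc using 1 Exz by (simp del: car_pos.simps)
        then have "visitors E (?\<omega> y) z (Suc (T + k)) \<noteq> {}" by blast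
        then show ?thesis unfolding step by simp
      qed
      then have "(\<integral>\<^sup>+y. weight \<alpha> x z T (Suc k) (?\<omega> y) \<partial>?N) \<le> (\<integral>\<^sup>+y. (weight \<alpha> x z T k \<omega> * ennreal \<alpha>) * indicator ?X y \<partial>?N)"
        by (intro nn_integral_mono)
      also have "\<dots> = weight \<alpha> x z T k \<omega> * (ennreal \<alpha> * ennreal (1 - K x z))"
        unfolding nn_integral_cmult_indicator[OF X] em by (simp only: mult.assoc)
      also have "\<dots> \<le> weight \<alpha> x z T k \<omega> * 1"
        using \<alpha> K_le_1 by (intro mult_left_mono) (simp_all flip: ennreal_mult)
      finally show ?thesis by simp
    qed
  qed
  also have "\<dots> \<le> 1" by (rule Suc)
  finally show ?case .
qed

text \<open>Without late visits to \<open>z\<close> all indicator factors are 1, which leaves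
  \<alpha> to the power of the number of occupied times.\<close>

lemma weight_unbounded:
  assumes \<alpha>: "1 < \<alpha>" and inf: "infinite {t. occupied x \<omega> t}" and none: "\<forall>t\<ge>T. visitors E \<omega> z (Suc t) = {}"
  shows "(SUP k. weight \<alpha> x z T k \<omega>) = \<infinity>"
proof -
  have w: "weight \<alpha> x z T k \<omega> = ennreal (\<alpha> ^ card {j. j < k \<and> occupied x \<omega> (T + j)})" for k
  proof -
    have "weight \<alpha> x z T k \<omega> = (\<Prod>j<k. if occupied x \<omega> (T + j) then ennreal \<alpha> else 1)"
      unfolding weight_def using none by (intro prod.cong) simp_all
    also have "\<dots> = (\<Prod>j\<in>{j \<in> {..<k}. occupied x \<omega> (T + j)}. ennreal \<alpha>)"
      by (rule prod.inter_filter[symmetric]) simp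
    finally show ?thesis using \<alpha> by (simp add: ennreal_power)
  qed
  have inf': "infinite {j. occupied x \<omega> (T + j)}"
  proof
    assume "finite {j. occupied x \<omega> (T + j)}"
    moreover have "{t. occupied x \<omega> t} \<subseteq> {..<T} \<union> (\<lambda>j. T + j) ` {j. occupied x \<omega> (T + j)}"
    proof
      fix t assume "t \<in> {t. occupied x \<omega> t}"
      then show "t \<in> {..<T} \<union> (\<lambda>j. T + j) ` {j. occupied x \<omega> (T + j)}"
        by (cases "t < T") (auto intro!: image_eqI[of _ _ "t - T"])
    qed
    ultimately show False using inf by (meson finite_UnI finite_imageI finite_lessThan finite_subset)
  qed
  have ge: "ennreal r \<le> (SUP k. weight \<alpha> x z T k \<omega>)" for r
  proof -
    obtain N where N: "r < \<alpha> ^ N" using real_arch_pow[OF \<alpha>] by blast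
    obtain J where J: "J \<subseteq> {j. occupied x \<omega> (T + j)}" "finite J" "card J = N"
      using infinite_arbitrarily_large[OF inf'] by blast
    obtain k where k: "J \<subseteq> {..<k}" using J(2) by (meson finite_nat_iff_bounded)
    have "N \<le> card {j. j < k \<and> occupied x \<omega> (T + j)}" unfolding J(3)[symmetric] using J k by (intro card_mono) auto
    then have "\<alpha> ^ N \<le> \<alpha> ^ card {j. j < k \<and> occupied x \<omega> (T + j)}" using \<alpha> by (intro power_increasing) auto
    then have "ennreal r \<le> weight \<alpha> x z T k \<omega>" unfolding w using N by (intro ennreal_leI) simp
    also have "\<dots> \<le> (SUP k. weight \<alpha> x z T k \<omega>)" by (rule SUP_upper) simp
    finally show ?thesis .
  qed
  show ?thesis
  proof (rule ccontr)
    assume "(SUP k. weight \<alpha> x z T k \<omega>) \<noteq> \<infinity>"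
    then obtain r where "0 \<le> r" "(SUP k. weight \<alpha> x z T k \<omega>) = ennreal r" by (cases "SUP k. weight \<alpha> x z T k \<omega>") auto
    with ge[of "r + 1"] show False by simp
  qed
qed

lemma AE_total_visits_step:
  assumes Kz: "0 < K x z"
  shows "AE \<omega> in parking_measure K p. total_visits E x \<omega> = \<infinity> \<longrightarrow> total_visits E z \<omega> = \<infinity>"
proof -
  let ?M = "parking_measure K p"
  \<comment> \<open>What is needed is \<alpha> > 1 with \<alpha> (1 - K x z) \<le> 1; halving K x z
    keeps the denominator positive even when K x z = 1.\<close>
  define \<alpha> where "\<alpha> = 1 / (1 - K x z / 2)"
  have \<alpha>: "1 < \<alpha>" "\<alpha> * (1 - K x z) \<le> 1" using Kz K_le_1[of x z] by (auto simp: \<alpha>_def field_simps)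
  have "AE \<omega> in ?M. \<not> (infinite {t. occupied x \<omega> t} \<and> (\<forall>t\<ge>T. visitors E \<omega> z (Suc t) = {}))" for T
  proof -
    have D: "Measurable.pred ?M (\<lambda>\<omega>. \<forall>t\<ge>T. visitors E \<omega> z (Suc t) = {})"
      by (intro pred_intros_countable pred_intros_logic) simp_all
    \<comment> \<open>On the event without late visits every factor of \<open>weight\<close> is at
      least 1. Multiplying by its indicator makes the sequence increasing, as monotone convergence
      requires.\<close>
    let ?w = "\<lambda>k \<omega>. weight \<alpha> x z T k \<omega> * indicator {\<omega>. \<forall>t\<ge>T. visitors E \<omega> z (Suc t) = {}} \<omega>"
    have mw [measurable]: "?w k \<in> borel_measurable ?M" for k
      by (intro borel_measurable_times_ennreal measurable_weight borel_measurable_indicator sets_parking_Collect D)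
    have "incseq ?w"
    proof (intro incseq_SucI le_funI)
      fix k \<omega>
      show "?w k \<omega> \<le> ?w (Suc k) \<omega>"
      proof (cases "\<forall>t\<ge>T. visitors E \<omega> z (Suc t) = {}")
        case True
        have "weight \<alpha> x z T k \<omega> * 1 \<le> weight \<alpha> x z T (Suc k) \<omega>"
          using True \<alpha>(1) ennreal_leI[of 1 \<alpha>] unfolding weight_def prod.lessThan_Suc by (intro mult_left_mono) simp_all
        then show ?thesis using True by (simp add: indicator_def)
      next
        case False
        then show ?thesis by (simp only: indicator_def mem_Collect_eq if_False of_bool_eq mult_zero_right order_refl)
      qed
    qed
    then have "(\<integral>\<^sup>+\<omega>. (SUP k. ?w k \<omega>) \<partial>?M) = (SUP k. \<integral>\<^sup>+\<omega>. ?w k \<omega> \<partial>?M)"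
      by (intro nn_integral_monotone_convergence_SUP mw)
    also have "\<dots> \<le> 1"
    proof (rule SUP_least)
      fix k
      have "(\<integral>\<^sup>+\<omega>. ?w k \<omega> \<partial>?M) \<le> (\<integral>\<^sup>+\<omega>. weight \<alpha> x z T k \<omega> \<partial>?M)"
        by (intro nn_integral_mono) (simp add: indicator_def)
      also have "\<dots> \<le> 1" using \<alpha> Kz by (intro nn_integral_weight) auto
      finally show "(\<integral>\<^sup>+\<omega>. ?w k \<omega> \<partial>?M) \<le> 1" .
    qed
    finally have "(\<integral>\<^sup>+\<omega>. (SUP k. ?w k \<omega>) \<partial>?M) \<noteq> \<infinity>" by (auto simp: top_unique)
    then have "AE \<omega> in ?M. (SUP k. ?w k \<omega>) \<noteq> \<infinity>"
      by (intro nn_integral_PInf_AE) measurable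
    then show ?thesis
    proof eventually_elim
      case (elim \<omega>)
      show ?case
      proof
        assume *: "infinite {t. occupied x \<omega> t} \<and> (\<forall>t\<ge>T. visitors E \<omega> z (Suc t) = {})"
        then have "(SUP k. ?w k \<omega>) = (SUP k. weight \<alpha> x z T k \<omega>)" by (simp add: indicator_def)
        with weight_unbounded[OF \<alpha>(1), of x \<omega> T z] * elim show False by simp
      qed
    qed
  qed
  then have "AE \<omega> in ?M. \<forall>T. \<not> (infinite {t. occupied x \<omega> t} \<and> (\<forall>t\<ge>T. visitors E \<omega> z (Suc t) = {}))"
    by (subst AE_all_countable) (rule allI)
  then show ?thesis using AE_regular[of p]
  proof eventually_elim
    case (elim \<omega>)
    show ?case
    proof
      assume "total_visits E x \<omega> = \<infinity>"
      then have "infinite {t. occupied x \<omega> t}"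
        using infinite_visits_imp_occupied[OF total_visits_infinite_imp[OF elim(2)]] by blast
      then have "infinite {t. visitors E \<omega> z (Suc t) \<noteq> {}}"
        using elim(1) unfolding infinite_nat_iff_unbounded_le by blast
      then show "total_visits E z \<omega> = \<infinity>" by (rule infinite_visits_imp)
    qed
  qed
qed

lemma AE_total_visits_reachable:
  assumes "(\<lambda>x y. 0 < K x y)\<^sup>*\<^sup>* x z"
  shows "AE \<omega> in parking_measure K p. total_visits E x \<omega> = \<infinity> \<longrightarrow> total_visits E z \<omega> = \<infinity>"
  using assms
proof (induction rule: rtranclp_induct)
  case (step y z)
  show ?case using step.IH AE_total_visits_step[OF step.hyps(2), of p] by eventually_elim blast
qed simp

section \<open>Zero-one law for infinitely many visits\<close>

lemma total_visits_act:
  assumes "\<phi> \<in> \<Gamma>"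
  shows "total_visits E v (act \<phi> \<omega>) = total_visits E (\<phi> v) \<omega>"
proof -
  have b: "bij \<phi>" by (rule aut(1)[OF assms])
  have "emeasure (count_space UNIV) (visitors E \<omega> (\<phi> v) (Suc t)) = emeasure (count_space UNIV) (visitors E (act \<phi> \<omega>) v (Suc t))" for t
  proof -
    have iff: "\<phi> c \<in> visitors E \<omega> (\<phi> v) (Suc t) \<longleftrightarrow> c \<in> visitors E (act \<phi> \<omega>) v (Suc t)" for c
      unfolding visitors_Suc using unparked_free_act[OF b, of \<omega> t] car_pos_act'[OF assms, of \<omega> c "Suc t" v]
        car_pos_act[OF b, of \<omega> c t] aut(2)[OF assms, of "car_pos (act \<phi> \<omega>) c t" v]
      by (simp del: car_pos.simps)
    have "visitors E \<omega> (\<phi> v) (Suc t) = \<phi> ` visitors E (act \<phi> \<omega>) v (Suc t)"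
    proof (intro equalityI subsetI)
      fix c assume c: "c \<in> visitors E \<omega> (\<phi> v) (Suc t)"
      obtain d where "c = \<phi> d" using b by (metis bij_pointE)
      with c iff show "c \<in> \<phi> ` visitors E (act \<phi> \<omega>) v (Suc t)" by blast
    qed (use iff in blast)
    moreover have "emeasure (count_space UNIV) (\<phi> ` X) = emeasure (count_space UNIV) X" for X
    proof -
      have i: "inj_on \<phi> X" using bij_is_inj[OF b] by (rule inj_on_subset) simp
      then show ?thesis by (simp add: emeasure_count_space finite_image_iff card_image)
    qed
    ultimately show ?thesis by simp
  qed
  then show ?thesis by (simp add: total_visits_eq visits_eq)
qed

lemma total_visits_finite:
  assumes p: "p \<in> {0..1}" "p < 1/2"
  shows "AE \<omega> in parking_measure K p. total_visits E v \<omega> < \<infinity>"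
proof -
  let ?M = "parking_measure K p"
  interpret prob_space ?M by (rule prob_space_parking)
  define A where "A w = {\<omega>. total_visits E w \<omega> = \<infinity>}" for w
  have mA: "Measurable.pred ?M (\<lambda>\<omega>. total_visits E w \<omega> = \<infinity>)" for w by measurable
  have A: "A w \<in> sets ?M" for w unfolding A_def by (rule sets_parking_Collect[OF mA])
  have act: "prob (A (\<phi> w)) = prob (A w)" if "\<phi> \<in> \<Gamma>" for \<phi> w
    using emeasure_act[OF that mA, of w] by (simp add: total_visits_act[OF that] A_def measure_def)
  obtain \<phi> u where \<phi>: "\<phi> \<in> \<Gamma>" and inf: "infinite (range (\<lambda>n. (\<phi> ^^ n) u))"
    and reach: "\<And>n. (\<lambda>x y. 0 < K x y)\<^sup>*\<^sup>* ((\<phi> ^^ n) u) u"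
    using reach_orbit by blast
  obtain e :: "nat \<Rightarrow> 'v" where e: "inj e" "range e \<subseteq> range (\<lambda>n. (\<phi> ^^ n) u)" using infinite_countable_subset[OF inf] by blast
  have "\<forall>n. \<exists>m. (\<phi> ^^ m) u = e n" using e(2) by (metis (no_types, lifting) imageE range_subsetD)
  then obtain m where m: "\<And>n. (\<phi> ^^ m n) u = e n" by metis
  have esc: "eventually (\<lambda>n. (\<phi> ^^ m n) u \<notin> F) sequentially" if "finite F" for F
    using eventually_notin[OF e(1) that] by (simp add: m)
  \<comment> \<open>As \<open>u\<close> is reachable from the orbit point, infinitely many visits
    there imply infinitely many at \<open>u\<close>. Up to a null set the intersection is therefore
    the event at the orbit point, which by invariance has the probability of
    \<open>A u\<close>.\<close>
  have "prob {\<omega>. total_visits E u \<omega> = \<infinity> \<and> total_visits E u (act (\<phi> ^^ m n) \<omega>) = \<infinity>} = prob (A u)" for n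
  proof -
    have "prob {\<omega>. total_visits E u \<omega> = \<infinity> \<and> total_visits E u (act (\<phi> ^^ m n) \<omega>) = \<infinity>} = prob (A ((\<phi> ^^ m n) u))"
    proof (rule finite_measure_eq_AE)
      show "{\<omega>. total_visits E u \<omega> = \<infinity> \<and> total_visits E u (act (\<phi> ^^ m n) \<omega>) = \<infinity>} \<in> sets ?M"
        by (rule sets_parking_Collect) (simp add: total_visits_act[OF \<Gamma>_funpow[OF \<phi>]])
      show "AE \<omega> in ?M. \<omega> \<in> {\<omega>. total_visits E u \<omega> = \<infinity> \<and> total_visits E u (act (\<phi> ^^ m n) \<omega>) = \<infinity>} \<longleftrightarrow> \<omega> \<in> A ((\<phi> ^^ m n) u)"
        using AE_total_visits_reachable[OF reach[of "m n"], of p]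
        by eventually_elim (auto simp: total_visits_act[OF \<Gamma>_funpow[OF \<phi>]] A_def)
    qed (rule A)
    then show ?thesis using act[OF \<Gamma>_funpow[OF \<phi>]] by simp
  qed
  then have "(\<lambda>n. prob (A u)) \<longlonglongrightarrow> prob (A u) * prob (A u)"
    using tendsto_act_inter[where \<phi>="\<lambda>n. \<phi> ^^ m n" and o'=u, OF \<Gamma>_funpow[OF \<phi>] esc mA[of u] mA[of u]]
    by (simp add: A_def)
  then have sq: "prob (A u) = prob (A u) * prob (A u)" using LIMSEQ_unique tendsto_const by blast
  \<comment> \<open>Unparked probabilities are nonnegative, so the balance
    \<open>prob_unparked_free\<close> keeps the free ones at least 1 - 2p.\<close>
  have "1 - 2 * p \<le> free_prob p u t" for t using prob_unparked_free[OF p(1), of u t] unparked_prob_nonneg[of p u t] by simp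
  then have "1 - 2 * p \<le> never_filled_prob p u" using free_prob_tendsto[of p u] by (intro LIMSEQ_le_const) auto
  moreover have "prob (A u) \<le> prob (UNIV - {\<omega>. \<forall>t. u \<in> free \<omega> t})"
  proof (rule finite_measure_mono_AE)
    show "UNIV - {\<omega>. \<forall>t. u \<in> free \<omega> t} \<in> sets ?M"
      using sets.compl_sets[OF sets_parking_Collect, of "\<lambda>\<omega>. \<forall>t. u \<in> free \<omega> t"] by simp
    show "AE \<omega> in ?M. \<omega> \<in> A u \<longrightarrow> \<omega> \<in> UNIV - {\<omega>. \<forall>t. u \<in> free \<omega> t}"
      using AE_regular[of p]
    proof eventually_elim
      case (elim \<omega>)
      have "visitors E \<omega> u (Suc t) = {}" if "\<forall>t. u \<in> free \<omega> t" for t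
        using free_not_visited[OF loc_fin symE elim] that unfolding visitors_Suc by blast
      then have "total_visits E u \<omega> = 0" if "\<forall>t. u \<in> free \<omega> t"
        using that unfolding total_visits_eq visits_eq by simp
      then show ?case by (cases "\<forall>t. u \<in> free \<omega> t") (simp_all add: A_def)
    qed
  qed
  moreover have "prob (UNIV - {\<omega>. \<forall>t. u \<in> free \<omega> t}) = 1 - never_filled_prob p u"
    unfolding never_filled_prob_def using prob_compl[OF sets_parking_Collect, of "\<lambda>\<omega>. \<forall>t. u \<in> free \<omega> t"] by simp
  ultimately have "prob (A u) < 1" using p by simp
  with sq have "prob (A u) = 0" by (metis mult_cancel_left2 less_irrefl mult_cancel_right1)
  moreover obtain \<psi> where \<psi>: "\<psi> \<in> \<Gamma>" "\<psi> u = v" using ex_transport by blast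
  ultimately have "prob (A v) = 0" using act[OF \<psi>(1), of u] by simp
  then have "AE \<omega> in ?M. \<omega> \<notin> A v"
    using A by (intro AE_I[of _ _ "A v"]) (auto simp: emeasure_eq_measure)
  then show ?thesis by eventually_elim (simp add: A_def less_top)
qed

end

section \<open>Very low density\<close>

primrec walks :: "('v \<Rightarrow> 'v \<Rightarrow> bool) \<Rightarrow> nat \<Rightarrow> 'v \<Rightarrow> 'v list set" where
  "walks E 0 v = {[v]}"
| "walks E (Suc n) v = (#) v ` (\<Union>u\<in>neighbors E v. walks E n u)"

lemma walks_hd: "w \<in> walks E n v \<Longrightarrow> \<exists>w'. w = v # w'"
  by (cases n) auto

lemma walks_Cons: "u \<in> neighbors E v \<Longrightarrow> w \<in> walks E n u \<Longrightarrow> v # w \<in> walks E (Suc n) v"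
  by auto

lemma finite_walks: "locally_finite_graph E \<Longrightarrow> finite (walks E n v)"
  by (induction n arbitrary: v) (auto simp: locally_finite_graph_def)

lemma card_walks:
  assumes "locally_finite_graph E" "\<And>v. card (neighbors E v) \<le> \<Delta>"
  shows "card (walks E n v) \<le> \<Delta> ^ n"
proof (induction n arbitrary: v)
  case (Suc n)
  have "card (walks E (Suc n) v) = card (\<Union>u\<in>neighbors E v. walks E n u)"
    by (simp add: card_image)
  also have "\<dots> \<le> (\<Sum>u\<in>neighbors E v. card (walks E n u))"
    using assms(1) by (intro card_UN_le) (simp add: locally_finite_graph_def)
  also have "\<dots> \<le> (\<Sum>u\<in>neighbors E v. \<Delta> ^ n)" by (intro sum_mono Suc)
  also have "\<dots> \<le> \<Delta> * \<Delta> ^ n" using assms(2) by simp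
  finally show ?case by simp
qed simp

text \<open>Insert the excursion from \<open>x\<close> to \<open>y\<close> and back, at the cost of
  two steps.\<close>

lemma walks_detour:
  assumes "symp E" "w \<in> walks E n v" "x \<in> set w" "E x y"
  shows "\<exists>w'\<in>walks E (Suc (Suc n)) v. set w' = insert y (set w)"
  using assms(2,3)
proof (induction n arbitrary: v w)
  case 0
  then have "w = [v]" "x = v" by auto
  moreover have "[v, y, v] \<in> walks E (Suc (Suc 0)) v"
  proof -
    have "v \<in> neighbors E y" "y \<in> neighbors E v"
      using assms(1,4) \<open>x = v\<close> by (auto simp: neighbors_def dest: sympD)
    then show ?thesis by (simp add: image_iff)
  qed
  ultimately show ?case by (intro bexI[of _ "[v, y, v]"]) auto
next
  case (Suc n)
  show ?case
  proof (cases "x = v")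
    case True
    have vy: "v \<in> neighbors E y" "y \<in> neighbors E v"
      using assms(1,4) True by (auto simp: neighbors_def dest: sympD)
    have "v # y # w \<in> walks E (Suc (Suc (Suc n))) v"
      by (rule walks_Cons[OF vy(2) walks_Cons[OF vy(1) Suc.prems(1)]])
    moreover have "v \<in> set w" using walks_hd[OF Suc.prems(1)] by auto
    ultimately show ?thesis by (intro bexI[of _ "v # y # w"]) auto
  next
    case False
    obtain u w1 where u: "u \<in> neighbors E v" "w1 \<in> walks E n u" "w = v # w1" using Suc.prems(1) by auto
    have "x \<in> set w1" using Suc.prems(2) False u(3) by simp
    from Suc.IH[OF u(2) this] obtain w' where w': "w' \<in> walks E (Suc (Suc n)) u" "set w' = insert y (set w1)" by blast
    have "v # w' \<in> walks E (Suc (Suc (Suc n))) v"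
      by (rule walks_Cons[OF u(1) w'(1)])
    then show ?thesis using w'(2) u(3) by (intro bexI[of _ "v # w'"]) auto
  qed
qed

definition reach_in :: "('v \<Rightarrow> 'v \<Rightarrow> bool) \<Rightarrow> 'v set \<Rightarrow> 'v \<Rightarrow> 'v \<Rightarrow> bool" where
  "reach_in E C = (\<lambda>a b. E a b \<and> a \<in> C \<and> b \<in> C)\<^sup>*\<^sup>*"

lemma reach_in_mono: "reach_in E C x y \<Longrightarrow> C \<subseteq> C' \<Longrightarrow> reach_in E C' x y"
  unfolding reach_in_def by (erule rtranclp_mono[THEN predicate2D, rotated]) auto

lemma reach_in_sym:
  assumes "symp E" shows "reach_in E C x y \<Longrightarrow> reach_in E C y x"
  unfolding reach_in_def
proof (induction rule: rtranclp_induct)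
  case (step y z)
  have "E z y" using step(2) assms by (auto dest: sympD)
  with step show ?case
    by (intro converse_rtranclp_into_rtranclp[of "\<lambda>a b. E a b \<and> a \<in> C \<and> b \<in> C" z y x]) simp_all
qed simp

lemma reach_in_trans: "reach_in E C x y \<Longrightarrow> reach_in E C y z \<Longrightarrow> reach_in E C x z"
  unfolding reach_in_def by (rule rtranclp_trans)

lemma reach_in_edge: "E x y \<Longrightarrow> x \<in> C \<Longrightarrow> y \<in> C \<Longrightarrow> reach_in E C x y"
  unfolding reach_in_def by auto

lemma reach_in_exit:
  assumes "reach_in E C v y" "v \<in> W" "y \<notin> W"
  shows "\<exists>a b. a \<in> W \<and> b \<notin> W \<and> b \<in> C \<and> E a b"
  using assms unfolding reach_in_def
proof (induction rule: rtranclp_induct)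
  case (step y z)
  then show ?case by blast
qed simp

text \<open>While vertices of C are missing, some edge leads from the covered set to a missing one;
  a detour along it adds one vertex and two steps.\<close>

lemma ex_covering_walk:
  assumes E: "symp E" and C: "finite C" "v \<in> C" "\<And>y. y \<in> C \<Longrightarrow> reach_in E C v y"
  shows "m < card C \<Longrightarrow> \<exists>w\<in>walks E (2 * m) v. set w \<subseteq> C \<and> card (set w) = Suc m"
proof (induction m)
  case 0
  then show ?case using C(2) by simp
next
  case (Suc m)
  then obtain w where w: "w \<in> walks E (2 * m) v" "set w \<subseteq> C" "card (set w) = Suc m" by auto
  have "set w \<noteq> C" using w(3) Suc.prems by auto
  then obtain y where "y \<in> C" "y \<notin> set w" using w(2) by blast
  moreover have "v \<in> set w" using walks_hd[OF w(1)] by auto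
  ultimately obtain a b where ab: "a \<in> set w" "b \<notin> set w" "b \<in> C" "E a b"
    using reach_in_exit[OF C(3)] by blast
  obtain w' where "w' \<in> walks E (Suc (Suc (2 * m))) v" "set w' = insert b (set w)"
    using walks_detour[OF E w(1) ab(1,4)] by blast
  then show ?case using w ab by (intro bexI[of _ w']) auto
qed

section \<open>Clusters of an unparked car\<close>

definition fills :: "'v outcome \<Rightarrow> 'v \<Rightarrow> 'v \<Rightarrow> bool" where
  "fills \<omega> d x \<longleftrightarrow> (\<exists>s. d \<in> parks \<omega> s \<and> car_pos \<omega> d (Suc s) = x)"

lemma fills_functional:
  assumes "fills \<omega> d x" "fills \<omega> d x'"
  shows "x = x'"
proof -
  obtain s s' where s: "d \<in> parks \<omega> s" "car_pos \<omega> d (Suc s) = x" "d \<in> parks \<omega> s'" "car_pos \<omega> d (Suc s') = x'"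
    using assms unfolding fills_def by blast
  have False if "r < r'" "d \<in> parks \<omega> r" "d \<in> parks \<omega> r'" for r r'
  proof -
    have "d \<in> unparked \<omega> (Suc r)" using unparked_antimono[of "Suc r" r' \<omega>] that(1) parks_imp(1)[OF that(3)] by auto
    then show False using that(2) by (simp add: unparked_Suc)
  qed
  then have "s = s'" using s by (metis linorder_neqE_nat)
  then show ?thesis using s by simp
qed

text \<open>A finite connected set that contains, with each of its spots, the starting vertex of the
  car that fills it. This closure is what forces many initial cars.\<close>

definition cluster :: "('v \<Rightarrow> 'v \<Rightarrow> bool) \<Rightarrow> 'v outcome \<Rightarrow> 'v \<Rightarrow> 'v set \<Rightarrow> bool" where
  "cluster E \<omega> c C \<longleftrightarrow> finite C \<and> c \<in> C \<and> (\<forall>y\<in>C. reach_in E C c y) \<and>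
     (\<forall>x\<in>C. \<not> init_car \<omega> x \<longrightarrow> (\<exists>d\<in>C. init_car \<omega> d \<and> fills \<omega> d x))"

text \<open>Sending a spot to the car that fills it is injective, since a car fills only one
  spot.\<close>

lemma card_cluster:
  assumes "cluster E \<omega> c C"
  shows "card C \<le> 2 * card {x \<in> C. init_car \<omega> x}"
proof -
  have fin: "finite C" using assms by (simp add: cluster_def)
  have "\<forall>x\<in>{x \<in> C. \<not> init_car \<omega> x}. \<exists>d. d \<in> C \<and> init_car \<omega> d \<and> fills \<omega> d x"
    using assms unfolding cluster_def by blast
  then obtain f where f: "\<And>x. x \<in> C \<Longrightarrow> \<not> init_car \<omega> x \<Longrightarrow> f x \<in> C \<and> init_car \<omega> (f x) \<and> fills \<omega> (f x) x"
    by (metis (mono_tags, lifting) mem_Collect_eq)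
  have "inj_on f {x \<in> C. \<not> init_car \<omega> x}"
  proof (rule inj_onI)
    fix x y assume "x \<in> {x \<in> C. \<not> init_car \<omega> x}" "y \<in> {x \<in> C. \<not> init_car \<omega> x}" and "f x = f y"
    then have "fills \<omega> (f x) x" "fills \<omega> (f x) y" using f by fastforce+
    then show "x = y" by (rule fills_functional)
  qed
  moreover have "f ` {x \<in> C. \<not> init_car \<omega> x} \<subseteq> {x \<in> C. init_car \<omega> x}" using f by auto
  ultimately have "card {x \<in> C. \<not> init_car \<omega> x} \<le> card {x \<in> C. init_car \<omega> x}"
    using fin by (intro card_inj_on_le) auto
  moreover have "card C = card {x \<in> C. init_car \<omega> x} + card {x \<in> C. \<not> init_car \<omega> x}"
    using fin by (subst card_Un_disjoint[symmetric]) (auto intro!: arg_cong[where f=card])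
  ultimately show ?thesis by simp
qed

text \<open>The spots on the trajectory were filled earlier, by cars that have clusters by induction.\<close>

lemma ex_cluster:
  assumes E: "locally_finite_graph E" "symp E" "regular E \<omega>"
  shows "c \<in> unparked \<omega> t \<Longrightarrow> \<exists>C. cluster E \<omega> c C \<and> car_pos \<omega> c ` {..t} \<subseteq> C"
proof (induction t arbitrary: c rule: less_induct)
  case (less t)
  let ?x = "car_pos \<omega> c"
  \<comment> \<open>The times at which the trajectory is at an initial spot. Each such spot was
    filled by time t, by a car that was unparked just before, so the induction hypothesis applies to
    that car.\<close>
  define I where "I = {i. i \<le> t \<and> \<not> init_car \<omega> (?x i)}"
  have "\<exists>d s C. s < t \<and> d \<in> parks \<omega> s \<and> car_pos \<omega> d (Suc s) = ?x i \<and> cluster E \<omega> d C \<and> car_pos \<omega> d ` {..s} \<subseteq> C" if "i \<in> I" for i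
  proof -
    have i: "i \<le> t" "\<not> init_car \<omega> (?x i)" using that by (auto simp: I_def)
    have nf: "?x i \<notin> free \<omega> t" by (rule unparked_pos_not_free[OF E less.prems i(1)])
    have "\<exists>s<t. ?x i \<in> free \<omega> s \<and> ?x i \<notin> free \<omega> (Suc s)"
    proof (rule ccontr)
      assume n: "\<not> ?thesis"
      have "s \<le> t \<Longrightarrow> ?x i \<in> free \<omega> s" for s
        by (induction s) (use i n in \<open>auto simp: free_0 simp del: car_pos.simps\<close>)
      with nf show False by blast
    qed
    then obtain s where s: "s < t" "?x i \<in> free \<omega> s" "?x i \<notin> free \<omega> (Suc s)" by blast
    then obtain d where d: "d \<in> parks \<omega> s" "car_pos \<omega> d (Suc s) = ?x i" unfolding in_free_Suc_iff by blast
    from less.IH[OF s(1) parks_imp(1)[OF d(1)]] show ?thesis using s(1) d by blast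
  qed
  then obtain d s C where dsC: "\<And>i. i \<in> I \<Longrightarrow> s i < t \<and> d i \<in> parks \<omega> (s i) \<and> car_pos \<omega> (d i) (Suc (s i)) = ?x i \<and>
      cluster E \<omega> (d i) (C i) \<and> car_pos \<omega> (d i) ` {..s i} \<subseteq> C i"
    by metis
  define D where "D = ?x ` {..t} \<union> (\<Union>i\<in>I. C i)"
  have finI: "finite I" unfolding I_def by simp
  have finC: "finite (C i)" "d i \<in> C i" "\<And>y. y \<in> C i \<Longrightarrow> reach_in E (C i) (d i) y"
      "\<And>x. x \<in> C i \<Longrightarrow> \<not> init_car \<omega> x \<Longrightarrow> \<exists>e\<in>C i. init_car \<omega> e \<and> fills \<omega> e x" if "i \<in> I" for i
    using dsC[OF that] unfolding cluster_def by blast+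
  have CD: "C i \<subseteq> D" if "i \<in> I" for i using that by (auto simp: D_def)
  have xD: "?x i \<in> D" if "i \<le> t" for i using that by (auto simp: D_def)
  have reach_x: "i \<le> t \<Longrightarrow> reach_in E D c (?x i)" for i
  proof (induction i)
    case 0
    then show ?case by (simp add: reach_in_def)
  next
    case (Suc i)
    have "reach_in E D (?x i) (?x (Suc i))"
      using regular_step[OF E(3), of c i] xD[of i] xD[of "Suc i"] Suc.prems by (intro reach_in_edge) simp_all
    then show ?case using Suc by (meson Suc_leD reach_in_trans)
  qed
  have "reach_in E D c y" if "y \<in> D" for y
  proof (cases "y \<in> ?x ` {..t}")
    case True
    then show ?thesis using reach_x by auto
  next
    case False
    with that obtain i where i: "i \<in> I" "y \<in> C i" by (auto simp: D_def)
    note di = dsC[OF i(1)]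
    have it: "i \<le> t" using i(1) by (simp add: I_def)
    \<comment> \<open>The last position of the filling car before it parks links its cluster to the
      trajectory: it lies in the cluster and is adjacent to the filled spot.\<close>
    let ?p = "car_pos \<omega> (d i) (s i)"
    have pC: "?p \<in> C i" using di by auto
    have "E ?p (?x i)" using regular_step[OF E(3), of "d i" "s i"] di by simp
    then have "reach_in E D (?x i) ?p"
      using CD[OF i(1)] pC xD[OF it] E(2) by (intro reach_in_edge) (auto dest: sympD)
    moreover have "reach_in E D ?p (d i)"
      by (rule reach_in_mono[OF reach_in_sym[OF E(2) finC(3)[OF i(1) pC]] CD[OF i(1)]])
    moreover have "reach_in E D (d i) y"
      by (rule reach_in_mono[OF finC(3)[OF i] CD[OF i(1)]])
    ultimately show ?thesis using reach_x[OF it] by (meson reach_in_trans)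
  qed
  moreover have "\<exists>e\<in>D. init_car \<omega> e \<and> fills \<omega> e x" if x: "x \<in> D" "\<not> init_car \<omega> x" for x
  proof (cases "x \<in> ?x ` {..t}")
    case True
    then obtain i where i: "i \<in> I" "x = ?x i" using x(2) by (auto simp: I_def)
    note di = dsC[OF i(1)]
    have "fills \<omega> (d i) x" unfolding fills_def using di i(2) by blast
    moreover have "init_car \<omega> (d i)"
      using unparked_antimono[of 0 "s i" \<omega>] parks_imp(1)[of "d i" \<omega> "s i"] di by (auto simp: unparked_0)
    ultimately show ?thesis using CD[OF i(1)] finC(2)[OF i(1)] by blast
  next
    case False
    with x(1) obtain i where i: "i \<in> I" "x \<in> C i" by (auto simp: D_def)
    from finC(4)[OF i x(2)] show ?thesis using CD[OF i(1)] by blast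
  qed
  moreover have "finite D" unfolding D_def using finI finC(1) by auto
  moreover have "c \<in> D" using xD[of 0] by simp
  ultimately have "cluster E \<omega> c D" unfolding cluster_def by blast
  then show ?case by (auto simp: D_def)
qed

context parking_graph
begin

section \<open>Union bound over clusters and the expected number of visits\<close>

definition deg :: nat where "deg = card (neighbors E (SOME x. True))"

lemma card_neighbors: "card (neighbors E v) = deg"
proof -
  let ?o = "SOME x :: 'v. True"
  obtain \<phi> where \<phi>: "\<phi> \<in> \<Gamma>" "\<phi> ?o = v" using ex_transport by blast
  have "neighbors E v = \<phi> ` neighbors E ?o"
  proof (intro equalityI subsetI)
    fix y assume "y \<in> neighbors E v"
    moreover obtain z where "y = \<phi> z" using aut(1)[OF \<phi>(1)] by (metis bij_pointE)
    ultimately show "y \<in> \<phi> ` neighbors E ?o" using aut(2)[OF \<phi>(1), of ?o z] \<phi>(2) by (auto simp: neighbors_def)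
  next
    fix y assume "y \<in> \<phi> ` neighbors E ?o"
    then show "y \<in> neighbors E v" using aut(2)[OF \<phi>(1), of ?o] \<phi>(2) by (auto simp: neighbors_def)
  qed
  then show ?thesis unfolding deg_def
    using inj_on_subset[OF bij_is_inj[OF aut(1)[OF \<phi>(1)]]] by (simp add: card_image)
qed

lemma deg_pos: "0 < deg"
proof -
  fix v :: 'v
  have "(\<Sum>y\<in>neighbors E v. K v y) = 1" using kernel by (simp add: markov_kernel_def)
  then have "neighbors E v \<noteq> {}" by auto
  then show ?thesis using loc_fin card_neighbors[of v] by (metis card_gt_0_iff locally_finite_graph_def)
qed

text \<open>A connected set of \<open>Suc n\<close> vertices is covered by a walk of \<open>2 * n\<close> steps, which bounds the number
  of such sets by \<open>deg ^ (2 * n)\<close>.\<close>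

definition crowded :: "'v \<Rightarrow> nat \<Rightarrow> ('v \<Rightarrow> bool) \<Rightarrow> bool" where
  "crowded v r y \<longleftrightarrow> (\<exists>k. \<exists>w\<in>walks E (2 * (r + k)) v. \<exists>B\<in>{B \<in> Pow (set w). Suc (r + k) = card (set w) \<and> Suc (r + k) \<le> 2 * card B}. \<forall>x\<in>B. y x)"

text \<open>The cluster contains the trajectory, hence at least r + 1 vertices; its covering walk
  has exactly the cluster as vertex set, and \<open>card_cluster\<close> supplies the cars.\<close>

lemma unparked_imp_crowded:
  assumes r: "regular E \<omega>" and v: "v \<in> unparked \<omega> s" and R: "card (car_pos \<omega> v ` {..s}) = Suc r"
  shows "crowded v r (init_car \<omega>)"
proof -
  obtain C where C: "cluster E \<omega> v C" "car_pos \<omega> v ` {..s} \<subseteq> C"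
    using ex_cluster[OF loc_fin symE r v] by blast
  have fin: "finite C" using C(1) by (simp add: cluster_def)
  have "Suc r \<le> card C" unfolding R[symmetric] using fin C(2) by (rule card_mono)
  then obtain k where k: "card C = Suc (r + k)" by (metis add_Suc nat_le_iff_add)
  obtain w where w: "w \<in> walks E (2 * (r + k)) v" "set w \<subseteq> C" "card (set w) = Suc (r + k)"
    using ex_covering_walk[OF symE fin, of v "r + k"] C(1) k unfolding cluster_def by auto
  have "set w = C" using w(2,3) fin k by (intro card_subset_eq) auto
  then show ?thesis unfolding crowded_def using w card_cluster[OF C(1)] k
    by (intro exI[of _ k] bexI[OF _ w(1)] bexI[of _ "{x \<in> C. init_car \<omega> x}"]) auto
qed

lemma sets_init_box: "{y. \<forall>x\<in>B. y x} \<in> sets (init_measure p)" if "finite B" for B :: "'v set"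
proof -
  have "Measurable.pred (init_measure p) (\<lambda>y. \<forall>x\<in>B. y x)" using that by (intro pred_intros_finite) measurable
  then show ?thesis by (simp add: pred_def)
qed

lemma crowded_eq:
  "{y. crowded v r y} = (\<Union>k. \<Union>w\<in>walks E (2 * (r + k)) v. \<Union>B\<in>{B \<in> Pow (set w). Suc (r + k) = card (set w) \<and> Suc (r + k) \<le> 2 * card B}. {y. \<forall>x\<in>B. y x})"
  unfolding crowded_def by blast

lemma sets_crowded: "{y. crowded v r y} \<in> sets (init_measure p)"
proof -
  have "(\<Union>w\<in>walks E (2 * (r + k)) v. \<Union>B\<in>{B \<in> Pow (set w). Suc (r + k) = card (set w) \<and> Suc (r + k) \<le> 2 * card B}. {y. \<forall>x\<in>B. y x})
    \<in> sets (init_measure p)" for k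
    by (intro sets.finite_UN finite_walks loc_fin sets_init_box) (auto intro: finite_subset)
  then show ?thesis unfolding crowded_eq by (intro sets.countable_UN) auto
qed

text \<open>A union bound. For n = r + k + 1 vertices there are at most \<open>deg ^ (2 * n)\<close>
  walks and \<open>2 ^ n\<close> subsets B, and B consists of cars with probability at most
  \<open>sqrt p ^ n\<close>; together this is \<open>x ^ n\<close>. As x \<le> 1/2, the sum over k
  costs a factor 2.\<close>

lemma prob_crowded:
  assumes p: "p \<in> {0..1}" and x: "x = 2 * real deg ^ 2 * sqrt p" "x \<le> 1/2"
  shows "emeasure (init_measure p) {y. crowded v r y} \<le> ennreal (2 * x ^ Suc r)"
proof -
  let ?I = "init_measure p"
  let ?W = "\<lambda>k. walks E (2 * (r + k)) v"
  let ?B = "\<lambda>k w. {B \<in> Pow (set w). Suc (r + k) = card (set w) \<and> Suc (r + k) \<le> 2 * card B}"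
  let ?X = "\<lambda>B. {y :: 'v \<Rightarrow> bool. \<forall>x\<in>B. y x}"
  have x0: "0 \<le> x" using p x by simp
  have deg1: "1 \<le> real deg" using deg_pos by simp
  have box: "emeasure ?I (?X B) \<le> ennreal (sqrt p ^ Suc (r + k))" if "B \<in> ?B k w" for B k w
  proof -
    have "finite B" using that by (auto intro: finite_subset)
    then have "emeasure ?I (?X B) = ennreal (p ^ card B)" by (rule emeasure_init_box(1)[OF _ p])
    also have "p ^ card B = sqrt p ^ (2 * card B)" using p by (simp add: power_mult)
    also have "\<dots> \<le> sqrt p ^ Suc (r + k)" using that p by (intro power_decreasing) auto
    finally show ?thesis by (simp add: ennreal_leI)
  qed
  have finB: "finite (?B k w)" for k w by simp
  have cardB: "card (?B k w) \<le> 2 ^ Suc (r + k)" for k w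
  proof (cases "Suc (r + k) = card (set w)")
    case True
    have "card (?B k w) \<le> card (Pow (set w))" by (intro card_mono) auto
    then show ?thesis using True by (simp add: card_Pow)
  next
    case False
    then have "?B k w = {}" by simp
    then show ?thesis by (simp only: card.empty)
  qed
  have setsB: "?X B \<in> sets ?I" if "B \<in> ?B k w" for B k w
    using that by (intro sets_init_box) (auto intro: finite_subset)
  have setsU: "(\<Union>B\<in>?B k w. ?X B) \<in> sets ?I" for k w
    by (intro sets.finite_UN finB setsB)
  have inner: "emeasure ?I (\<Union>B\<in>?B k w. ?X B) \<le> ennreal ((2 * sqrt p) ^ Suc (r + k))" for k w
  proof -
    have "emeasure ?I (\<Union>B\<in>?B k w. ?X B) \<le> (\<Sum>B\<in>?B k w. emeasure ?I (?X B))"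
      using finB setsB by (intro emeasure_subadditive_finite) auto
    also have "\<dots> \<le> (\<Sum>B\<in>?B k w. ennreal (sqrt p ^ Suc (r + k)))" by (intro sum_mono box)
    also have "\<dots> = of_nat (card (?B k w)) * ennreal (sqrt p ^ Suc (r + k))" by (rule sum_constant)
    also have "\<dots> \<le> of_nat (2 ^ Suc (r + k)) * ennreal (sqrt p ^ Suc (r + k))"
      by (intro mult_right_mono of_nat_mono cardB) simp
    also have "\<dots> = ennreal (real (2 ^ Suc (r + k)) * sqrt p ^ Suc (r + k))"
      unfolding ennreal_of_nat_eq_real_of_nat using p by (intro ennreal_mult[symmetric]) simp_all
    also have "real (2 ^ Suc (r + k)) * sqrt p ^ Suc (r + k) = (2 * sqrt p) ^ Suc (r + k)"
      by (simp add: power_mult_distrib)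
    finally show ?thesis .
  qed
  have step: "emeasure ?I (\<Union>w\<in>?W k. \<Union>B\<in>?B k w. ?X B) \<le> ennreal (x ^ (Suc r + k))" for k
  proof -
    have "emeasure ?I (\<Union>w\<in>?W k. \<Union>B\<in>?B k w. ?X B) \<le> (\<Sum>w\<in>?W k. emeasure ?I (\<Union>B\<in>?B k w. ?X B))"
      by (intro emeasure_subadditive_finite image_subsetI setsU finite_walks loc_fin)
    also have "\<dots> \<le> (\<Sum>w\<in>?W k. ennreal ((2 * sqrt p) ^ Suc (r + k)))" by (intro sum_mono inner)
    also have "\<dots> = ennreal (real (card (?W k)) * (2 * sqrt p) ^ Suc (r + k))"
      using p by (simp add: ennreal_mult ennreal_of_nat_eq_real_of_nat)
    also have "\<dots> \<le> ennreal (x ^ (Suc r + k))"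
    proof (rule ennreal_leI)
      have "card (?W k) \<le> deg ^ (2 * (r + k))" using card_neighbors by (intro card_walks[OF loc_fin]) simp
      then have "real (card (?W k)) \<le> real deg ^ (2 * (r + k))" by (metis of_nat_le_iff of_nat_power)
      \<comment> \<open>Two steps too many, so that all three counts become powers with exponent
        \<open>Suc (r + k)\<close>.\<close>
      also have "\<dots> \<le> real deg ^ (2 * Suc (r + k))" using deg1 by (intro power_increasing) auto
      also have "\<dots> = (real deg ^ 2) ^ Suc (r + k)" by (rule power_mult)
      finally have "real (card (?W k)) * (2 * sqrt p) ^ Suc (r + k) \<le> (real deg ^ 2) ^ Suc (r + k) * (2 * sqrt p) ^ Suc (r + k)"
        using p by (intro mult_right_mono) auto
      also have "\<dots> = x ^ (Suc r + k)" unfolding x(1) power_mult_distrib[symmetric] by (simp add: mult_ac)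
      finally show "real (card (?W k)) * (2 * sqrt p) ^ Suc (r + k) \<le> x ^ (Suc r + k)" .
    qed
    finally show ?thesis .
  qed
  have sums: "(\<lambda>k. x ^ (Suc r + k)) sums (x ^ Suc r * (1 / (1 - x)))"
    unfolding power_add using x x0 by (intro sums_mult geometric_sums) simp
  have "emeasure ?I {y. crowded v r y} \<le> (\<Sum>k. emeasure ?I (\<Union>w\<in>?W k. \<Union>B\<in>?B k w. ?X B))"
    unfolding crowded_eq
    by (intro emeasure_subadditive_countably image_subsetI sets.finite_UN finite_walks loc_fin setsU)
  also have "\<dots> \<le> (\<Sum>k. ennreal (x ^ (Suc r + k)))" by (intro suminf_le step) simp_all
  also have "\<dots> = ennreal (x ^ Suc r * (1 / (1 - x)))"
    using x0 sums by (intro suminf_ennreal_eq) simp_all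
  also have "\<dots> \<le> ennreal (2 * x ^ Suc r)"
  proof (rule ennreal_leI)
    have "1 / (1 - x) \<le> 2" using x by (simp add: field_simps)
    then have "x ^ Suc r * (1 / (1 - x)) \<le> x ^ Suc r * 2" using x0 by (intro mult_left_mono) auto
    then show "x ^ Suc r * (1 / (1 - x)) \<le> 2 * x ^ Suc r" by (simp add: mult.commute)
  qed
  finally show ?thesis .
qed

text \<open>Split by the number r + 1 of vertices visited up to time s. Crowding depends on the
  initial configuration only and slowness of the walk on the moves only, so the joint event is a
  rectangle and its probability a product.\<close>

lemma prob_unparked_le:
  assumes p: "p \<in> {0..1}" and x: "x = 2 * real deg ^ 2 * sqrt p" "x \<le> 1/2"
  shows "unparked_prob p v s \<le> (\<Sum>r\<le>s. 2 * x ^ Suc r * (1 - min_step ^ Suc r) ^ (s div Suc r))"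
proof -
  let ?M = "parking_measure K p" and ?I = "init_measure p" and ?N = "move_measure K"
  interpret M: prob_space ?M by (rule prob_space_parking)
  interpret N: prob_space ?N by (rule prob_space_move)
  interpret T: prob_space "tie_measure :: ('v \<times> nat \<Rightarrow> real) measure" by (rule prob_space_tie)
  interpret R: prob_space "?N \<Otimes>\<^sub>M (tie_measure :: ('v \<times> nat \<Rightarrow> real) measure)" by (rule prob_space_move_tie)
  have x0: "0 \<le> x" using p x by simp
  have q: "0 \<le> 1 - min_step ^ r" for r using min_step by (simp add: power_le_one)
  let ?C = "\<lambda>r. {y. crowded v r y}" and ?B = "\<lambda>r. {y. no_block v (Suc r) (s div Suc r) y}"
  let ?Z = "\<lambda>r. ?C r \<times> (?B r \<times> (UNIV :: ('v \<times> nat \<Rightarrow> real) set))"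
  have C: "?C r \<in> sets ?I" and B: "?B r \<in> sets ?N" for r
    by (rule sets_crowded) (rule sets_move_Collect, rule measurable_no_block)
  have U: "UNIV \<in> sets (tie_measure :: ('v \<times> nat \<Rightarrow> real) measure)"
    using sets.top[of "tie_measure :: ('v \<times> nat \<Rightarrow> real) measure"] by simp
  have Z: "?Z r \<in> sets ?M" for r
    unfolding parking_measure_def using C B U by (intro pair_measureI)
  have emZ: "emeasure ?M (?Z r) \<le> ennreal (2 * x ^ Suc r * (1 - min_step ^ Suc r) ^ (s div Suc r))" for r
  proof -
    have "emeasure ?M (?Z r) = emeasure ?I (?C r) * emeasure (?N \<Otimes>\<^sub>M tie_measure) (?B r \<times> (UNIV :: ('v \<times> nat \<Rightarrow> real) set))"
      unfolding parking_measure_def using C B U by (intro R.emeasure_pair_measure_Times pair_measureI)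
    also have "emeasure (?N \<Otimes>\<^sub>M tie_measure) (?B r \<times> (UNIV :: ('v \<times> nat \<Rightarrow> real) set)) = emeasure ?N (?B r) * 1"
      using B U T.emeasure_space_1 by (subst T.emeasure_pair_measure_Times) simp_all
    also have "emeasure ?I (?C r) * (emeasure ?N (?B r) * 1) \<le> ennreal (2 * x ^ Suc r) * ennreal ((1 - min_step ^ Suc r) ^ (s div Suc r))"
      unfolding mult_1_right by (rule mult_mono[OF prob_crowded[OF p x] prob_no_block]) simp_all
    also have "\<dots> = ennreal (2 * x ^ Suc r * (1 - min_step ^ Suc r) ^ (s div Suc r))"
      using x0 q[of "Suc r"] by (intro ennreal_mult[symmetric] zero_le_power mult_nonneg_nonneg) (simp_all del: power_Suc)
    finally show ?thesis .
  qed
  have "emeasure ?M {\<omega>. v \<in> unparked \<omega> s} \<le> emeasure ?M (\<Union>r\<in>{..s}. ?Z r)"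
  proof (rule emeasure_mono_AE)
    show "AE \<omega> in ?M. \<omega> \<in> {\<omega>. v \<in> unparked \<omega> s} \<longrightarrow> \<omega> \<in> (\<Union>r\<in>{..s}. ?Z r)"
      using AE_regular[of p]
    proof eventually_elim
      case (elim \<omega>)
      show ?case
      proof
        assume "\<omega> \<in> {\<omega>. v \<in> unparked \<omega> s}"
        then have un: "v \<in> unparked \<omega> s" by simp
        let ?R = "car_pos \<omega> v ` {..s}"
        have "card ?R > 0" by (simp add: card_gt_0_iff)
        then obtain r where r: "card ?R = Suc r" using gr0_implies_Suc by blast
        have "card ?R \<le> card {..s}" by (rule card_image_le) simp
        then have rs: "r \<le> s" using r by simp
        have "s div Suc r * Suc r \<le> s" by (rule div_times_less_eq_dividend)
        then have "wpos (next_vertex \<omega>) v ` {..s div Suc r * Suc r} \<subseteq> ?R"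
          unfolding car_pos_eq_wpos by (intro image_mono) auto
        then have "card (wpos (next_vertex \<omega>) v ` {..s div Suc r * Suc r}) \<le> Suc r"
          unfolding r[symmetric] by (intro card_mono) auto
        then have "no_block v (Suc r) (s div Suc r) (next_vertex \<omega>)" by (rule card_range_le_imp_no_block)
        moreover have "crowded v r (init_car \<omega>)" by (rule unparked_imp_crowded[OF elim un r])
        ultimately have "\<omega> \<in> ?Z r" by (cases \<omega>) auto
        with rs show "\<omega> \<in> (\<Union>r\<in>{..s}. ?Z r)" by blast
      qed
    qed
    show "(\<Union>r\<in>{..s}. ?Z r) \<in> sets ?M" using Z by (intro sets.finite_UN) auto
  qed
  also have "\<dots> \<le> (\<Sum>r\<le>s. emeasure ?M (?Z r))" using Z by (intro emeasure_subadditive_finite) auto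
  also have "\<dots> \<le> (\<Sum>r\<le>s. ennreal (2 * x ^ Suc r * (1 - min_step ^ Suc r) ^ (s div Suc r)))" by (intro sum_mono emZ)
  also have "\<dots> = ennreal (\<Sum>r\<le>s. 2 * x ^ Suc r * (1 - min_step ^ Suc r) ^ (s div Suc r))"
    using x0 q by (intro sum_ennreal mult_nonneg_nonneg zero_le_power) (auto simp del: power_Suc)
  finally show ?thesis
    unfolding unparked_prob_def M.emeasure_eq_measure using x0 q
    by (subst (asm) ennreal_le_iff) (auto intro!: sum_nonneg mult_nonneg_nonneg zero_le_power simp del: power_Suc)
qed

text \<open>Each quotient is taken by r consecutive times, which reduces the sum to a geometric
  series.\<close>

lemma sum_div_power_le:
  fixes \<theta> :: real
  assumes \<theta>: "0 \<le> \<theta>" "\<theta> < 1" and r: "0 < r"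
  shows "(\<Sum>s<t. \<theta> ^ (s div r)) \<le> real r / (1 - \<theta>)"
proof -
  have "(\<Sum>s<t. \<theta> ^ (s div r)) \<le> (\<Sum>s<t * r. \<theta> ^ (s div r))"
    using \<theta> r by (intro sum_mono2) (auto intro: less_le_trans)
  also have "\<dots> = (\<Sum>j<t. \<Sum>s=j * r..<j * r + r. \<theta> ^ (s div r))"
    by (rule sum.nat_group[symmetric])
  also have "\<dots> = (\<Sum>j<t. \<Sum>s=j * r..<j * r + r. \<theta> ^ j)"
  proof (intro sum.cong refl)
    fix j s assume "s \<in> {j * r..<j * r + r}"
    then have "s div r = j" by (intro div_nat_eqI) (auto simp: mult.commute)
    then show "\<theta> ^ (s div r) = \<theta> ^ j" by simp
  qed
  also have "\<dots> = real r * (\<Sum>j<t. \<theta> ^ j)" by (simp add: sum_distrib_left)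
  also have "(\<Sum>j<t. \<theta> ^ j) = (1 - \<theta> ^ t) / (1 - \<theta>)" using \<theta> by (simp add: sum_gp_strict)
  also have "real r * ((1 - \<theta> ^ t) / (1 - \<theta>)) \<le> real r * (1 / (1 - \<theta>))"
    using \<theta> by (intro mult_left_mono divide_right_mono) auto
  finally show ?thesis by simp
qed

text \<open>The threshold is chosen to give \<open>x \<le> min_step / 4\<close>. Summed over time,
  slowness with r + 1 visited vertices contributes at most \<open>Suc r / min_step ^ Suc r\<close>,
  so apart from a factor 2 the product with the crowding bound is at most
  \<open>Suc r / 4 ^ Suc r\<close>, hence at most \<open>(1 / 2) ^ Suc r\<close>.\<close>

lemma expected_total_visits_finite:
  assumes p: "p \<in> {0..1}" "p < (min_step / (8 * real deg ^ 2)) ^ 2"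
  shows "(\<integral>\<^sup>+\<omega>. total_visits E v \<omega> \<partial>parking_measure K p) < \<infinity>"
proof -
  define x where "x = 2 * real deg ^ 2 * sqrt p"
  have deg1: "1 \<le> real deg" using deg_pos by simp
  have x0: "0 \<le> x" using p by (simp add: x_def)
  have "sqrt p < min_step / (8 * real deg ^ 2)" using p min_step by (intro real_less_lsqrt) auto
  then have x4: "x \<le> min_step / 4" using deg1 by (simp add: x_def field_simps)
  then have x2: "x \<le> 1 / 2" using min_step(2) by simp
  have bound: "(\<Sum>s<t. unparked_prob p v s) \<le> 4" for t
  proof -
    have "(\<Sum>s<t. unparked_prob p v s) \<le> (\<Sum>s<t. \<Sum>r\<le>s. 2 * x ^ Suc r * (1 - min_step ^ Suc r) ^ (s div Suc r))"
      using prob_unparked_le[OF p(1) x_def x2] by (intro sum_mono)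
    \<comment> \<open>Enlarging the range of r makes it independent of s, so that the two sums can
      be exchanged.\<close>
    also have "\<dots> \<le> (\<Sum>s<t. \<Sum>r<t. 2 * x ^ Suc r * (1 - min_step ^ Suc r) ^ (s div Suc r))"
      using x0 min_step(1,2) power_le_one[of min_step]
      by (intro sum_mono sum_mono2 mult_nonneg_nonneg zero_le_power) (auto simp del: power_Suc)
    also have "\<dots> = (\<Sum>r<t. 2 * x ^ Suc r * (\<Sum>s<t. (1 - min_step ^ Suc r) ^ (s div Suc r)))"
      by (subst sum.swap) (simp add: sum_distrib_left)
    also have "\<dots> \<le> (\<Sum>r<t. 2 * (1 / 2) ^ Suc r)"
    proof (rule sum_mono)
      fix r
      have d: "0 < min_step ^ Suc r" "min_step ^ Suc r \<le> 1" using min_step by (auto intro!: power_le_one zero_less_power simp del: power_Suc)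
      have "(\<Sum>s<t. (1 - min_step ^ Suc r) ^ (s div Suc r)) \<le> real (Suc r) / (1 - (1 - min_step ^ Suc r))"
        using d by (intro sum_div_power_le) (simp_all del: power_Suc)
      then have "x ^ Suc r * (\<Sum>s<t. (1 - min_step ^ Suc r) ^ (s div Suc r)) \<le> (min_step / 4) ^ Suc r * (real (Suc r) / min_step ^ Suc r)"
        using x0 x4 d by (intro mult_mono power_mono) (auto intro!: sum_nonneg simp del: power_Suc)
      also have "\<dots> = real (Suc r) * (1 / 4) ^ Suc r"
        using min_step(1) by (simp add: power_divide del: power_Suc)
      also have "\<dots> \<le> 2 ^ Suc r * (1 / 4) ^ Suc r"
      proof -
        have "real (Suc r) < 2 ^ Suc r" by (metis less_exp of_nat_less_iff of_nat_numeral of_nat_power)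
        then show ?thesis by (intro mult_right_mono) auto
      qed
      also have "\<dots> = (1 / 2) ^ Suc r" by (simp add: power_mult_distrib[symmetric] del: power_Suc)
      finally show "2 * x ^ Suc r * (\<Sum>s<t. (1 - min_step ^ Suc r) ^ (s div Suc r)) \<le> 2 * (1 / 2) ^ Suc r"
        by (simp only: mult.assoc)
    qed
    also have "\<dots> = (\<Sum>r<t. (1 / 2) ^ r)" by simp
    also have "\<dots> = (1 - (1 / 2) ^ t) / (1 - 1 / 2 :: real)" by (simp add: sum_gp_strict)
    also have "\<dots> \<le> 4"
    proof -
      have "0 \<le> (1 / 2 :: real) ^ t" by simp
      then show ?thesis by (simp add: field_simps)
    qed
    finally show ?thesis .
  qed
  have "(\<integral>\<^sup>+\<omega>. total_visits E v \<omega> \<partial>parking_measure K p) \<le> ennreal 4"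
    unfolding nn_integral_total_visits by (intro SUP_least ennreal_leI bound)
  also have "\<dots> < \<infinity>" by simp
  finally show ?thesis .
qed

end

theorem theorem2p1:
  fixes E :: "'v \<Rightarrow> 'v \<Rightarrow> bool"
    and K :: "'v \<Rightarrow> 'v \<Rightarrow> real"
    and \<Gamma> :: "('v \<Rightarrow> 'v) set"
  assumes "simple_graph E"
    and "locally_finite_graph E"
    and "connected_graph E"
    and "markov_kernel E K"
    and "subgroup \<Gamma> (kernel_aut_group E K)"
    and "transitive_triple \<Gamma>"
    and "unimodular_triple \<Gamma>"
    and "infinitely_accessible E K \<Gamma>"
  shows "(\<forall>p\<in>{0..1}. p \<ge> 1/2 \<longrightarrow> (\<forall>v.
           (AE \<omega> in parking_measure K p. total_visits E v \<omega> = \<infinity>) \<and>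
           (\<forall>t. (\<integral>\<^sup>+ \<omega>. visits E v t \<omega> \<partial>parking_measure K p) < \<infinity>) \<and>
           (\<lambda>t. enn2real (\<integral>\<^sup>+ \<omega>. visits E v t \<omega> \<partial>parking_measure K p) - (2 * p - 1) * real t)
             \<in> o(\<lambda>t. real t))) \<and>
         (\<forall>p\<in>{0..1}. p < 1/2 \<longrightarrow> (\<forall>v.
           AE \<omega> in parking_measure K p. total_visits E v \<omega> < \<infinity>)) \<and>
         (\<exists>p\<^sub>0>0. \<forall>p\<in>{0..1}. p < p\<^sub>0 \<longrightarrow> (\<forall>v.
           (\<integral>\<^sup>+ \<omega>. total_visits E v \<omega> \<partial>parking_measure K p) < \<infinity>))"
proof -
  interpret parking_graph E K \<Gamma> using assms by (rule parking_graph.intro)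
  show ?thesis
  proof (intro conjI ballI impI allI)
    fix p :: real and v assume p: "p \<in> {0..1}" "1/2 \<le> p"
    show "AE \<omega> in parking_measure K p. total_visits E v \<omega> = \<infinity>"
      using p total_visits_infinite_1[of v] total_visits_infinite_lt_1[OF p, of v] by (cases "p = 1") auto
    \<comment> \<open>This gives the asymptotics their meaning, since \<open>enn2real\<close> would
      send an infinite expectation to 0.\<close>
    show "(\<integral>\<^sup>+ \<omega>. visits E v t \<omega> \<partial>parking_measure K p) < \<infinity>" for t
      by (simp add: nn_integral_visits)
    show "(\<lambda>t. enn2real (\<integral>\<^sup>+ \<omega>. visits E v t \<omega> \<partial>parking_measure K p) - (2 * p - 1) * real t) \<in> o(\<lambda>t. real t)"
      by (rule expected_visits_asymp[OF p])
  next
    fix p :: real and v assume "p \<in> {0..1}" "p < 1/2"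
    then show "AE \<omega> in parking_measure K p. total_visits E v \<omega> < \<infinity>" by (rule total_visits_finite)
  next
    show "\<exists>p\<^sub>0>0. \<forall>p\<in>{0..1}. p < p\<^sub>0 \<longrightarrow> (\<forall>v. (\<integral>\<^sup>+ \<omega>. total_visits E v \<omega> \<partial>parking_measure K p) < \<infinity>)"
      using expected_total_visits_finite min_step(1) deg_pos by (intro exI[of _ "(min_step / (8 * real deg ^ 2)) ^ 2"]) auto
  qed
qed

end
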